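(* Let $G(k)$ be a bypass-commutative algebraic $N\times N$ matrix function (in particular its Riemann surface is balanced), with $\det G\not\equiv 0$. Then there exists a rational matrix $S(k)$ such that the matrix $G(k)S(k)$ is branch-commutative.
   Context: Setting. $G(k)$ is an $N\times N$ matrix whose entries are algebraic functions of $k\in\mathbb C$. A branch of $G$ is fixed in a narrow strip $-\epsilon<\mathrm{Im}\,k<\epsilon$ along the real axis. The branch points of $G$ lie off the real axis (outside the strip); their affixes (projections to the $k$-plane) are $\tau_m^+$ with $\mathrm{Im}\,\tau_m^+>0$ and $\tau_m^-$ with $\mathrm{Im}\,\tau_m^-<0$. A rational matrix is a matrix whose entries are rational functions of $k$. Bypasses. Draw pairwise disjoint cuts $\gamma_m^+$ from $\tau_m^+$ to infinity in the upper half-plane and $\gamma_m^-$ from $\tau_m^-$ to infinity in the lower half-plane, none meeting the real axis. The branch of $G$ on the cut plane extending the fixed branch on the strip is called the physical sheet. The letters $a_i$ (resp. $b_i$) denote bypasses in the positive direction about $\tau_i^+$ (resp. $\tau_i^-$), i.e. closed paths based at $k$ crossing $\gamma_i^+$ (resp. $\gamma_i^-$) once and no other cut. A word in these letters denotes the consecutive bypasses, read from left to right (leftmost performed first); $e$ is the trivial word. $\mathcal W$ is the set of all words, and $\mathcal W_a$, $\mathcal W_b$ are the sets of words composed only of letters $a_i$, respectively only of letters $b_i$ (both containing $e$). For an algebraic matrix $F$, $F(k)\{w\}$ is the value at $k$ obtained by analytic continuation of $F$ along $w$ starting from the physical value $F(k)\{e\}$; $G^{-1}(k)\{w\}$ is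 the inverse of $G(k)\{w\}$. Balanced. The Riemann surface of $G$ is called balanced if for any $w\in\mathcal W$ there exist words $w_a\in\mathcal W_a$ and $w_b\in\mathcal W_b$ such that $G(k)\{w_a\}=G(k)\{w_b\}=G(k)\{w\}$ (identically in $k$). Basic bypass matrices. Let $G$ have a balanced Riemann surface with $n$ sheets. Let $w_1,\dots,w_{n-1}\in\mathcal W_b$ be any words such that the $G(k)\{w_j\}$ belong to pairwise different sheets of the Riemann surface of $G$, none of which is the physical one. The basic bypass matrices are $\hat P_j(k)=G(k)\{w_j\}\,G^{-1}(k)\{e\}$, $j=1,\dots,n-1$. Bypass-commutative. An algebraic matrix $G$ with balanced Riemann surface is called bypass-commutative if all basic bypass matrices commute with each other: $\hat P_j(k)\hat P_m(k)=\hat P_m(k)\hat P_j(k)$ for $j,m=1,\dots,n-1$. Branch-commutative. An algebraic matrix $F$ is called branch-commutative if for any $k$ the values of $F$ on different sheets of its Riemann surface commute, i.e. $F(k)\{w_1\}\,F(k)\{w_2\}-F(k)\{w_2\}\,F(k)\{w_1\}=0$ for any different words $w_1,w_2$. *)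

theory Defs
  imports "HOL-Complex_Analysis.Complex_Analysis"
begin

text \<open>Matrix functions are meromorphic, so their values at isolated points carry no meaning.
  An identity between them on an open set \<open>A\<close> is therefore stated as \<open>\<forall>\<^sub>\<approx>k\<in>A. \<dots>\<close>,
  i.e. off a set without limit points in \<open>A\<close>.\<close>

definition matrix_meromorphic_on ::
    "(complex \<Rightarrow> complex ^ 'n ^ 'n) \<Rightarrow> complex set \<Rightarrow> bool" where
  "matrix_meromorphic_on F A \<longleftrightarrow> (\<forall>i j. (\<lambda>k. F k $ i $ j) meromorphic_on A)"

definition strip :: "real \<Rightarrow> complex set" where
  "strip \<epsilon> = {k. \<bar>Im k\<bar> < \<epsilon>}"

text \<open>In \<open>poly (poly P [:y:]) k\<close> the outer variable of \<open>P\<close> is replaced by the constant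
  polynomial \<open>y\<close> and the inner one by \<open>k\<close>: this is the bivariate polynomial \<open>P(k, y)\<close>.\<close>

definition algebraic_matrix_on ::
    "(complex \<Rightarrow> complex ^ 'n ^ 'n) \<Rightarrow> complex set \<Rightarrow> bool" where
  "algebraic_matrix_on F A \<longleftrightarrow> matrix_meromorphic_on F A \<and>
     (\<forall>i j. \<exists>P :: complex poly poly. P \<noteq> 0 \<and> (\<forall>\<^sub>\<approx>k\<in>A. poly (poly P [:F k $ i $ j:]) k = 0))"

definition rational_matrix :: "(complex \<Rightarrow> complex ^ 'n ^ 'n) \<Rightarrow> bool" where
  "rational_matrix S \<longleftrightarrow>
     (\<forall>i j. \<exists>p q :: complex poly. q \<noteq> 0 \<and> (\<forall>k. S k $ i $ j = poly p k / poly q k))"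

text \<open>Analytic continuation of the germ of \<open>F\<close> at the start of \<open>g\<close> along \<open>g\<close> yields the germ
  of \<open>H\<close> at the end of \<open>g\<close>. The germs are meromorphic, so \<open>g\<close> may run through poles.\<close>

definition continuation ::
    "(complex \<Rightarrow> complex ^ 'n ^ 'n) \<Rightarrow> (real \<Rightarrow> complex) \<Rightarrow> (complex \<Rightarrow> complex ^ 'n ^ 'n) \<Rightarrow> bool" where
  "continuation F g H \<longleftrightarrow>
     (\<exists>f. (\<forall>t\<in>{0..1}. matrix_meromorphic_on (f t) {g t}) \<and>
          (\<forall>t\<in>{0..1}. \<forall>\<^sub>F s in at t within {0..1}. \<forall>\<^sub>F k in at (g s). f s k = f t k) \<and>
          (\<forall>\<^sub>F k in at (g 0). f 0 k = F k) \<and>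
          (\<forall>\<^sub>F k in at (g 1). f 1 k = H k))"

text \<open>Affixes of the branch points: since poles do not obstruct a meromorphic continuation,
  the only obstructions for an algebraic \<open>F\<close> are its (finite) branch points. A point may be a
  branch point for some of the paths leading to it and a regular point for others.\<close>

definition branch_points :: "(complex \<Rightarrow> complex ^ 'n ^ 'n) \<Rightarrow> complex set" where
  "branch_points F =
     {z. \<exists>g. path g \<and> Im (pathstart g) = 0 \<and> pathfinish g = z \<and>
             (\<forall>t\<in>{0..<1}. \<exists>H. continuation F (subpath 0 t g) H) \<and>
             \<not> (\<exists>H. continuation F g H)}"

text \<open>\<open>A i\<close> is the bypass about the \<open>i\<close>-th upper branch point, \<open>B i\<close> about the \<open>i\<close>-th lower one.\<close>

datatype letter = A nat | B nat

text \<open>\<open>\<gamma> l\<close> parametrises the cut attached to the letter \<open>l\<close>; it starts at the branch point.\<close>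

locale cut_system =
  fixes p q :: nat and \<gamma> :: "letter \<Rightarrow> real \<Rightarrow> complex"
  assumes cut_continuous: "l \<in> A ` {..<p} \<union> B ` {..<q} \<Longrightarrow> continuous_on {0..} (\<gamma> l)"
    and cut_inj: "l \<in> A ` {..<p} \<union> B ` {..<q} \<Longrightarrow> inj_on (\<gamma> l) {0..}"
    and cut_to_infinity: "l \<in> A ` {..<p} \<union> B ` {..<q} \<Longrightarrow> filterlim (\<gamma> l) at_infinity at_top"
    and cut_upper: "i < p \<Longrightarrow> 0 \<le> t \<Longrightarrow> Im (\<gamma> (A i) t) > 0"
    and cut_lower: "j < q \<Longrightarrow> 0 \<le> t \<Longrightarrow> Im (\<gamma> (B j) t) < 0"
    and cut_disjoint: "l \<in> A ` {..<p} \<union> B ` {..<q} \<Longrightarrow> m \<in> A ` {..<p} \<union> B ` {..<q} \<Longrightarrow>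
          l \<noteq> m \<Longrightarrow> \<gamma> l ` {0..} \<inter> \<gamma> m ` {0..} = {}"
begin

definition letters :: "letter set" where
  "letters = A ` {..<p} \<union> B ` {..<q}"

definition words :: "letter list set" where
  "words = lists letters"

definition words_a :: "letter list set" where
  "words_a = lists (A ` {..<p})"

definition words_b :: "letter list set" where
  "words_b = lists (B ` {..<q})"

definition cut :: "letter \<Rightarrow> complex set" where
  "cut l = \<gamma> l ` {0..}"

definition \<tau> :: "letter \<Rightarrow> complex" where
  "\<tau> l = \<gamma> l 0"

definition cut_plane :: "complex set" where
  "cut_plane = - (\<Union>l\<in>letters. cut l)"

text \<open>A loop based at \<open>k\<close> that crosses the cut of \<open>l\<close> once, meets no other cut, and turns in the
  positive direction about \<open>\<tau> l\<close>. The cut is an arbitrary arc, so a single crossing may run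
  along it for a while: the crossing times form an interval, possibly a single point. That
  the loop crosses, rather than merely touches the cut, is the winding number.\<close>

definition bypass :: "letter \<Rightarrow> complex \<Rightarrow> (real \<Rightarrow> complex) \<Rightarrow> bool" where
  "bypass l k g \<longleftrightarrow>
     path g \<and> pathstart g = k \<and> pathfinish g = k \<and>
     connected {t\<in>{0..1}. g t \<in> cut l} \<and>
     (\<forall>m\<in>letters - {l}. path_image g \<inter> cut m = {}) \<and>
     \<tau> l \<notin> path_image g \<and> winding_number g (\<tau> l) = 1"

fun word_loop :: "letter list \<Rightarrow> complex \<Rightarrow> (real \<Rightarrow> complex) \<Rightarrow> bool" where
  "word_loop [] k g \<longleftrightarrow> g = (\<lambda>_. k)"
| "word_loop (l # w) k g \<longleftrightarrow> (\<exists>g\<^sub>1 g\<^sub>2. bypass l k g\<^sub>1 \<and> word_loop w k g\<^sub>2 \<and> g = g\<^sub>1 +++ g\<^sub>2)"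

text \<open>\<open>F\<close> is a branch fixed near the real axis. It is continued inside the cut plane to \<open>k\<close>,
  which gives the physical value at \<open>k\<close>, and then along the loop of the word \<open>w\<close>.\<close>

definition is_branch ::
    "(complex \<Rightarrow> complex ^ 'n ^ 'n) \<Rightarrow> letter list \<Rightarrow> (complex \<Rightarrow> complex ^ 'n ^ 'n) \<Rightarrow> bool" where
  "is_branch F w H \<longleftrightarrow>
     matrix_meromorphic_on H cut_plane \<and>
     (\<forall>k\<in>cut_plane. \<forall>c g.
        path c \<and> path_image c \<subseteq> cut_plane \<and> Im (pathstart c) = 0 \<and> pathfinish c = k \<and>
        word_loop w k g \<longrightarrow> continuation F (c +++ g) H)"

text \<open>\<open>branch F w k\<close> is \<open>F(k){w}\<close>; as a function of \<open>k\<close> it is determined on the cut plane up to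
  its values at isolated points.\<close>

definition branch ::
    "(complex \<Rightarrow> complex ^ 'n ^ 'n) \<Rightarrow> letter list \<Rightarrow> complex \<Rightarrow> complex ^ 'n ^ 'n" where
  "branch F w = (SOME H. is_branch F w H)"

definition same_sheet :: "(complex \<Rightarrow> complex ^ 'n ^ 'n) \<Rightarrow> letter list \<Rightarrow> letter list \<Rightarrow> bool" where
  "same_sheet F v w \<longleftrightarrow> (\<forall>\<^sub>\<approx>k\<in>cut_plane. branch F v k = branch F w k)"

definition sheet_count :: "(complex \<Rightarrow> complex ^ 'n ^ 'n) \<Rightarrow> nat" where
  "sheet_count F = card (words // {(v, w). v \<in> words \<and> w \<in> words \<and> same_sheet F v w})"

definition balanced :: "(complex \<Rightarrow> complex ^ 'n ^ 'n) \<Rightarrow> bool" where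
  "balanced F \<longleftrightarrow>
     (\<forall>w\<in>words. \<exists>w\<^sub>a\<in>words_a. \<exists>w\<^sub>b\<in>words_b. same_sheet F w\<^sub>a w \<and> same_sheet F w\<^sub>b w)"

definition basic_bypass_words :: "(complex \<Rightarrow> complex ^ 'n ^ 'n) \<Rightarrow> letter list list \<Rightarrow> bool" where
  "basic_bypass_words F ws \<longleftrightarrow>
     length ws = sheet_count F - 1 \<and> set ws \<subseteq> words_b \<and>
     (\<forall>i<length ws. \<not> same_sheet F (ws ! i) []) \<and>
     (\<forall>i<length ws. \<forall>j<length ws. i \<noteq> j \<longrightarrow> \<not> same_sheet F (ws ! i) (ws ! j))"

definition bypass_matrix ::
    "(complex \<Rightarrow> complex ^ 'n ^ 'n) \<Rightarrow> letter list \<Rightarrow> complex \<Rightarrow> complex ^ 'n ^ 'n" where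
  "bypass_matrix F w k = branch F w k ** matrix_inv (branch F [] k)"

text \<open>Any two admissible choices of words give the same basic bypass matrices up to order.\<close>

definition bypass_commutative :: "(complex \<Rightarrow> complex ^ 'n ^ 'n) \<Rightarrow> bool" where
  "bypass_commutative F \<longleftrightarrow> balanced F \<and>
     (\<forall>ws. basic_bypass_words F ws \<longrightarrow>
        (\<forall>j<length ws. \<forall>m<length ws. \<forall>\<^sub>\<approx>k\<in>cut_plane.
           bypass_matrix F (ws ! j) k ** bypass_matrix F (ws ! m) k =
           bypass_matrix F (ws ! m) k ** bypass_matrix F (ws ! j) k))"

definition branch_commutative :: "(complex \<Rightarrow> complex ^ 'n ^ 'n) \<Rightarrow> bool" where
  "branch_commutative F \<longleftrightarrow>
     (\<forall>w\<^sub>1\<in>words. \<forall>w\<^sub>2\<in>words. w\<^sub>1 \<noteq> w\<^sub>2 \<longrightarrow>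
        (\<forall>\<^sub>\<approx>k\<in>cut_plane. branch F w\<^sub>1 k ** branch F w\<^sub>2 k - branch F w\<^sub>2 k ** branch F w\<^sub>1 k = 0))"

end

end

theory Submission
  imports Defs
begin

text \<open>Let \<open>G\<^sub>0, \<dots>, G\<^sub>n\<^sub>-\<^sub>1\<close> be the sheets of \<open>G\<close>, \<open>G\<^sub>0\<close> the physical one, and \<open>P\<^sub>i = G\<^sub>i G\<^sub>0\<^sup>-\<^sup>1\<close>.
  For a scalar \<open>h\<close> that is polynomial in the entries of a matrix put \<open>S = \<Sum>\<^sub>i h(G\<^sub>i) adj(G\<^sub>i)\<close>.
  Then \<open>G\<^sub>0 S\<close> is a combination of the \<open>P\<^sub>i\<^sup>-\<^sup>1\<close>, so it commutes with all \<open>P\<^sub>j\<close>; as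
  \<open>G\<^sub>j S = P\<^sub>j (G\<^sub>0 S)\<close>, the branches of \<open>G S\<close> commute. A bypass permutes the sheets, hence \<open>S\<close> is
  single-valued; after multiplication by a polynomial its entries are bounded polynomially, so by
  Liouville's theorem they are rational. If \<open>h\<close> is nonzero at \<open>G\<^sub>0(z\<^sub>0)\<close> and vanishes at the other
  \<open>G\<^sub>i(z\<^sub>0)\<close>, then \<open>S\<close> is invertible at \<open>z\<^sub>0\<close>.

  That the branches along words are well defined rests on the monodromy theorem for meromorphic germs
  and on two facts about arbitrary cuts: slit planes are simply connected (Janiszewski), and every
  point of the cut plane has a bypass about every branch point (Jordan).\<close>

subsection \<open>Meromorphic germs and their continuation along paths\<close>

text \<open>The weight h keeps \<open>S\<close> from degenerating: for G = diag(r, 1) with a square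
  root r, the adjugates diag(1, r) and diag(1, -r) of the two sheets add up to the singular matrix
  diag(2, 0). The adjugate is used because, like h, it is polynomial in the entries, so growth
  bounds and analyticity at z_0 pass to \<open>S\<close>; where det(G_i) is nonzero it is a multiple
  of the inverse, and this form gives the commutation. Commutativity is assumed for words in the
  letters \<open>B j\<close> only; balance provides such a word on every sheet. The topological
  obstacle is that \<open>is_branch\<close> quantifies over all bypasses and says nothing if there
  is none. Existence of a branch requires that loops of winding number one in a punctured slit plane
  are homotopic; its uniqueness requires a bypass at every point. A cut is merely a continuous arc
  and has no evident sides, so both facts are obtained on the logarithmic cover, where a winding
  number becomes a difference of endpoints.\<close>

lemma eventually_at_nhds_at:
  fixes z :: "'a :: t1_space"
  assumes "eventually P (at z)"
  shows "eventually (\<lambda>w. eventually P (at w)) (nhds z)"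
proof -
  obtain S where S: "open S" "z \<in> S" "\<And>w. w \<in> S \<Longrightarrow> w \<noteq> z \<Longrightarrow> P w"
    using assms unfolding eventually_at_topological by blast
  have "eventually P (at w)" if w: "w \<in> S" for w
  proof (cases "w = z")
    case False
    have "open (S - {z})" using S by auto
    then show ?thesis
      unfolding eventually_at_topological using False w S by blast
  qed (use assms in auto)
  then show ?thesis
    using S eventually_nhds by blast
qed

text \<open>Truth and falsity of \<open>P\<close> both define relatively open subsets of
  \<open>I\<close>. Uniqueness along a path and invariance under homotopy are reduced to it: the
  truth value of a claim is shown to be locally constant in the parameter.\<close>

lemma connected_induction_eventually:
  fixes I :: "'a :: topological_space set"
  assumes I: "connected I" and P: "\<And>t. t \<in> I \<Longrightarrow> \<forall>\<^sub>F s in at t within I. P s \<longleftrightarrow> P t"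
    and a: "a \<in> I" "P a" and b: "b \<in> I"
  shows "P b"
proof (rule ccontr)
  assume nb: "\<not> P b"
  have "openin (top_of_set I) {t\<in>I. P t = c}" for c
  proof (subst openin_subopen, intro ballI)
    fix t assume t: "t \<in> {t\<in>I. P t = c}"
    then obtain S where S: "open S" "t \<in> S" "\<And>s. s \<in> S \<Longrightarrow> s \<noteq> t \<Longrightarrow> s \<in> I \<Longrightarrow> P s \<longleftrightarrow> P t"
      using P[of t] unfolding eventually_at_topological by auto
    have "I \<inter> S \<subseteq> {t\<in>I. P t = c}" using S t by blast
    moreover have "t \<in> I \<inter> S" using S t by blast
    moreover have "openin (top_of_set I) (I \<inter> S)" using S by blast
    ultimately show "\<exists>T. openin (top_of_set I) T \<and> t \<in> T \<and> T \<subseteq> {t\<in>I. P t = c}" by blast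
  qed
  from this[of True] this[of False] have "openin (top_of_set I) {t\<in>I. P t}" "openin (top_of_set I) {t\<in>I. \<not> P t}"
    by auto
  moreover have "{t\<in>I. P t} \<inter> {t\<in>I. \<not> P t} = {}" "I \<subseteq> {t\<in>I. P t} \<union> {t\<in>I. \<not> P t}" by auto
  ultimately have "{t\<in>I. P t} = {} \<or> {t\<in>I. \<not> P t} = {}"
    using I unfolding connected_openin by blast
  then show False using a b nb by blast
qed

section \<open>Matrices of meromorphic functions and the identity theorem\<close>

lemma matrix_meromorphic_on_subset:
  "matrix_meromorphic_on F D \<Longrightarrow> D' \<subseteq> D \<Longrightarrow> matrix_meromorphic_on F D'"
  unfolding matrix_meromorphic_on_def using meromorphic_on_subset by blast

lemma matrix_meromorphic_on_iff:
  "matrix_meromorphic_on F D \<longleftrightarrow> (\<forall>z\<in>D. matrix_meromorphic_on F {z})"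
  unfolding matrix_meromorphic_on_def using meromorphic_on_meromorphic_at by blast

lemma matrix_meromorphic_on_cong:
  fixes F H :: "complex \<Rightarrow> complex ^ 'n ^ 'n"
  assumes "\<And>z. z \<in> D \<Longrightarrow> \<forall>\<^sub>F k in at z. F k = H k" "matrix_meromorphic_on F D"
  shows "matrix_meromorphic_on H D"
  unfolding matrix_meromorphic_on_def
proof (intro allI)
  fix i j
  have "(\<lambda>k. F k $ i $ j) meromorphic_on D \<longleftrightarrow> (\<lambda>k. H k $ i $ j) meromorphic_on D"
  proof (rule meromorphic_on_cong)
    fix z assume "z \<in> D"
    then show "\<forall>\<^sub>F w in at z. F w $ i $ j = H w $ i $ j"
      by (rule eventually_mono[OF assms(1)]) simp
  qed simp
  then show "(\<lambda>k. H k $ i $ j) meromorphic_on D"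
    using assms(2) by (simp add: matrix_meromorphic_on_def)
qed

lemma matrix_meromorphic_on_nhd:
  fixes F :: "complex \<Rightarrow> complex ^ 'n ^ 'n"
  assumes "matrix_meromorphic_on F {z}"
  obtains r where "r > 0" "matrix_meromorphic_on F (ball z r)"
proof -
  have "\<exists>V. open V \<and> z \<in> V \<and> (\<lambda>k. F k $ i $ j) meromorphic_on V" for i j
    using assms meromorphic_on_open_nhd[of "\<lambda>k. F k $ i $ j" "{z}"]
    unfolding matrix_meromorphic_on_def by (metis insert_subset)
  then obtain V where V: "\<And>i j. open (V i j)" "\<And>i j. z \<in> V i j"
    "\<And>i j. (\<lambda>k. F k $ i $ j) meromorphic_on V i j" by metis
  have "open (\<Inter>i. \<Inter>j. V i j)" using V(1) by (intro open_INT) auto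
  moreover have "z \<in> (\<Inter>i. \<Inter>j. V i j)" using V by auto
  ultimately obtain r where r: "r > 0" "ball z r \<subseteq> (\<Inter>i. \<Inter>j. V i j)"
    using open_contains_ball by meson
  have "matrix_meromorphic_on F (ball z r)"
    unfolding matrix_meromorphic_on_def using V(3) r(2) by (blast intro: meromorphic_on_subset)
  then show ?thesis using r that by blast
qed

text \<open>Each entry of the difference is either zero or nonzero off a set without limit points,
  and frequent equality at one point excludes the second case. Hence germs that are not equal are
  eventually different, which later separates the sheets at generic points.\<close>

lemma matrix_meromorphic_eqI:
  fixes F H :: "complex \<Rightarrow> complex ^ 'n ^ 'n"
  assumes "matrix_meromorphic_on F D" "matrix_meromorphic_on H D" "open D" "connected D"
    and "z \<in> D" "\<exists>\<^sub>F k in at z. F k = H k" "w \<in> D"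
  shows "\<forall>\<^sub>F k in at w. F k = H k"
proof -
  have "\<forall>\<^sub>F k in at w. F k $ i $ j = H k $ i $ j" for i j
  proof -
    let ?d = "\<lambda>k. F k $ i $ j - H k $ i $ j"
    have m: "?d meromorphic_on D"
      using assms(1,2) unfolding matrix_meromorphic_on_def by (intro meromorphic_intros) auto
    have "\<not> (\<forall>\<^sub>\<approx>k\<in>D. ?d k \<noteq> 0)"
    proof
      assume "\<forall>\<^sub>\<approx>k\<in>D. ?d k \<noteq> 0"
      then have "\<forall>\<^sub>F k in at z. ?d k \<noteq> 0"
        using assms by (simp add: eventually_cosparse_open_eq)
      with assms(6) have "\<exists>\<^sub>F k in at z. F k = H k \<and> ?d k \<noteq> 0"
        by (rule frequently_eventually_frequently)
      then show False by (auto dest!: frequently_ex)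
    qed
    then have "\<forall>\<^sub>\<approx>k\<in>D. ?d k = 0"
      using meromorphic_imp_constant_or_avoid[OF m assms(3,4)] by blast
    then show ?thesis
      using assms by (simp add: eventually_cosparse_open_eq)
  qed
  then have "\<forall>\<^sub>F k in at w. \<forall>i j. F k $ i $ j = H k $ i $ j"
    by (intro eventually_all_finite) auto
  then show ?thesis by (simp add: vec_eq_iff)
qed

lemma matrix_meromorphic_eqI':
  fixes F H :: "complex \<Rightarrow> complex ^ 'n ^ 'n"
  assumes "matrix_meromorphic_on F D" "matrix_meromorphic_on H D" "open D" "connected D"
    and "z \<in> D" "\<forall>\<^sub>F k in at z. F k = H k" "w \<in> D"
  shows "\<forall>\<^sub>F k in at w. F k = H k"
  using matrix_meromorphic_eqI[OF assms(1-5) _ assms(7)] assms(6)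
  by (simp add: eventually_frequently)

text \<open>The local condition in \<open>continuation\<close>, freed from the endpoint conditions
  and from the interval {0..1}, so that it can be restricted, reparametrised and glued.\<close>

definition germ_family ::
    "(real \<Rightarrow> complex \<Rightarrow> complex ^ 'n ^ 'n) \<Rightarrow> (real \<Rightarrow> complex) \<Rightarrow> real set \<Rightarrow> bool" where
  "germ_family f g I \<longleftrightarrow> (\<forall>t\<in>I. matrix_meromorphic_on (f t) {g t}) \<and>
     (\<forall>t\<in>I. \<forall>\<^sub>F s in at t within I. \<forall>\<^sub>F k in at (g s). f s k = f t k)"

lemma continuation_iff:
  "continuation F g H \<longleftrightarrow> (\<exists>f. germ_family f g {0..1} \<and>
     (\<forall>\<^sub>F k in at (g 0). f 0 k = F k) \<and> (\<forall>\<^sub>F k in at (g 1). f 1 k = H k))"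
  unfolding continuation_def germ_family_def by blast

lemma germ_family_subset:
  "germ_family f g I \<Longrightarrow> J \<subseteq> I \<Longrightarrow> germ_family f g J"
  unfolding germ_family_def by (meson at_le filter_leD subsetD)

lemma at_within_compose_nhds:
  assumes "continuous_on I (g :: real \<Rightarrow> complex)" "t \<in> I" "eventually P (nhds (g t))"
  shows "\<forall>\<^sub>F s in at t within I. P (g s)"
  using assms by (metis continuous_on_def eventually_compose_filterlim)

text \<open>Equality of the two germs is locally constant in the parameter: on a ball around
  \<open>g t\<close> both \<open>f t\<close> and \<open>f' t\<close> are meromorphic, and the
  identity theorem carries equality between \<open>g s\<close> and \<open>g t\<close> in either
  direction.\<close>

lemma germ_family_unique:
  fixes f f' :: "real \<Rightarrow> complex \<Rightarrow> complex ^ 'n ^ 'n"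
  assumes f: "germ_family f g I" and f': "germ_family f' g I"
    and g: "continuous_on I g" and I: "connected I"
    and a: "a \<in> I" "\<forall>\<^sub>F k in at (g a). f a k = f' a k" and b: "b \<in> I"
  shows "\<forall>\<^sub>F k in at (g b). f b k = f' b k"
proof -
  let ?P = "\<lambda>t. \<forall>\<^sub>F k in at (g t). f t k = f' t k"
  have "\<forall>\<^sub>F s in at t within I. ?P s = ?P t" if t: "t \<in> I" for t
  proof -
    have ft: "matrix_meromorphic_on (f t) {g t}" "matrix_meromorphic_on (f' t) {g t}"
      using f f' t unfolding germ_family_def by auto
    obtain r1 where r1: "r1 > 0" "matrix_meromorphic_on (f t) (ball (g t) r1)"
      using matrix_meromorphic_on_nhd[OF ft(1)] .
    obtain r2 where r2: "r2 > 0" "matrix_meromorphic_on (f' t) (ball (g t) r2)"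
      using matrix_meromorphic_on_nhd[OF ft(2)] .
    define r where "r = min r1 r2"
    have r: "r > 0" "matrix_meromorphic_on (f t) (ball (g t) r)"
      "matrix_meromorphic_on (f' t) (ball (g t) r)"
      using r1 r2 by (auto simp: r_def intro: matrix_meromorphic_on_subset)
    have 1: "\<forall>\<^sub>F s in at t within I. g s \<in> ball (g t) r"
      using r(1) by (intro at_within_compose_nhds[OF g t] eventually_nhds_in_open) auto
    have 2: "\<forall>\<^sub>F s in at t within I. \<forall>\<^sub>F k in at (g s). f s k = f t k"
      "\<forall>\<^sub>F s in at t within I. \<forall>\<^sub>F k in at (g s). f' s k = f' t k"
      using f f' t unfolding germ_family_def by auto
    show ?thesis using 1 2
    proof eventually_elim
      case (elim s)
      have "?P s \<longleftrightarrow> (\<forall>\<^sub>F k in at (g s). f t k = f' t k)"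
        using elim(2,3) by (intro eventually_cong[OF eventually_conj[OF elim(2,3)]]) auto
      also have "\<dots> \<longleftrightarrow> ?P t"
        using matrix_meromorphic_eqI'[OF r(2,3), of "g s" "g t"]
          matrix_meromorphic_eqI'[OF r(2,3), of "g t" "g s"] elim(1) r(1) by auto
      finally show ?case .
    qed
  qed
  then show ?thesis
    using connected_induction_eventually[OF I, of ?P a b] a b by simp
qed

text \<open>The members are exchanged for functions with the same germs, not merely for equal
  functions; the joint of two paths needs this.\<close>

lemma germ_family_germ_cong:
  assumes f: "germ_family f g I" and g: "continuous_on I g"
    and e: "\<And>t. t \<in> I \<Longrightarrow> \<forall>\<^sub>F k in at (g t). f t k = f' t k"
  shows "germ_family f' g I"
  unfolding germ_family_def
proof (intro conjI ballI)
  fix t assume t: "t \<in> I"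
  show "matrix_meromorphic_on (f' t) {g t}"
    using f e[OF t] t by (auto simp: germ_family_def intro: matrix_meromorphic_on_cong)
  have "\<forall>\<^sub>F s in at t within I. \<forall>\<^sub>F k in at (g s). f t k = f' t k"
    by (rule at_within_compose_nhds[OF g t eventually_at_nhds_at[OF e[OF t]]])
  moreover have "\<forall>\<^sub>F s in at t within I. \<forall>\<^sub>F k in at (g s). f s k = f t k"
    using f t by (simp add: germ_family_def)
  moreover have "\<forall>\<^sub>F s in at t within I. s \<in> I" by (simp add: eventually_at_filter)
  ultimately show "\<forall>\<^sub>F s in at t within I. \<forall>\<^sub>F k in at (g s). f' s k = f' t k"
  proof eventually_elim
    case (elim s)
    show ?case using elim(1,2) e[OF elim(3)] by eventually_elim simp
  qed
qed

lemma germ_family_cong: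
  assumes "germ_family f g I" "\<And>t. t \<in> I \<Longrightarrow> f' t = f t" "\<And>t. t \<in> I \<Longrightarrow> g' t = g t"
  shows "germ_family f' g' I"
  unfolding germ_family_def
proof (intro conjI ballI)
  fix t assume t: "t \<in> I"
  show "matrix_meromorphic_on (f' t) {g' t}" using assms t by (simp add: germ_family_def)
  have "\<forall>\<^sub>F s in at t within I. \<forall>\<^sub>F k in at (g s). f s k = f t k"
    using assms(1) t by (simp add: germ_family_def)
  moreover have "\<forall>\<^sub>F s in at t within I. s \<in> I" by (simp add: eventually_at_filter)
  ultimately show "\<forall>\<^sub>F s in at t within I. \<forall>\<^sub>F k in at (g' s). f' s k = f' t k"
    by eventually_elim (use assms(2,3) t in simp)
qed

lemma germ_family_affine:
  fixes a b :: real
  assumes f: "germ_family f g I" and ab: "\<And>s. s \<in> J \<Longrightarrow> a * s + b \<in> I"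
  shows "germ_family (\<lambda>s. f (a * s + b)) (\<lambda>s. g (a * s + b)) J"
  unfolding germ_family_def
proof (intro conjI ballI)
  fix t assume t: "t \<in> J"
  show "matrix_meromorphic_on (f (a * t + b)) {g (a * t + b)}"
    using f ab[OF t] by (simp add: germ_family_def)
  show "\<forall>\<^sub>F s in at t within J. \<forall>\<^sub>F k in at (g (a * s + b)). f (a * s + b) k = f (a * t + b) k"
  \<comment> \<open>For a = 0 the substitution is constant and does not approach its limit through a
    punctured neighbourhood; the two germs are then the same.\<close>
  proof (cases "a = 0")
    case False
    then have "filterlim (\<lambda>s. a * s + b) (at (a * t + b) within I) (at t within J)"
      unfolding filterlim_at using ab by (auto simp: eventually_at_filter intro!: tendsto_intros)
    moreover have "\<forall>\<^sub>F s in at (a * t + b) within I. \<forall>\<^sub>F k in at (g s). f s k = f (a * t + b) k"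
      using f ab[OF t] by (simp add: germ_family_def)
    ultimately show ?thesis by (rule eventually_compose_filterlim[rotated])
  qed simp
qed

lemma germ_family_union:
  fixes a b c :: real
  assumes "germ_family f g {a..b}" "germ_family f g {b..c}" "a \<le> b" "b \<le> c"
  shows "germ_family f g {a..c}"
  unfolding germ_family_def
proof (intro conjI ballI)
  fix t assume t: "t \<in> {a..c}"
  have *: "{a..c} = {a..b} \<union> {b..c}" using assms(3,4) by auto
  show "matrix_meromorphic_on (f t) {g t}"
    using assms(1,2) t unfolding * germ_family_def by blast
  have l: "\<forall>\<^sub>F s in at t within {a..b}. \<forall>\<^sub>F k in at (g s). f s k = f t k" if "t \<le> b"
    using assms(1) t that by (simp add: germ_family_def)
  have r: "\<forall>\<^sub>F s in at t within {b..c}. \<forall>\<^sub>F k in at (g s). f s k = f t k" if "t \<ge> b"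
    using assms(2) t that by (simp add: germ_family_def)
  \<comment> \<open>A point outside a closed interval is no limit point of it, so that half of the
    filter is trivial.\<close>
  have ne: "at t within {x..y} = bot" if "t \<notin> {x..y}" for x y
  proof -
    have "\<not> t islimpt {x..y}"
      using closed_limpt[of "{x..y}"] closed_real_atLeastAtMost that by blast
    then show ?thesis by (simp add: trivial_limit_within)
  qed
  show "\<forall>\<^sub>F s in at t within {a..c}. \<forall>\<^sub>F k in at (g s). f s k = f t k"
    unfolding * at_within_union eventually_sup
    using l r ne[of a b] ne[of b c] by (cases t b rule: linorder_cases) auto
qed

lemma germ_family_restrict:
  assumes "matrix_meromorphic_on F (g ` I)"
  shows "germ_family (\<lambda>_. F) g I"
  using assms unfolding germ_family_def by (auto intro: matrix_meromorphic_on_subset)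

lemma continuation_const:
  assumes "matrix_meromorphic_on F (path_image g)"
  shows "continuation F g F"
  unfolding continuation_iff path_image_def[symmetric]
  using germ_family_restrict[of F g "{0..1}"] assms unfolding path_image_def by fastforce

lemma continuation_meromorphic:
  assumes "continuation F g H"
  shows "matrix_meromorphic_on F {pathstart g}" "matrix_meromorphic_on H {pathfinish g}"
proof -
  obtain f where f: "germ_family f g {0..1}" "\<forall>\<^sub>F k in at (g 0). f 0 k = F k"
    "\<forall>\<^sub>F k in at (g 1). f 1 k = H k"
    using assms unfolding continuation_iff by blast
  have "matrix_meromorphic_on (f 0) {g 0}" "matrix_meromorphic_on (f 1) {g 1}"
    using f(1) unfolding germ_family_def by auto
  then show "matrix_meromorphic_on F {pathstart g}" "matrix_meromorphic_on H {pathfinish g}"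
    unfolding pathstart_def pathfinish_def using f(2,3)
    by (auto intro: matrix_meromorphic_on_cong)
qed

lemma continuation_cong:
  assumes "continuation F g H" "\<forall>\<^sub>F k in at (pathstart g). F k = F' k"
    "\<forall>\<^sub>F k in at (pathfinish g). H k = H' k"
  shows "continuation F' g H'"
proof -
  obtain f where f: "germ_family f g {0..1}" "\<forall>\<^sub>F k in at (g 0). f 0 k = F k"
    "\<forall>\<^sub>F k in at (g 1). f 1 k = H k"
    using assms unfolding continuation_iff by blast
  have "\<forall>\<^sub>F k in at (g 0). f 0 k = F' k"
    using eventually_conj[OF f(2) assms(2)[unfolded pathstart_def]] by (rule eventually_mono) simp
  moreover have "\<forall>\<^sub>F k in at (g 1). f 1 k = H' k"
    using eventually_conj[OF f(3) assms(3)[unfolded pathfinish_def]] by (rule eventually_mono) simp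
  ultimately show ?thesis using f(1) unfolding continuation_iff by blast
qed

lemma continuation_unique:
  assumes "continuation F g H" "continuation F' g H'" "path g"
    "\<forall>\<^sub>F k in at (pathstart g). F k = F' k"
  shows "\<forall>\<^sub>F k in at (pathfinish g). H k = H' k"
proof -
  have "continuation F' g H"
    using continuation_cong[OF assms(1,4), of H] by simp
  then obtain f where f: "germ_family f g {0..1}" "\<forall>\<^sub>F k in at (g 0). f 0 k = F' k"
    "\<forall>\<^sub>F k in at (g 1). f 1 k = H k"
    unfolding continuation_iff by blast
  obtain f' where f': "germ_family f' g {0..1}" "\<forall>\<^sub>F k in at (g 0). f' 0 k = F' k"
    "\<forall>\<^sub>F k in at (g 1). f' 1 k = H' k"
    using assms(2) unfolding continuation_iff by blast
  have "\<forall>\<^sub>F k in at (g 0). f 0 k = f' 0 k"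
    using eventually_conj[OF f(2) f'(2)] by (rule eventually_mono) simp
  then have "\<forall>\<^sub>F k in at (g 1). f 1 k = f' 1 k"
    using germ_family_unique[OF f(1) f'(1), of 0 1] \<open>path g\<close> by (simp add: path_def)
  then show ?thesis
    unfolding pathfinish_def using f(3) f'(3) by eventually_elim simp
qed

lemma continuation_reverse:
  assumes "continuation F g H"
  shows "continuation H (reversepath g) F"
proof -
  obtain f where f: "germ_family f g {0..1}" "\<forall>\<^sub>F k in at (g 0). f 0 k = F k"
    "\<forall>\<^sub>F k in at (g 1). f 1 k = H k"
    using assms unfolding continuation_iff by blast
  have "germ_family (\<lambda>t. f (1 - t)) (reversepath g) {0..1}"
    by (rule germ_family_cong[OF germ_family_affine[OF f(1), of "{0..1}" "-1" 1]])
       (auto simp: reversepath_def)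
  with f show ?thesis
    unfolding continuation_iff by (intro exI[of _ "\<lambda>t. f (1 - t)"]) (auto simp: reversepath_def)
qed

text \<open>Continuation can be run backwards, so the end germ determines the starting germ. This
  makes a bypass act injectively on the sheets and prevents a determinant from becoming zero on the
  way.\<close>

lemma continuation_unique_start:
  assumes "continuation F g H" "continuation F' g H'" "path g"
    "\<forall>\<^sub>F k in at (pathfinish g). H k = H' k"
  shows "\<forall>\<^sub>F k in at (pathstart g). F k = F' k"
  using continuation_unique[OF continuation_reverse[OF assms(1)] continuation_reverse[OF assms(2)]]
    assms(3,4) by simp

lemma continuation_join:
  assumes "continuation F g1 K" "continuation K g2 H" "path g1" "path g2"
    "pathfinish g1 = pathstart g2"
  shows "continuation F (g1 +++ g2) H"
proof -
  obtain f1 where f1: "germ_family f1 g1 {0..1}" "\<forall>\<^sub>F k in at (g1 0). f1 0 k = F k"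
    "\<forall>\<^sub>F k in at (g1 1). f1 1 k = K k"
    using assms(1) unfolding continuation_iff by blast
  obtain f2 where f2: "germ_family f2 g2 {0..1}" "\<forall>\<^sub>F k in at (g2 0). f2 0 k = K k"
    "\<forall>\<^sub>F k in at (g2 1). f2 1 k = H k"
    using assms(2) unfolding continuation_iff by blast
  define g where "g = g1 +++ g2"
  define f where "f t = (if t \<le> 1/2 then f1 (2 * t + 0) else f2 (2 * t + (-1)))" for t :: real
  have pg: "path g" unfolding g_def using assms by simp
  have g12: "g1 1 = g2 0" using assms(5) by (simp add: pathstart_def pathfinish_def)
  have g1: "g t = g1 (2 * t + 0)" if "t \<le> 1/2" for t using that by (simp add: g_def joinpaths_def)
  have g2: "g t = g2 (2 * t + (-1))" if "t \<ge> 1/2" for t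
  proof (cases "t = 1/2")
    case True
    show ?thesis unfolding True by (simp add: g_def joinpaths_def g12)
  qed (use that in \<open>auto simp: g_def joinpaths_def\<close>)
  have "germ_family f g {0..1/2}"
    by (rule germ_family_cong[OF germ_family_affine[OF f1(1), of "{0..1/2}" 2 0]]) (auto simp: f_def g1)
  moreover have "germ_family f g {1/2..1}"
  proof (rule germ_family_germ_cong)
    show "germ_family (\<lambda>t. f2 (2 * t + (-1))) g {1/2..1}"
      by (rule germ_family_cong[OF germ_family_affine[OF f2(1), of "{1/2..1}" 2 "-1"]]) (auto simp: g2)
    show "continuous_on {1/2..1} g"
      using pg unfolding path_def by (rule continuous_on_subset) auto
    \<comment> \<open>At the joint \<open>f\<close> takes its value from the first family, which
      agrees with the second one only as a germ.\<close>
    have mid: "\<forall>\<^sub>F k in at (g (1/2)). f2 0 k = f1 1 k"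
      using f2(2) f1(3) unfolding g12 g2[of "1/2", simplified] by eventually_elim simp
    show "\<forall>\<^sub>F k in at (g t). f2 (2 * t + (-1)) k = f t k" if "t \<in> {1/2..1}" for t
    proof (cases "t = 1/2")
      case True
      show ?thesis unfolding True f_def using mid by simp
    qed (use that in \<open>simp add: f_def\<close>)
  qed
  ultimately have "germ_family f g {0..1}" by (rule germ_family_union) simp_all
  moreover have "\<forall>\<^sub>F k in at (g 0). f 0 k = F k" using f1(2) g1[of 0] by (simp add: f_def)
  moreover have "\<forall>\<^sub>F k in at (g 1). f 1 k = H k" using f2(3) g2[of 1] by (simp add: f_def)
  ultimately show ?thesis unfolding continuation_iff g_def by blast
qed

text \<open>\<Psi> acts on each germ of the families separately; \<open>loc\<close> is required
  because the members outside \<open>I\<close> are arbitrary functions. Sums over the sheets are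
  continued in this way, and, with a single index, expressions in one matrix.\<close>

lemma continuation_combine:
  fixes F H :: "'i \<Rightarrow> complex \<Rightarrow> complex ^ 'n ^ 'n" and \<Psi> :: "complex \<Rightarrow> ('i \<Rightarrow> complex ^ 'n ^ 'n) \<Rightarrow> complex ^ 'm ^ 'm"
  assumes "finite I" "\<And>i. i \<in> I \<Longrightarrow> continuation (F i) g (H i)"
    and \<Psi>: "\<And>K z. (\<And>i. i \<in> I \<Longrightarrow> matrix_meromorphic_on (K i) {z}) \<Longrightarrow>
               matrix_meromorphic_on (\<lambda>k. \<Psi> k (\<lambda>i. K i k)) {z}"
    and loc: "\<And>k A A'. (\<And>i. i \<in> I \<Longrightarrow> A i = A' i) \<Longrightarrow> \<Psi> k A = \<Psi> k A'"
  shows "continuation (\<lambda>k. \<Psi> k (\<lambda>i. F i k)) g (\<lambda>k. \<Psi> k (\<lambda>i. H i k))"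
proof -
  have "\<exists>f. \<forall>i\<in>I. germ_family (f i) g {0..1} \<and>
     (\<forall>\<^sub>F k in at (g 0). f i 0 k = F i k) \<and> (\<forall>\<^sub>F k in at (g 1). f i 1 k = H i k)"
    using assms(2) unfolding continuation_iff by (intro bchoice) blast
  then obtain f where f: "\<And>i. i \<in> I \<Longrightarrow> germ_family (f i) g {0..1}"
     "\<And>i. i \<in> I \<Longrightarrow> \<forall>\<^sub>F k in at (g 0). f i 0 k = F i k"
     "\<And>i. i \<in> I \<Longrightarrow> \<forall>\<^sub>F k in at (g 1). f i 1 k = H i k" by blast
  have ev: "\<forall>\<^sub>F k in G. \<Psi> k (\<lambda>i. K i k) = \<Psi> k (\<lambda>i. K' i k)"
    if "\<And>i. i \<in> I \<Longrightarrow> \<forall>\<^sub>F k in G. K i k = K' i k"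
    for K K' :: "'i \<Rightarrow> complex \<Rightarrow> complex ^ 'n ^ 'n" and G :: "complex filter"
  proof -
    have "\<forall>\<^sub>F k in G. \<forall>i\<in>I. K i k = K' i k"
      using that \<open>finite I\<close> by (simp add: eventually_ball_finite)
    then show ?thesis by eventually_elim (auto intro: loc)
  qed
  have "germ_family (\<lambda>t k. \<Psi> k (\<lambda>i. f i t k)) g {0..1}"
    unfolding germ_family_def
  proof (intro conjI ballI)
    fix t :: real assume t: "t \<in> {0..1}"
    show "matrix_meromorphic_on (\<lambda>k. \<Psi> k (\<lambda>i. f i t k)) {g t}"
      using f(1) t unfolding germ_family_def by (intro \<Psi>) auto
    have "\<forall>\<^sub>F s in at t within {0..1}. \<forall>i\<in>I. \<forall>\<^sub>F k in at (g s). f i s k = f i t k"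
      using f(1) t \<open>finite I\<close> unfolding germ_family_def by (auto simp: eventually_ball_finite)
    then show "\<forall>\<^sub>F s in at t within {0..1}. \<forall>\<^sub>F k in at (g s). \<Psi> k (\<lambda>i. f i s k) = \<Psi> k (\<lambda>i. f i t k)"
      by eventually_elim (auto intro: ev)
  qed
  moreover have "\<forall>\<^sub>F k in at (g 0). \<Psi> k (\<lambda>i. f i 0 k) = \<Psi> k (\<lambda>i. F i k)"
    "\<forall>\<^sub>F k in at (g 1). \<Psi> k (\<lambda>i. f i 1 k) = \<Psi> k (\<lambda>i. H i k)"
    using f(2,3) by (auto intro: ev)
  ultimately show ?thesis
    unfolding continuation_iff by (intro exI[of _ "\<lambda>t k. \<Psi> k (\<lambda>i. f i t k)"]) auto
qed

text \<open>\<open>branch_points\<close> speaks of subpaths, whereas families over {0..t} are nested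
  in \<open>t\<close>, as the supremum argument for continuability needs. This lemma and the next
  translate between the two.\<close>

lemma continuation_subpathI:
  fixes t :: real
  assumes f: "germ_family f g {0..t}" "\<forall>\<^sub>F k in at (g 0). f 0 k = F k" and t: "0 \<le> t"
  shows "continuation F (subpath 0 t g) (f t)"
proof -
  have "germ_family (\<lambda>s. f (t * s + 0)) (subpath 0 t g) {0..1}"
    by (rule germ_family_cong[OF germ_family_affine[OF f(1), of "{0..1}" t 0]])
       (use t in \<open>auto simp: subpath_def mult_left_le\<close>)
  then show ?thesis
    unfolding continuation_iff using f(2)
    by (intro exI[of _ "\<lambda>s. f (t * s + 0)"]) (simp add: subpath_def)
qed

lemma continuation_subpathD:
  fixes t :: real
  assumes "continuation F (subpath 0 t g) H" and t: "0 < t"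
  obtains f where "germ_family f g {0..t}" "\<forall>\<^sub>F k in at (g 0). f 0 k = F k"
proof -
  obtain f where f: "germ_family f (subpath 0 t g) {0..1}" "\<forall>\<^sub>F k in at (g 0). f 0 k = F k"
    using assms(1) unfolding continuation_iff by (auto simp: subpath_def)
  have "germ_family (\<lambda>s. f (1/t * s + 0)) g {0..t}"
    by (rule germ_family_cong[OF germ_family_affine[OF f(1), of "{0..t}" "1/t" 0]])
       (use t in \<open>auto simp: subpath_def\<close>)
  then show ?thesis using f(2) by (intro that[of "\<lambda>s. f (1/t * s + 0)"]) simp_all
qed

section \<open>Stability of continuation under perturbation and the monodromy theorem\<close>

lemma germ_family_nhd:
  assumes f: "germ_family f g I" and g: "continuous_on I g" and t: "t \<in> I"
  obtains r d where "r > 0" "d > 0" "matrix_meromorphic_on (f t) (ball (g t) r)"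
    "\<And>s. s \<in> I \<Longrightarrow> \<bar>s - t\<bar> < d \<Longrightarrow> g s \<in> ball (g t) (r / 2)"
    "\<And>s. s \<in> I \<Longrightarrow> \<bar>s - t\<bar> < d \<Longrightarrow> \<forall>\<^sub>F k in at (g s). f s k = f t k"
proof -
  have "matrix_meromorphic_on (f t) {g t}" using f t unfolding germ_family_def by blast
  then obtain r where r: "r > 0" "matrix_meromorphic_on (f t) (ball (g t) r)"
    by (rule matrix_meromorphic_on_nhd)
  have 1: "\<forall>\<^sub>F s in at t within I. g s \<in> ball (g t) (r/2)"
    using r(1) by (intro at_within_compose_nhds[OF g t] eventually_nhds_in_open) auto
  have 2: "\<forall>\<^sub>F s in at t within I. \<forall>\<^sub>F k in at (g s). f s k = f t k"
    using f t unfolding germ_family_def by auto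
  obtain d where d: "d > 0" "\<And>s. s \<in> I \<Longrightarrow> s \<noteq> t \<Longrightarrow> dist s t < d \<Longrightarrow>
      g s \<in> ball (g t) (r/2) \<and> (\<forall>\<^sub>F k in at (g s). f s k = f t k)"
    using eventually_conj[OF 1 2] unfolding eventually_at by blast
  show ?thesis
  proof (rule that[OF r(1) d(1) r(2)])
    fix s assume "s \<in> I" "\<bar>s - t\<bar> < d"
    then show "g s \<in> ball (g t) (r / 2)" "\<forall>\<^sub>F k in at (g s). f s k = f t k"
      using d(2)[of s] r(1) by (cases "s = t"; simp add: dist_real_def)+
  qed
qed

text \<open>Finitely many parameters suffice to follow the path by discs on which the respective
  germs are meromorphic. A nearby path stays in the same discs, so the germs attached to their
  centres can be reused for it.\<close>

lemma continuation_stable: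
  fixes g :: "real \<Rightarrow> complex"
  assumes c: "continuation F g H" and g: "path g"
  obtains \<delta> where "\<delta> > 0" "\<And>g'. path g' \<Longrightarrow> pathstart g' = pathstart g \<Longrightarrow> pathfinish g' = pathfinish g \<Longrightarrow>
     (\<And>t. t \<in> {0..1} \<Longrightarrow> dist (g t) (g' t) < \<delta>) \<Longrightarrow> continuation F g' H"
proof -
  obtain f where f: "germ_family f g {0..1}" "\<forall>\<^sub>F k in at (g 0). f 0 k = F k"
    "\<forall>\<^sub>F k in at (g 1). f 1 k = H k"
    using c unfolding continuation_iff by blast
  define Q where "Q t r d \<longleftrightarrow> r > 0 \<and> d > 0 \<and> matrix_meromorphic_on (f t) (ball (g t) r) \<and>
    (\<forall>s\<in>{0..1}. \<bar>s - t\<bar> < d \<longrightarrow> g s \<in> ball (g t) (r / 2) \<and> (\<forall>\<^sub>F k in at (g s). f s k = f t k))" for t r d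
  have "\<exists>r d. Q t r d" if "t \<in> {0..1}" for t
    by (rule germ_family_nhd[OF f(1) g[unfolded path_def] that]) (unfold Q_def, blast)
  then obtain r d where "\<And>t. t \<in> {0..1} \<Longrightarrow> Q t (r t) (d t)" by metis
  then have rd: "\<And>t. t \<in> {0..1} \<Longrightarrow> r t > 0" "\<And>t. t \<in> {0..1} \<Longrightarrow> d t > 0"
    "\<And>t. t \<in> {0..1} \<Longrightarrow> matrix_meromorphic_on (f t) (ball (g t) (r t))"
    "\<And>t s. t \<in> {0..1} \<Longrightarrow> s \<in> {0..1} \<Longrightarrow> \<bar>s - t\<bar> < d t \<Longrightarrow> g s \<in> ball (g t) (r t / 2)"
    "\<And>t s. t \<in> {0..1} \<Longrightarrow> s \<in> {0..1} \<Longrightarrow> \<bar>s - t\<bar> < d t \<Longrightarrow> \<forall>\<^sub>F k in at (g s). f s k = f t k"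
    unfolding Q_def by blast+
  obtain T where T: "T \<subseteq> {0..1}" "finite T" "{0..1} \<subseteq> (\<Union>t\<in>T. ball t (d t))"
  proof (rule compactE_image[of "{0..1::real}" "{0..1}" "\<lambda>t. ball t (d t)"])
    show "{0..1} \<subseteq> (\<Union>t\<in>{0..1}. ball t (d t))" using rd(2) by force
  qed auto
  then have "T \<noteq> {}" by auto
  \<comment> \<open>The old path lies in the half discs, so an error below the smallest half radius
    keeps the new one in the full discs.\<close>
  define \<delta> where "\<delta> = Min ((\<lambda>t. r t / 2) ` T)"
  have \<delta>: "\<delta> > 0" "\<And>t. t \<in> T \<Longrightarrow> \<delta> \<le> r t / 2"
  proof -
    have "\<forall>x\<in>(\<lambda>t. r t / 2) ` T. 0 < x" using rd(1) T(1) by auto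
    then show "\<delta> > 0" unfolding \<delta>_def using T(2) \<open>T \<noteq> {}\<close> by (subst Min_gr_iff) auto
    show "\<delta> \<le> r t / 2" if "t \<in> T" for t
      unfolding \<delta>_def by (rule Min_le) (use T(2) that in auto)
  qed
  have "\<exists>i. \<forall>s\<in>{0..1}. i s \<in> T \<and> \<bar>s - i s\<bar> < d (i s)"
    using T(3) by (intro bchoice) (auto simp: dist_real_def abs_minus_commute subset_iff)
  then obtain i where i: "\<And>s. s \<in> {0..1} \<Longrightarrow> i s \<in> T" "\<And>s. s \<in> {0..1} \<Longrightarrow> \<bar>s - i s\<bar> < d (i s)" by blast
  have iT: "i s \<in> {0..1}" if "s \<in> {0..1}" for s using i(1)[OF that] T(1) by blast
  show ?thesis
  proof (rule that[OF \<delta>(1)])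
    fix g' assume g': "path g'" "pathstart g' = pathstart g" "pathfinish g' = pathfinish g"
      "\<And>t. t \<in> {0..1} \<Longrightarrow> dist (g t) (g' t) < \<delta>"
    have near: "g' s \<in> ball (g t) (r t)" if "t \<in> T" "g s \<in> ball (g t) (r t / 2)" "s \<in> {0..1}" for s t
      using dist_triangle[of "g t" "g' s" "g s"] g'(4)[OF that(3)] \<delta>(2)[OF that(1)] that(2) by simp
    have gi: "g s \<in> ball (g (i s)) (r (i s) / 2)" if "s \<in> {0..1}" for s
      using rd(4)[OF iT[OF that] that i(2)[OF that]] .
    have "germ_family (\<lambda>s. f (i s)) g' {0..1}"
      unfolding germ_family_def
    proof (intro conjI ballI)
      fix s :: real assume s: "s \<in> {0..1}"
      show "matrix_meromorphic_on (f (i s)) {g' s}"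
        using near[OF i(1)[OF s] gi[OF s] s] rd(3)[OF iT[OF s]]
        by (auto intro: matrix_meromorphic_on_subset)
      have "\<forall>\<^sub>F u in at s within {0..1}. \<bar>u - i s\<bar> < d (i s)"
        by (rule order_tendstoD[where y="\<bar>s - i s\<bar>"]) (use i(2)[OF s] in \<open>auto intro!: tendsto_intros\<close>)
      moreover have "\<forall>\<^sub>F u in at s within {0..1}. u \<in> {0..1}" by (simp add: eventually_at_filter)
      ultimately show "\<forall>\<^sub>F u in at s within {0..1}. \<forall>\<^sub>F k in at (g' u). f (i u) k = f (i s) k"
      proof eventually_elim
        case (elim u)
        \<comment> \<open>The choice of centre \<open>i\<close> may jump. Both germs are meromorphic
          on the convex intersection of their discs and agree at \<open>g u\<close>; hence they
          agree at \<open>g' u\<close>.\<close>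
        let ?D = "ball (g (i u)) (r (i u)) \<inter> ball (g (i s)) (r (i s))"
        have a: "g u \<in> ball (g (i s)) (r (i s) / 2)"
          using rd(4)[OF iT[OF s] elim(2,1)] .
        have b: "g' u \<in> ?D" using near[OF i(1)[OF s] a elim(2)] near[OF i(1)[OF elim(2)] gi[OF elim(2)] elim(2)] by blast
        have h: "ball (g (i t)) (r (i t) / 2) \<subseteq> ball (g (i t)) (r (i t))" if "t \<in> {0..1}" for t
          using rd(1)[OF iT[OF that]] by (intro subset_ball) auto
        have c: "g u \<in> ?D" using a gi[OF elim(2)] h[OF s] h[OF elim(2)] by blast
        have "\<forall>\<^sub>F k in at (g u). f (i u) k = f (i s) k"
          using rd(5)[OF iT[OF s] elim(2,1)] rd(5)[OF iT[OF elim(2)] elim(2) i(2)[OF elim(2)]]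
          by eventually_elim simp
        moreover have "convex ?D" by (intro convex_Int) auto
        ultimately show ?case
          by (intro matrix_meromorphic_eqI'[of "f (i u)" ?D "f (i s)" "g u" "g' u"] b c convex_connected
                matrix_meromorphic_on_subset[OF rd(3)[OF iT[OF s]]]
                matrix_meromorphic_on_subset[OF rd(3)[OF iT[OF elim(2)]]]) auto
      qed
    qed
    moreover have g01: "g' 0 = g 0" "g' 1 = g 1" using g' by (auto simp: pathstart_def pathfinish_def)
    moreover have "\<forall>\<^sub>F k in at (g 0). f (i 0) k = F k"
    proof -
      have "\<forall>\<^sub>F k in at (g 0). f 0 k = f (i 0) k"
        by (rule rd(5)) (use iT[of 0] i(2)[of 0] in auto)
      with f(2) show ?thesis by eventually_elim simp
    qed
    moreover have "\<forall>\<^sub>F k in at (g 1). f (i 1) k = H k"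
    proof -
      have "\<forall>\<^sub>F k in at (g 1). f 1 k = f (i 1) k"
        by (rule rd(5)) (use iT[of 1] i(2)[of 1] in auto)
      with f(3) show ?thesis by eventually_elim simp
    qed
    ultimately show "continuation F g' H"
      unfolding continuation_iff by (intro exI[of _ "\<lambda>s. f (i s)"]) simp
  qed
qed

lemma continuation_path_cong:
  fixes F :: "complex \<Rightarrow> complex ^ 'n ^ 'n"
  assumes "\<And>t. t \<in> {0..1} \<Longrightarrow> g t = g' t"
  shows "continuation F g H \<longleftrightarrow> continuation F g' H"
proof -
  have "germ_family f g {0..1} \<longleftrightarrow> germ_family f g' {0..1}" for f :: "real \<Rightarrow> complex \<Rightarrow> complex ^ 'n ^ 'n"
    using germ_family_cong[of f g "{0..1}" f g'] germ_family_cong[of f g' "{0..1}" f g] assms by auto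
  note this [simp]
  show ?thesis unfolding continuation_iff using assms by simp
qed

text \<open>The monodromy theorem. By stability, paths of the homotopy close to a given one lead to
  the same germ, so reaching \<open>H\<close> is a locally constant property of the homotopy
  parameter. \<open>ex\<close> provides the germ reached by an intermediate path.\<close>

lemma continuation_homotopic:
  assumes hom: "homotopic_paths D p q" and c: "continuation F p H"
    and ex: "\<And>g. path g \<Longrightarrow> path_image g \<subseteq> D \<Longrightarrow> pathstart g = pathstart p \<Longrightarrow> \<exists>K. continuation F g K"
  shows "continuation F q H"
proof -
  obtain h where h: "continuous_on ({0..1::real} \<times> {0..1::real}) h" "h ` ({0..1} \<times> {0..1}) \<subseteq> D"
    "\<And>x. x \<in> {0..1} \<Longrightarrow> h (0, x) = p x" "\<And>x. x \<in> {0..1} \<Longrightarrow> h (1, x) = q x"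
    "\<And>t. t \<in> {0..1} \<Longrightarrow> pathstart (h \<circ> Pair t) = pathstart p"
    "\<And>t. t \<in> {0..1} \<Longrightarrow> pathfinish (h \<circ> Pair t) = pathfinish p"
    using hom unfolding homotopic_paths by (force simp: image_subset_iff)
  have path: "path (h \<circ> Pair s)" if "s \<in> {0..1}" for s
    unfolding path_def comp_def
    by (intro continuous_on_compose2[OF h(1)] continuous_intros) (use that in auto)
  have img: "path_image (h \<circ> Pair s) \<subseteq> D" if "s \<in> {0..1}" for s
    using h(2) that unfolding path_image_def by auto
  have uc: "uniformly_continuous_on ({0..1::real} \<times> {0..1::real}) h"
    by (intro compact_uniformly_continuous h(1) compact_Times) auto
  have "\<forall>\<^sub>F s' in at s within {0..1}. continuation F (h \<circ> Pair s') H \<longleftrightarrow> continuation F (h \<circ> Pair s) H"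
    if s: "s \<in> {0..1}" for s
  proof -
    obtain K where K: "continuation F (h \<circ> Pair s) K"
      using ex[OF path[OF s] img[OF s] h(5)[OF s]] by blast
    obtain \<delta> where \<delta>: "\<delta> > 0" "\<And>g'. path g' \<Longrightarrow> pathstart g' = pathstart (h \<circ> Pair s) \<Longrightarrow>
        pathfinish g' = pathfinish (h \<circ> Pair s) \<Longrightarrow>
        (\<And>t. t \<in> {0..1} \<Longrightarrow> dist ((h \<circ> Pair s) t) (g' t) < \<delta>) \<Longrightarrow> continuation F g' K"
      using continuation_stable[OF K path[OF s]] by blast
    obtain d where d: "d > 0" "\<And>x y. x \<in> {0..1} \<times> {0..1} \<Longrightarrow> y \<in> {0..1} \<times> {0..1} \<Longrightarrow> dist y x < d \<Longrightarrow> dist (h y) (h x) < \<delta>"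
      using uc \<delta>(1) unfolding uniformly_continuous_on_def by metis
    have K': "continuation F (h \<circ> Pair s') K" if "s' \<in> {0..1}" "dist s' s < d" for s'
    proof (rule \<delta>(2)[OF path[OF that(1)]])
      fix t :: real assume t: "t \<in> {0..1}"
      have "dist (s, t) (s', t) < d" using that(2) by (simp add: dist_Pair_Pair dist_commute)
      then show "dist ((h \<circ> Pair s) t) ((h \<circ> Pair s') t) < \<delta>"
        using d(2)[of "(s', t)" "(s, t)"] s t that(1) by simp
    qed (use h(5,6) s that in auto)
    \<comment> \<open>All paths of the homotopy have the same end, so \<open>H\<close> is reached if
      and only if it has the germ of \<open>K\<close> there.\<close>
    have iff: "continuation F (h \<circ> Pair s') H \<longleftrightarrow> (\<forall>\<^sub>F k in at (pathfinish p). K k = H k)"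
      if "s' \<in> {0..1}" "continuation F (h \<circ> Pair s') K" for s'
      using continuation_unique[OF that(2) _ path[OF that(1)], of F H]
        continuation_cong[OF that(2), of F H] h(6)[OF that(1)] by auto
    have "\<forall>\<^sub>F s' in at s within {0..1}. s' \<in> {0..1} \<and> dist s' s < d"
      using d(1) unfolding eventually_at by auto
    then show ?thesis
      by eventually_elim (use iff K' K s in auto)
  qed
  moreover have "continuation F (h \<circ> Pair 0) H \<longleftrightarrow> continuation F p H"
    "continuation F (h \<circ> Pair 1) H \<longleftrightarrow> continuation F q H"
    by (rule continuation_path_cong; use h(3,4) in simp)+
  ultimately show ?thesis
    using connected_induction_eventually[of "{0..1::real}" "\<lambda>s. continuation F (h \<circ> Pair s) H" 0 1] c
    by simp
qed

lemma glue_germs: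
  fixes \<phi> :: "complex \<Rightarrow> complex \<Rightarrow> complex ^ 'n ^ 'n"
  assumes "\<And>z. z \<in> D \<Longrightarrow> matrix_meromorphic_on (\<phi> z) {z}"
    and "\<And>z. z \<in> D \<Longrightarrow> \<forall>\<^sub>F w in at z. \<forall>\<^sub>F k in at w. \<phi> w k = \<phi> z k"
  obtains H where "matrix_meromorphic_on H D" "\<And>z. z \<in> D \<Longrightarrow> \<forall>\<^sub>F k in at z. H k = \<phi> z k"
proof -
  \<comment> \<open>\<open>remove_sings\<close> extracts from a germ a value that does not depend on
    the representative, so near \<open>z\<close> the values taken from the germs of
    \<open>\<phi> w\<close> are those of \<open>\<phi> z\<close>.\<close>
  define H where "H z = (\<chi> i j. remove_sings (\<lambda>k. \<phi> z k $ i $ j) z)" for z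
  have ev: "\<forall>\<^sub>F k in at z. H k = \<phi> z k" if z: "z \<in> D" for z
  proof -
    have "isolated_singularity_at (\<lambda>k. \<phi> z k $ i $ j) z" for i j
      using assms(1)[OF z] unfolding matrix_meromorphic_on_def meromorphic_at_iff by auto
    then have "\<forall>\<^sub>F w in at z. \<forall>i j. remove_sings (\<lambda>k. \<phi> z k $ i $ j) w = \<phi> z w $ i $ j"
      by (intro eventually_all_finite) (rule eventually_remove_sings_eq_at)
    then show ?thesis using assms(2)[OF z]
    proof eventually_elim
      case (elim w)
      have "remove_sings (\<lambda>k. \<phi> w k $ i $ j) w = remove_sings (\<lambda>k. \<phi> z k $ i $ j) w" for i j
        by (rule remove_sings_cong) (use elim(2) in \<open>auto elim: eventually_mono\<close>)
      then show ?case using elim(1) by (simp add: H_def vec_eq_iff)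
    qed
  qed
  have "matrix_meromorphic_on H {z}" if "z \<in> D" for z
    by (rule matrix_meromorphic_on_cong[OF _ assms(1)[OF that]])
       (use ev[OF that] in \<open>auto elim: eventually_mono\<close>)
  then have "matrix_meromorphic_on H D"
    by (subst matrix_meromorphic_on_iff) blast
  then show ?thesis using ev that by blast
qed

subsection \<open>Slit planes\<close>

text \<open>A proper map is closed: whatever part of the image lies in a ball comes from a bounded,
  hence compact, part of \<open>S\<close>.\<close>

lemma closed_proper_image:
  fixes f :: "real \<Rightarrow> complex"
  assumes f: "continuous_on {0..} f" "filterlim f at_infinity at_top" and S: "closed S" "S \<subseteq> {0..}"
  shows "closed (f ` S)"
proof -
  have "x \<in> f ` S" if x: "x \<in> closure (f ` S)" for x
  proof -
    define R where "R = norm x + 1"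
    have "\<forall>\<^sub>F t in at_top. R + 1 \<le> norm (f t)"
    proof -
      have "R + 1 > 0" unfolding R_def using norm_ge_zero[of x] by linarith
      then show ?thesis
        using f(2)[unfolded filterlim_at_infinity[OF order_refl]] by blast
    qed
    then obtain T where T: "\<And>t. t \<ge> T \<Longrightarrow> R + 1 \<le> norm (f t)"
      unfolding eventually_at_top_linorder by blast
    have sub: "f ` S \<inter> ball 0 R \<subseteq> f ` (S \<inter> {0..T})"
    proof
      fix y assume "y \<in> f ` S \<inter> ball 0 R"
      then obtain t where t: "t \<in> S" "y = f t" "norm (f t) < R" by auto
      have "t \<le> T" using T[of t] t(3) by linarith
      then show "y \<in> f ` (S \<inter> {0..T})" using t S(2) by auto
    qed
    have "compact (f ` (S \<inter> {0..T}))"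
    proof (rule compact_continuous_image)
      show "compact (S \<inter> {0..T})" using S(1) by (intro closed_Int_compact) auto
    qed (use f(1) S(2) in \<open>auto intro: continuous_on_subset\<close>)
    then have cl: "closure (f ` S \<inter> ball 0 R) \<subseteq> f ` (S \<inter> {0..T})"
      using sub by (meson closure_minimal compact_imp_closed)
    have "x \<in> ball 0 R" by (simp add: R_def)
    then have "x \<in> closure (f ` S \<inter> ball 0 R)"
      using open_Int_closure_subset[of "ball 0 R" "f ` S"] x by (auto simp: Int_commute)
    then show ?thesis using cl by blast
  qed
  then show ?thesis
    by (metis closure_closed closure_subset closed_closure subsetI subset_antisym)
qed

context cut_system
begin

lemma finite_letters: "finite letters"
  unfolding letters_def by auto

lemmas cut_facts = cut_continuous[folded letters_def] cut_inj[folded letters_def]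
  cut_to_infinity[folded letters_def]

lemma cut_disj:
  assumes "l \<in> letters" "m \<in> letters" "l \<noteq> m"
  shows "cut l \<inter> cut m = {}"
  using cut_disjoint[folded letters_def] assms unfolding cut_def by blast

lemma closed_cut_image:
  assumes "l \<in> letters" "closed S" "S \<subseteq> {0..}"
  shows "closed (\<gamma> l ` S)"
  using closed_proper_image cut_facts assms by blast

lemma closed_cut: "l \<in> letters \<Longrightarrow> closed (cut l)"
  unfolding cut_def by (intro closed_cut_image) auto

lemma connected_cut: "l \<in> letters \<Longrightarrow> connected (cut l)"
  unfolding cut_def using cut_facts(1) by (intro connected_continuous_image) auto

lemma cut_far:
  assumes "l \<in> letters"
  obtains T where "T \<ge> 0" "\<And>t. t \<ge> T \<Longrightarrow> norm (\<gamma> l t) > R"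
proof -
  have "\<forall>\<^sub>F t in at_top. norm (\<gamma> l t) \<ge> max R 0 + 1"
  proof -
    have "max R 0 + 1 > 0" by linarith
    then show ?thesis
      using cut_facts(3)[OF assms, unfolded filterlim_at_infinity[OF order_refl]] by blast
  qed
  then obtain T where T: "\<And>t. t \<ge> T \<Longrightarrow> norm (\<gamma> l t) \<ge> max R 0 + 1"
    unfolding eventually_at_top_linorder by blast
  show ?thesis
  proof (rule that[of "max T 0"])
    fix t assume "max T 0 \<le> t"
    then show "norm (\<gamma> l t) > R" using T[of t] by simp
  qed simp
qed

lemma unbounded_cut: 
  assumes "l \<in> letters" shows "\<not> bounded (cut l)"
proof
  assume "bounded (cut l)"
  then obtain R where R: "\<And>z. z \<in> cut l \<Longrightarrow> norm z \<le> R" unfolding bounded_iff by blast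
  obtain T where "T \<ge> 0" "\<And>t. t \<ge> T \<Longrightarrow> norm (\<gamma> l t) > R" using cut_far[OF assms] by blast
  then show False using R[of "\<gamma> l T"] unfolding cut_def by force
qed

definition slit :: "letter set \<Rightarrow> complex set" where
  "slit M = - (\<Union>l\<in>M. cut l)"

lemma cut_plane_slit: "cut_plane = slit letters"
  unfolding cut_plane_def slit_def ..

lemma open_slit: "M \<subseteq> letters \<Longrightarrow> open (slit M)"
  unfolding slit_def using finite_letters closed_cut
  by (intro open_Compl closed_UN) (auto intro: finite_subset)

lemma connected_complement_cut_arc:
  assumes l: "l \<in> letters"
  shows "connected (- \<gamma> l ` {0..T})"
proof -
  have c: "continuous_on {0..T} (\<gamma> l)" "inj_on (\<gamma> l) {0..T}"
    by (rule continuous_on_subset[OF cut_facts(1)[OF l]] inj_on_subset[OF cut_facts(2)[OF l]]; auto)+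
  have "{0..T} homeomorphic \<gamma> l ` {0..T}"
    by (rule homeomorphic_compact[OF _ c(1) refl c(2)]) simp
  then have "\<gamma> l ` {0..T} homeomorphic {0..T}" using homeomorphic_sym by blast
  then show ?thesis
    by (rule connected_complement_homeomorphic_convex_compact) auto
qed

text \<open>The ends of the cuts stay outside a disc containing both points; the remaining arcs are then
  added one at a time, each meeting the set built so far in its endpoint only (Janiszewski).\<close>

lemma connected_slit:
  assumes M: "M \<subseteq> letters"
  shows "connected (slit M)"
  unfolding connected_iff_connected_component
proof (intro ballI)
  fix a b assume ab: "a \<in> slit M" "b \<in> slit M"
  define R where "R = max (norm a) (norm b)"
  have "\<exists>T. T \<ge> 0 \<and> (\<forall>t\<ge>T. norm (\<gamma> l t) > R)" if "l \<in> M" for l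
  proof -
    have "l \<in> letters" using M that by blast
    then obtain T where "T \<ge> 0" "\<And>t. t \<ge> T \<Longrightarrow> norm (\<gamma> l t) > R"
      by (rule cut_far[where R = R]) blast
    then show ?thesis by blast
  qed
  then obtain T where T: "\<And>l. l \<in> M \<Longrightarrow> T l \<ge> 0" "\<And>l t. l \<in> M \<Longrightarrow> t \<ge> T l \<Longrightarrow> norm (\<gamma> l t) > R"
    by metis
  define K where "K = (\<Union>l\<in>M. \<gamma> l ` {T l..})"
  have fin: "finite M" using M finite_letters finite_subset by blast
  have clK: "closed K"
  proof -
    have "closed (\<gamma> l ` {T l..})" if "l \<in> M" for l
      by (rule closed_cut_image) (use T(1)[OF that] M that in auto)
    then show ?thesis unfolding K_def using fin by blast
  qed
  have "connected_component (- (K \<union> (\<Union>l\<in>F. \<gamma> l ` {0..T l}))) a b" if "F \<subseteq> M" for F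
    using finite_subset[OF that fin] that
  proof (induction F rule: finite_induct)
    case empty
    have "cball (0::complex) R \<subseteq> - K"
    proof
      fix x :: complex assume "x \<in> cball 0 R"
      then have "x \<noteq> \<gamma> l t" if "l \<in> M" "t \<ge> T l" for l t
        using T(2)[OF that] by auto
      then show "x \<in> - K" unfolding K_def by auto
    qed
    moreover have "a \<in> cball (0::complex) R" "b \<in> cball 0 R" by (auto simp: R_def)
    ultimately have "connected (cball (0::complex) R) \<and> cball 0 R \<subseteq> - K \<and> a \<in> cball 0 R \<and> b \<in> cball 0 R"
      using convex_connected[OF convex_cball] by blast
    then have "connected_component (- K) a b" unfolding connected_component_def by (rule exI)
    then show ?case by (simp only: UN_empty Un_empty_right)
  next
    case (insert l F)
    let ?S = "\<gamma> l ` {0..T l}" and ?T = "K \<union> (\<Union>l\<in>F. \<gamma> l ` {0..T l})"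
    have l: "l \<in> letters" "l \<in> M" using insert M by auto
    have "compact ?S"
      using cut_facts(1)[OF l(1)] by (intro compact_continuous_image) (auto intro: continuous_on_subset)
    moreover have "closed ?T"
    proof -
      have "closed (\<gamma> m ` {0..T m})" if "m \<in> F" for m
        by (rule closed_cut_image) (use M insert.prems that in auto)
      then show ?thesis using clK insert.hyps(1) by (intro closed_Un closed_UN) auto
    qed
    moreover have "?S \<inter> ?T = {\<gamma> l (T l)}"
    proof
      have "x = \<gamma> l (T l)" if x: "x \<in> ?S" "x \<in> ?T" for x
      proof -
        obtain t where t: "0 \<le> t" "t \<le> T l" "x = \<gamma> l t" using x(1) by auto
        have xl: "x \<in> cut l" unfolding cut_def using t by auto
        have no: "x \<notin> \<gamma> m ` S" if "m \<in> M" "m \<noteq> l" "S \<subseteq> {0..}" for m S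
          using cut_disj[of l m] l M that xl unfolding cut_def by blast
        have "x \<in> \<gamma> l ` {T l..}"
        proof -
          have "x \<notin> \<gamma> m ` {T m..}" if "m \<in> M" "m \<noteq> l" for m
            using no[OF that, of "{T m..}"] T(1)[OF that(1)] by auto
          moreover have "x \<notin> \<gamma> m ` {0..T m}" if "m \<in> F" for m
            using no[of m "{0..T m}"] that insert.prems insert.hyps(2) by auto
          ultimately show ?thesis using x(2) unfolding K_def by blast
        qed
        then obtain s where s: "T l \<le> s" "x = \<gamma> l s" by auto
        have eq: "\<gamma> l s = \<gamma> l t" using s(2) t(3) by simp
        have "s \<in> {0..}" "t \<in> {0..}" using s(1) t(1) T(1)[OF l(2)] by auto
        with eq have "s = t" by (rule inj_onD[OF cut_facts(2)[OF l(1)]])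
        then have "s = T l" using s(1) t(2) by linarith
        then show ?thesis using s(2) by simp
      qed
      then show "?S \<inter> ?T \<subseteq> {\<gamma> l (T l)}" by blast
      show "{\<gamma> l (T l)} \<subseteq> ?S \<inter> ?T" unfolding K_def using T(1)[OF l(2)] l(2) by auto
    qed
    then have "connected (?S \<inter> ?T)" by simp
    moreover have "connected_component (- ?S) a b"
    proof -
      have "?S \<subseteq> cut l" unfolding cut_def by auto
      then have "a \<in> - ?S" "b \<in> - ?S" using ab l unfolding slit_def by auto
      then show ?thesis
        using connected_complement_cut_arc[OF l(1)] unfolding connected_iff_connected_component by blast
    qed
    moreover have "connected_component (- ?T) a b" using insert by blast
    ultimately have "connected_component (- (?S \<union> ?T)) a b" by (rule Janiszewski)
    then show ?case by (simp add: Un_ac)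
  qed
  from this[OF order_refl] have "connected_component (- (K \<union> (\<Union>l\<in>M. \<gamma> l ` {0..T l}))) a b" .
  moreover have "K \<union> (\<Union>l\<in>M. \<gamma> l ` {0..T l}) = (\<Union>l\<in>M. cut l)"
  proof -
    have "\<gamma> l ` {T l..} \<union> \<gamma> l ` {0..T l} = cut l" if "l \<in> M" for l
    proof -
      have "{T l..} \<union> {0..T l} = {0..}" using T(1)[OF that] by auto
      then show ?thesis unfolding cut_def image_Un[symmetric] by simp
    qed
    then show ?thesis unfolding K_def UN_Un_distrib[symmetric] by (intro SUP_cong refl)
  qed
  ultimately show "connected_component (slit M) a b" by (simp only: slit_def)
qed

text \<open>A connected open subset of the plane is simply connected if no component of its
  complement is bounded. Such a component would contain a whole cut, and cuts are unbounded.\<close>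

lemma simply_connected_slit:
  assumes M: "M \<subseteq> letters"
  shows "simply_connected (slit M)"
  unfolding simply_connected_eq_unbounded_complement_components[OF open_slit[OF M]]
proof (intro conjI connected_slit[OF M] ballI notI)
  fix C assume C: "C \<in> components (- slit M)" "bounded C"
  then obtain z where z: "z \<in> C" using in_components_nonempty by blast
  then have "z \<in> - slit M" using in_components_subset C by blast
  then obtain l where l: "l \<in> M" "z \<in> cut l" unfolding slit_def by auto
  have "cut l \<subseteq> C"
    by (rule components_maximal[OF C(1) connected_cut]) (use l M z in \<open>auto simp: slit_def\<close>)
  then show False using unbounded_cut C(2) l M bounded_subset by blast
qed

text \<open>By properness \<open>\<gamma> l\<close> is a closed map onto the cut, so the parameter
  depends continuously on the point.\<close>

lemma cut_homeomorphism:
  assumes "l \<in> letters"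
  obtains \<delta> where "continuous_on (cut l) \<delta>" "\<And>t. t \<ge> 0 \<Longrightarrow> \<delta> (\<gamma> l t) = t"
    "\<And>z. z \<in> cut l \<Longrightarrow> \<delta> z \<ge> 0" "\<And>z. z \<in> cut l \<Longrightarrow> \<gamma> l (\<delta> z) = z"
proof -
  obtain \<delta> where "homeomorphism {0..} (cut l) (\<gamma> l) \<delta>"
  proof (rule homeomorphism_injective_closed_map[of "{0..}" "\<gamma> l" "cut l"])
    fix U :: "real set" assume "closedin (top_of_set {0..}) U"
    then have "closed U" "U \<subseteq> {0..}" 
      using closedin_closed_eq[of "{0..}" U] by auto
    then show "closedin (top_of_set (cut l)) (\<gamma> l ` U)"
      using closed_cut_image[OF assms] by (intro closed_subset) (auto simp: cut_def)
  qed (use cut_facts assms in \<open>auto simp: cut_def\<close>)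
  then show ?thesis using that unfolding homeomorphism_def by force
qed

text \<open>The parameter would map a nonempty open subset of the plane continuously and injectively
  into the line, against invariance of dimension. The resulting density of the cut plane serves to
  extend functions across the cuts and to transfer bounds.\<close>

lemma interior_cut: 
  assumes "l \<in> letters" shows "interior (cut l) = {}"
proof (rule ccontr)
  assume ne: "interior (cut l) \<noteq> {}"
  obtain \<delta> where \<delta>: "continuous_on (cut l) \<delta>" "\<And>z. z \<in> cut l \<Longrightarrow> \<gamma> l (\<delta> z) = z"
    using cut_homeomorphism[OF assms] by metis
  have "DIM(complex) \<le> DIM(real)"
  proof (rule invariance_of_dimension[of "interior (cut l)" \<delta>])
    show "continuous_on (interior (cut l)) \<delta>"
      using \<delta>(1) interior_subset continuous_on_subset by blast
    show "inj_on \<delta> (interior (cut l))"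
      by (rule inj_on_inverseI[of _ "\<gamma> l"]) (use \<delta>(2) interior_subset in blast)
  qed (use ne in auto)
  then show False by simp
qed

lemma interior_cuts: 
  assumes "M \<subseteq> letters"
  shows "interior (\<Union>l\<in>M. cut l) = {}"
  using finite_subset[OF assms finite_letters] assms
proof (induction M rule: finite_induct)
  case (insert l M)
  then show ?case
    using interior_closed_Un_empty_interior[of "cut l" "\<Union>l\<in>M. cut l"] closed_cut interior_cut by simp
qed simp

lemma slit_dense:
  assumes "M \<subseteq> letters" "open V" "V \<noteq> {}"
  shows "V \<inter> slit M \<noteq> {}"
proof
  assume "V \<inter> slit M = {}"
  then have "V \<subseteq> (\<Union>l\<in>M. cut l)" unfolding slit_def by blast
  then show False using interior_cuts[OF assms(1)] interior_maximal[OF _ assms(2)] assms(3) by blast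
qed

lemma real_in_slit:
  assumes "M \<subseteq> letters" "Im z = 0"
  shows "z \<in> slit M"
proof -
  have "z \<notin> cut l" if "l \<in> letters" for l
    using that cut_upper cut_lower assms(2) unfolding cut_def letters_def by fastforce
  then show ?thesis using assms(1) unfolding slit_def by blast
qed

end

subsection \<open>The logarithmic cover of a slit plane and the existence of bypasses\<close>

text \<open>A continuous logarithm along \<open>p\<close> exists because \<open>p\<close> avoids
  \<zeta>; a multiple of 2 pi i moves its start to \<open>w\<close>. The winding number becomes the
  displacement of the lift.\<close>

lemma exp_lift:
  assumes "path p" "\<zeta> \<notin> path_image p" "pathstart p = \<zeta> + exp w"
  obtains q where "path q" "pathstart q = w" "\<And>t. t \<in> {0..1} \<Longrightarrow> p t = \<zeta> + exp (q t)"
    "pathfinish q = w + 2 * of_real pi * \<i> * winding_number p \<zeta>"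
proof -
  obtain q where q: "path q" "pathfinish q - pathstart q = 2 * of_real pi * \<i> * winding_number p \<zeta>"
    "\<And>t. t \<in> {0..1} \<Longrightarrow> p t = \<zeta> + exp (q t)"
    using winding_number_as_continuous_log[OF assms(1,2)] by blast
  have "exp (pathstart q) = exp w"
    using q(3)[of 0] assms(3) by (simp add: pathstart_def)
  then obtain n :: int where n: "pathstart q = w + of_int (2 * n) * of_real pi * \<i>"
    by (auto simp: exp_eq)
  define q' where "q' t = q t - of_int (2 * n) * of_real pi * \<i>" for t
  have e: "exp (q' t) = exp (q t)" for t
    unfolding q'_def exp_eq by (intro exI[of _ "- n"]) (simp add: algebra_simps)
  show ?thesis
  proof (rule that[of q'])
    show "path q'" using q(1) unfolding q'_def path_def by (intro continuous_intros)
    show "pathstart q' = w" using n by (simp add: q'_def pathstart_def)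
    show "p t = \<zeta> + exp (q' t)" if "t \<in> {0..1}" for t using q(3)[OF that] e by simp
    have "pathfinish q = pathstart q + 2 * of_real pi * \<i> * winding_number p \<zeta>"
      using q(2) by (simp add: algebra_simps)
    then show "pathfinish q' = w + 2 * of_real pi * \<i> * winding_number p \<zeta>"
      unfolding n by (simp add: q'_def pathfinish_def)
  qed
qed

lemma winding_number_exp_lift:
  assumes "path q"
  shows "winding_number (\<lambda>t. \<zeta> + exp (q t)) \<zeta> = (pathfinish q - pathstart q) / (2 * of_real pi * \<i>)"
  using winding_number_compose_exp[OF assms] winding_number_offset[of "\<lambda>t. \<zeta> + exp (q t)" \<zeta>]
  by (simp add: comp_def)

context cut_system
begin

text \<open>The universal cover of \<open>slit (letters - {l}) - {\<tau> l}\<close>, with projection \<open>w \<mapsto> \<tau> l + exp w\<close>.\<close>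

definition log_cover :: "letter \<Rightarrow> complex set" where
  "log_cover l = {w. \<tau> l + exp w \<in> slit (letters - {l})}"

lemma tau_in_cut: "\<tau> l \<in> cut l"
  unfolding \<tau>_def cut_def by auto

lemma cut_disj_tau: "l \<in> letters \<Longrightarrow> m \<in> letters \<Longrightarrow> l \<noteq> m \<Longrightarrow> \<tau> l \<notin> cut m"
  using cut_disj tau_in_cut by blast

lemma tau_in_slit: "l \<in> letters \<Longrightarrow> \<tau> l \<in> slit (letters - {l})"
  unfolding slit_def using cut_disj_tau by auto

lemma open_log_cover: "open (log_cover l)"
proof -
  have "open ((\<lambda>w. \<tau> l + exp w) -` slit (letters - {l}))"
    by (rule open_vimage[OF open_slit]) (auto intro!: continuous_intros)
  then show ?thesis unfolding log_cover_def by (simp add: vimage_def)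
qed

text \<open>Every point is joined to the vertical line over a small circle around \<open>\<tau> l\<close>.\<close>

lemma connected_log_cover:
  assumes l: "l \<in> letters"
  shows "connected (log_cover l)"
proof -
  let ?V = "slit (letters - {l})"
  obtain r where r: "r > 0" "cball (\<tau> l) r \<subseteq> ?V"
    using open_contains_cball_eq[OF open_slit] tau_in_slit[OF l] by blast
  define Ln where "Ln = {w::complex. Re w = ln r}"
  have LnE: "Ln \<subseteq> log_cover l"
  proof
    fix w assume "w \<in> Ln"
    then have "norm (exp w) = r" using r(1) by (simp add: Ln_def)
    then have "\<tau> l + exp w \<in> cball (\<tau> l) r" by (simp add: dist_norm)
    then show "w \<in> log_cover l" using r(2) unfolding log_cover_def by blast
  qed
  have cLn: "connected Ln"
  proof -
    have "convex Ln" unfolding Ln_def convex_def by (simp add: ring_distribs(2)[symmetric])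
    then show ?thesis by (rule convex_connected)
  qed
  have conn: "\<exists>w'\<in>Ln. connected_component (log_cover l) w w'" if w: "w \<in> log_cover l" for w
  proof -
    have "path_connected (?V - {\<tau> l})"
      by (rule path_connected_open_delete) (auto intro: open_slit connected_slit)
    moreover have "\<tau> l + exp w \<in> ?V - {\<tau> l}" using w unfolding log_cover_def by simp
    moreover have "\<tau> l + of_real r \<in> ?V - {\<tau> l}"
    proof -
      have "\<tau> l + of_real r \<in> cball (\<tau> l) r" using r(1) by (simp add: dist_norm)
      then show ?thesis using r by auto
    qed
    ultimately obtain p where p: "path p" "path_image p \<subseteq> ?V - {\<tau> l}"
      "pathstart p = \<tau> l + exp w" "pathfinish p = \<tau> l + of_real r"
      unfolding path_connected_def by blast
    then have "\<tau> l \<notin> path_image p" by blast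
    from exp_lift[OF p(1) this p(3)] obtain q where q: "path q" "pathstart q = w"
      "\<And>t. t \<in> {0..1} \<Longrightarrow> p t = \<tau> l + exp (q t)" by metis
    have im: "path_image q \<subseteq> log_cover l"
    proof
      fix y assume "y \<in> path_image q"
      then obtain t where t: "t \<in> {0..1}" "y = q t" unfolding path_image_def by blast
      have "p t \<in> ?V" using p(2) t(1) unfolding path_image_def by blast
      then show "y \<in> log_cover l" using q(3)[OF t(1)] t(2) unfolding log_cover_def by simp
    qed
    have "exp (pathfinish q) = of_real r"
      using q(3)[of 1] p(4) by (simp add: pathfinish_def)
    then have "norm (exp (pathfinish q)) = r" using r(1) by simp
    then have "exp (Re (pathfinish q)) = r" by simp
    then have "pathfinish q \<in> Ln" unfolding Ln_def by auto
    moreover have "connected_component (log_cover l) w (pathfinish q)"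
      unfolding connected_component_def
      using im connected_path_image[OF q(1)] q(2) pathstart_in_path_image[of q] pathfinish_in_path_image[of q] 
      by (intro exI[of _ "path_image q"]) simp
    ultimately show ?thesis by blast
  qed
  show ?thesis
    unfolding connected_iff_connected_component
  proof (intro ballI)
    fix w1 w2 assume w: "w1 \<in> log_cover l" "w2 \<in> log_cover l"
    obtain v1 v2 where v: "v1 \<in> Ln" "v2 \<in> Ln" "connected_component (log_cover l) w1 v1"
      "connected_component (log_cover l) w2 v2"
      using conn[OF w(1)] conn[OF w(2)] by blast
    have "connected_component (log_cover l) v1 v2"
      unfolding connected_component_def using cLn LnE v by blast
    then show "connected_component (log_cover l) w1 w2"
      using v by (meson connected_component_sym connected_component_trans)
  qed
qed

lemma log_cut:
  assumes l: "l \<in> letters" and S: "convex S" "S \<subseteq> {0..}" and \<zeta>: "\<zeta> \<notin> \<gamma> l ` S"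
  obtains lg where "continuous_on S lg" "\<And>t. t \<in> S \<Longrightarrow> \<gamma> l t = \<zeta> + exp (lg t)"
proof -
  obtain lg where "continuous_on S lg" "\<And>t. t \<in> S \<Longrightarrow> \<gamma> l t - \<zeta> = exp (lg t)"
  proof (rule continuous_logarithm_on_contractible[of S "\<lambda>t. \<gamma> l t - \<zeta>"])
    show "continuous_on S (\<lambda>t. \<gamma> l t - \<zeta>)"
      using continuous_on_subset[OF cut_facts(1)[OF l] S(2)] by (intro continuous_intros)
    show "contractible S" using S(1) by (rule convex_imp_contractible)
    show "\<gamma> l z - \<zeta> \<noteq> 0" if "z \<in> S" for z using \<zeta> that by auto
  qed blast
  then show ?thesis using that[of lg] by (simp add: algebra_simps)
qed

text \<open>A point of the complement lies over some other cut. The part of that cut from there to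
  infinity has a logarithmic lift starting at the point; it stays in the complement and its real
  part is unbounded. So no complementary component is bounded.\<close>

lemma simply_connected_log_cover:
  assumes l: "l \<in> letters"
  shows "simply_connected (log_cover l)"
  unfolding simply_connected_eq_unbounded_complement_components[OF open_log_cover]
proof (intro conjI connected_log_cover[OF l] ballI notI)
  fix C assume C: "C \<in> components (- log_cover l)" "bounded C"
  then obtain w where w: "w \<in> C" using in_components_nonempty by blast
  then have "w \<in> - log_cover l" using in_components_subset C by blast
  then obtain m where m: "m \<in> letters" "m \<noteq> l" "\<tau> l + exp w \<in> cut m"
    unfolding log_cover_def slit_def by auto
  then obtain s where s: "s \<ge> 0" "\<tau> l + exp w = \<gamma> m s" unfolding cut_def by auto
  have "\<tau> l \<notin> \<gamma> m ` {s..}" using cut_disj_tau[OF l m(1)] m(2) s(1) unfolding cut_def by auto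
  moreover have "{s..} \<subseteq> {0..}" using s(1) by auto
  ultimately obtain g where g: "continuous_on {s..} g" "\<And>t. t \<in> {s..} \<Longrightarrow> \<gamma> m t = \<tau> l + exp (g t)"
    using log_cut[OF m(1), of "{s..}" "\<tau> l"] convex_real_interval(1)[of s] by blast
  \<comment> \<open>The difference \<open>w - g s\<close> is a multiple of 2 pi i; adding it makes
    the lift start at \<open>w\<close>.\<close>
  define g' where "g' t = g t + (w - g s)" for t
  have "exp (g s) = exp w" using g(2)[of s] s(2) by simp
  then have "exp (w - g s) = 1" by (simp add: exp_diff)
  then have g': "\<gamma> m t = \<tau> l + exp (g' t)" if "t \<in> {s..}" for t
    using g(2)[OF that] by (simp add: g'_def exp_add)
  have sub: "g' ` {s..} \<subseteq> - log_cover l"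
  proof
    fix x assume "x \<in> g' ` {s..}"
    then obtain t where t: "t \<ge> s" "x = g' t" by auto
    have "\<tau> l + exp x \<in> cut m" using g'[of t, symmetric] t s(1) unfolding cut_def by auto
    then show "x \<in> - log_cover l" using m unfolding log_cover_def slit_def by auto
  qed
  have con: "connected (g' ` {s..})"
    by (rule connected_continuous_image) (use g(1) in \<open>auto simp: g'_def intro!: continuous_intros\<close>)
  have "w \<in> g' ` {s..}" by (rule image_eqI[of _ _ s]) (simp_all add: g'_def)
  with w have "C \<inter> g' ` {s..} \<noteq> {}" by blast
  then have sC: "g' ` {s..} \<subseteq> C" by (rule components_maximal[OF C(1) con sub])
  obtain R where R: "\<And>x. x \<in> C \<Longrightarrow> norm x \<le> R" using C(2) unfolding bounded_iff by blast
  obtain T where T: "T \<ge> 0" "\<And>t. t \<ge> T \<Longrightarrow> norm (\<gamma> m t) > norm (\<tau> l) + exp R"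
    by (rule cut_far[OF m(1), where R = "norm (\<tau> l) + exp R"]) blast
  let ?t = "max s T"
  have "g' ?t \<in> C" by (rule subsetD[OF sC]) simp
  then have "norm (g' ?t) \<le> R" by (rule R)
  then have "Re (g' ?t) \<le> R" using complex_Re_le_cmod[of "g' ?t"] by linarith
  then have "norm (exp (g' ?t)) \<le> exp R" by simp
  moreover have "norm (\<gamma> m ?t) \<le> norm (\<tau> l) + norm (exp (g' ?t))"
    using g'[of ?t] norm_triangle_ineq[of "\<tau> l" "exp (g' ?t)"] by simp
  ultimately show False using T(2)[OF max.cobounded2, of s] by linarith
qed

text \<open>Lifted from a common starting point, paths of equal winding number have a common end.
  The lifts are homotopic in the simply connected cover, and the exponential projects the homotopy
  back.\<close>

lemma homotopic_paths_winding:
  assumes l: "l \<in> letters"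
    and c1: "path c1" "path_image c1 \<subseteq> slit (letters - {l}) - {\<tau> l}"
    and c2: "path c2" "path_image c2 \<subseteq> slit (letters - {l}) - {\<tau> l}"
    and pq: "pathstart c2 = pathstart c1" "pathfinish c2 = pathfinish c1"
      "winding_number c1 (\<tau> l) = winding_number c2 (\<tau> l)"
  shows "homotopic_paths (slit (letters - {l}) - {\<tau> l}) c1 c2"
proof -
  let ?D = "slit (letters - {l}) - {\<tau> l}"
  define f where "f = (\<lambda>w. \<tau> l + exp w)"
  have "pathstart c1 \<noteq> \<tau> l" using c1(2) pathstart_in_path_image by blast
  then have w: "pathstart c1 = \<tau> l + exp (Ln (pathstart c1 - \<tau> l))" by simp
  have \<tau>: "\<tau> l \<notin> path_image c1" "\<tau> l \<notin> path_image c2" using c1 c2 by auto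
  obtain c1' where c1': "path c1'" "pathstart c1' = Ln (pathstart c1 - \<tau> l)"
    "\<And>t. t \<in> {0..1} \<Longrightarrow> c1 t = \<tau> l + exp (c1' t)"
    "pathfinish c1' = Ln (pathstart c1 - \<tau> l) + 2 * of_real pi * \<i> * winding_number c1 (\<tau> l)"
    by (rule exp_lift[OF c1(1) \<tau>(1) w]) blast
  obtain c2' where c2': "path c2'" "pathstart c2' = Ln (pathstart c1 - \<tau> l)"
    "\<And>t. t \<in> {0..1} \<Longrightarrow> c2 t = \<tau> l + exp (c2' t)"
    "pathfinish c2' = Ln (pathstart c1 - \<tau> l) + 2 * of_real pi * \<i> * winding_number c2 (\<tau> l)"
    using exp_lift[OF c2(1) \<tau>(2), of "Ln (pathstart c1 - \<tau> l)"] w pq(1) by metis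
  have im: "path_image c1' \<subseteq> log_cover l" "path_image c2' \<subseteq> log_cover l"
    using c1(2) c2(2) c1'(3) c2'(3) unfolding path_image_def log_cover_def by force+
  have "homotopic_paths (log_cover l) c1' c2'"
    using simply_connected_log_cover[OF l] im c1' c2' pq(3)
    unfolding simply_connected_eq_homotopic_paths by simp
  moreover have "f \<in> log_cover l \<rightarrow> ?D" by (auto simp: f_def log_cover_def)
  moreover have "continuous_on (log_cover l) f" unfolding f_def by (intro continuous_intros)
  ultimately have "homotopic_paths ?D (f \<circ> c1') (f \<circ> c2')"
    by (intro homotopic_paths_continuous_image)
  moreover have "homotopic_paths ?D c1 (f \<circ> c1')"
    by (rule homotopic_paths_eq[OF c1]) (use c1'(3) in \<open>simp add: f_def\<close>)
  moreover have "homotopic_paths ?D c2 (f \<circ> c2')"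
    by (rule homotopic_paths_eq[OF c2]) (use c2'(3) in \<open>simp add: f_def\<close>)
  ultimately show ?thesis
    by (meson homotopic_paths_sym homotopic_paths_trans)
qed


text \<open>Over the cut plane, and over the cut itself, the logarithm of \<open>z - \<tau> l\<close> has continuous branches
  \<open>L\<close> and \<open>\<Lambda> \<circ> \<delta>\<close>, so the logarithmic cover splits into sheets \<open>W n\<close> and lifted cuts \<open>\<Gamma> n\<close>.
  As the cover is connected, \<open>W 0\<close> touches two different lifts \<open>\<Gamma> a\<close> and \<open>\<Gamma> b\<close>; a path in \<open>W 0\<close> between
  them and a piece of the cut form a simple closed curve of winding number \<open>b - a\<close>, whence \<open>b - a = \<plusminus>1\<close>.\<close>

lemma log_cover_pieces:
  assumes l: "l \<in> letters"
  obtains L \<Lambda> \<delta> where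
    "continuous_on cut_plane L" "\<And>z. z \<in> cut_plane \<Longrightarrow> z = \<tau> l + exp (L z)"
    "continuous_on {0<..} \<Lambda>" "\<And>t. t > 0 \<Longrightarrow> \<gamma> l t = \<tau> l + exp (\<Lambda> t)"
    "continuous_on (cut l) \<delta>" "\<And>t. t \<ge> 0 \<Longrightarrow> \<delta> (\<gamma> l t) = t"
    "\<And>z. z \<in> cut l \<Longrightarrow> \<delta> z \<ge> 0" "\<And>z. z \<in> cut l \<Longrightarrow> \<gamma> l (\<delta> z) = z"
proof -
  have \<tau>U: "\<tau> l \<notin> cut_plane" using l tau_in_cut unfolding cut_plane_def by blast
  have 1: "continuous_on cut_plane (\<lambda>z. z - \<tau> l)" by (intro continuous_intros)
  have 2: "simply_connected cut_plane" unfolding cut_plane_slit by (rule simply_connected_slit) simp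
  have 3: "locally path_connected cut_plane"
    by (rule open_imp_locally_path_connected) (simp add: cut_plane_slit open_slit)
  obtain L where L: "continuous_on cut_plane L" "\<And>z. z \<in> cut_plane \<Longrightarrow> z - \<tau> l = exp (L z)"
    by (rule continuous_logarithm_on_simply_connected[OF 1 2 3]) (use \<tau>U in auto)
  have "\<tau> l \<notin> \<gamma> l ` {0<..}"
  proof
    assume "\<tau> l \<in> \<gamma> l ` {0<..}"
    then obtain t where t: "t > 0" "\<gamma> l 0 = \<gamma> l t" unfolding \<tau>_def by auto
    have "0 = t" by (rule inj_onD[OF cut_facts(2)[OF l] t(2)]) (use t in auto)
    then show False using t(1) by simp
  qed
  moreover have "{0<..} \<subseteq> {0::real..}" by auto
  ultimately obtain \<Lambda> where \<Lambda>: "continuous_on {0<..} \<Lambda>" "\<And>t. t \<in> {0<..} \<Longrightarrow> \<gamma> l t = \<tau> l + exp (\<Lambda> t)"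
    using log_cut[OF l convex_real_interval(3)[of 0], of "\<tau> l"] by blast
  obtain \<delta> where \<delta>: "continuous_on (cut l) \<delta>" "\<And>t. t \<ge> 0 \<Longrightarrow> \<delta> (\<gamma> l t) = t"
    "\<And>z. z \<in> cut l \<Longrightarrow> \<delta> z \<ge> 0" "\<And>z. z \<in> cut l \<Longrightarrow> \<gamma> l (\<delta> z) = z"
    by (rule cut_homeomorphism[OF l]) blast
  show ?thesis
  proof (rule that[of L \<Lambda> \<delta>])
    show "z = \<tau> l + exp (L z)" if "z \<in> cut_plane" for z using L(2)[OF that] by (simp add: algebra_simps)
    show "\<gamma> l t = \<tau> l + exp (\<Lambda> t)" if "t > 0" for t using \<Lambda>(2) that by simp
  qed (use L \<Lambda> \<delta> in auto)
qed

text \<open>Different multiples are at least 2 pi apart. An integer index that varies continuously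
  up to an error below 1 is therefore locally constant.\<close>

lemma int_multiple_near:
  assumes "norm (2 * of_real pi * \<i> * of_int m - 2 * of_real pi * \<i> * of_int n) < 1"
  shows "m = n"
proof (rule ccontr)
  assume "m \<noteq> n"
  then have "\<bar>real_of_int (m - n)\<bar> \<ge> 1" by linarith
  moreover have "2 * of_real pi * \<i> * of_int m - 2 * of_real pi * \<i> * of_int n = 2 * of_real pi * \<i> * of_int (m - n)"
    by (simp add: algebra_simps)
  then have "norm (2 * of_real pi * \<i> * of_int m - 2 * of_real pi * \<i> * of_int n) = 2 * pi * \<bar>real_of_int (m - n)\<bar>"
    by (simp only: norm_mult norm_of_int) simp
  moreover have "2 * pi * 1 \<le> 2 * pi * \<bar>real_of_int (m - n)\<bar>"
    using calculation(1) by (intro mult_left_mono) auto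
  ultimately show False using assms pi_gt3 by linarith
qed

text \<open>Suppose that the sheet \<open>W 0\<close> touches no lift of the cut except possibly
  \<open>\<Gamma> a\<close>. Then the sets \<open>W n \<union> \<Gamma> (a + n)\<close> are open and
  disjoint and cover the logarithmic cover, which is connected. The paths obtained are segments
  towards touching points, stopped on leaving \<open>W 0\<close>.\<close>

lemma cut_lifts_touching:
  assumes l: "l \<in> letters"
    and L: "continuous_on cut_plane L" "\<And>z. z \<in> cut_plane \<Longrightarrow> z = \<tau> l + exp (L z)"
    and \<Lambda>: "continuous_on {0<..} \<Lambda>" "\<And>t. t > 0 \<Longrightarrow> \<gamma> l t = \<tau> l + exp (\<Lambda> t)"
    and \<delta>: "continuous_on (cut l) \<delta>" "\<And>t. t \<ge> 0 \<Longrightarrow> \<delta> (\<gamma> l t) = t"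
      "\<And>z. z \<in> cut l \<Longrightarrow> \<delta> z \<ge> 0" "\<And>z. z \<in> cut l \<Longrightarrow> \<gamma> l (\<delta> z) = z"
  obtains a b :: int and s t g h where "a \<noteq> b" "s > 0" "t > 0"
    "path g" "pathstart g \<in> L ` cut_plane" "pathfinish g = \<Lambda> s + 2 * of_real pi * \<i> * of_int a"
    "path_image g \<subseteq> insert (pathfinish g) (L ` cut_plane)"
    "path h" "pathstart h \<in> L ` cut_plane" "pathfinish h = \<Lambda> t + 2 * of_real pi * \<i> * of_int b"
    "path_image h \<subseteq> insert (pathfinish h) (L ` cut_plane)"
proof -
  define f where "f = (\<lambda>w. \<tau> l + exp w)"
  have contf: "continuous_on S f" for S unfolding f_def by (intro continuous_intros)
  define c where "c n = 2 * of_real pi * \<i> * of_int n" for n :: int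
  have fc: "f (w + c n) = f w" "f (w - c n) = f w" for w n
  proof -
    have "exp (c n) = 1" unfolding c_def exp_eq_1 by simp
    then show "f (w + c n) = f w" "f (w - c n) = f w" by (simp_all add: f_def exp_add exp_diff)
  qed
  have cadd: "c (m + n) = c m + c n" for m n by (simp add: c_def algebra_simps)
  have cdiff: "c (m - n) = c m - c n" for m n by (simp add: c_def algebra_simps)
  have feq: "\<exists>n. w - v = c n" if "f w = f v" for w v
  proof -
    obtain n :: int where "w = v + (of_int (2 * n) * pi) * \<i>"
      using \<open>f w = f v\<close> by (auto simp: f_def exp_eq)
    then have "w - v = c n" by (simp add: c_def mult_ac)
    then show ?thesis ..
  qed
  define E where "E = log_cover l"
  have Uf: "z \<in> slit (letters - {l}) \<longleftrightarrow> z \<in> cut_plane \<or> z \<in> cut l" for z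
    using l cut_disj[OF l] unfolding cut_plane_def slit_def by auto
  have disjU: "z \<in> cut_plane \<Longrightarrow> z \<notin> cut l" for z using l unfolding cut_plane_def by auto
  \<comment> \<open>The index counts the turns by which \<open>w\<close> differs from the chosen
    branch of the logarithm: \<open>L\<close> over the cut plane,
    \<open>\<Lambda> \<circ> \<delta>\<close> over the cut.\<close>
  define W where "W n = {w. f w \<in> cut_plane \<and> w - L (f w) = c n}" for n
  define \<Gamma> where "\<Gamma> n = {w. f w \<in> cut l \<and> w - \<Lambda> (\<delta> (f w)) = c n}" for n
  have fL: "f (L z) = z" if "z \<in> cut_plane" for z using L(2)[OF that] by (simp add: f_def)
  have W0: "W 0 = L ` cut_plane"
  proof
    show "L ` cut_plane \<subseteq> W 0" using fL by (auto simp: W_def c_def)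
    show "W 0 \<subseteq> L ` cut_plane"
    proof
      fix w assume "w \<in> W 0"
      then have w: "f w \<in> cut_plane" "w - L (f w) = 0" unfolding W_def c_def by simp_all
      have "w = L (f w)" using w(2) by (simp only: right_minus_eq)
      with w(1) show "w \<in> L ` cut_plane" by (rule rev_image_eqI)
    qed
  qed
  \<comment> \<open>The exponential omits zero, so nothing lies over \<open>\<tau> l\<close>, and
    the parameter stays in the domain of \<Lambda>.\<close>
  have dpos: "\<delta> (f w) > 0" if "f w \<in> cut l" for w
  proof -
    have "\<delta> (f w) \<noteq> 0"
    proof
      assume "\<delta> (f w) = 0"
      then have "f w = \<tau> l" using \<delta>(4)[OF that] by (simp add: \<tau>_def)
      then show False by (simp add: f_def)
    qed
    then show ?thesis using \<delta>(3)[OF that] by linarith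
  qed
  have fLam: "f (\<Lambda> (\<delta> (f w))) = f w" if "f w \<in> cut l" for w
    using \<Lambda>(2)[OF dpos[OF that]] \<delta>(4)[OF that] by (simp add: f_def)
  have E: "w \<in> E \<longleftrightarrow> (\<exists>n. w \<in> W n) \<or> (\<exists>n. w \<in> \<Gamma> n)" for w
  proof
    assume "w \<in> E"
    then consider "f w \<in> cut_plane" | "f w \<in> cut l"
      using Uf unfolding E_def log_cover_def f_def by blast
    then show "(\<exists>n. w \<in> W n) \<or> (\<exists>n. w \<in> \<Gamma> n)"
    proof cases
      case 1
      then show ?thesis using feq[of w "L (f w)"] fL[OF 1] 1 unfolding W_def by simp
    next
      case 2
      then show ?thesis using feq[of w "\<Lambda> (\<delta> (f w))"] fLam[OF 2] 2 unfolding \<Gamma>_def by simp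
    qed
  next
    assume "(\<exists>n. w \<in> W n) \<or> (\<exists>n. w \<in> \<Gamma> n)"
    then show "w \<in> E" using Uf unfolding E_def log_cover_def W_def \<Gamma>_def f_def by blast
  qed
  have cinj: "c m = c n \<Longrightarrow> m = n" for m n by (rule int_multiple_near) (simp add: c_def)
  have WW: "m = n" if "w \<in> W m" "w \<in> W n" for w m n
    using that cinj[of m n] unfolding W_def by simp
  have GG: "m = n" if "w \<in> \<Gamma> m" "w \<in> \<Gamma> n" for w m n
    using that cinj[of m n] unfolding \<Gamma>_def by simp
  have WG: "w \<notin> \<Gamma> n" if "w \<in> W m" for w m n using that disjU unfolding W_def \<Gamma>_def by blast
  have Wsh: "w + c m \<in> W (n + m) \<longleftrightarrow> w \<in> W n" for w m n
    unfolding W_def mem_Collect_eq fc cadd by (simp add: algebra_simps)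
  have Gsh: "w + c m \<in> \<Gamma> (n + m) \<longleftrightarrow> w \<in> \<Gamma> n" for w m n
    unfolding \<Gamma>_def mem_Collect_eq fc cadd by (simp add: algebra_simps)
  have opU: "open cut_plane" by (simp add: cut_plane_slit open_slit)
  have openW: "open (W n)" for n
  proof -
    have o: "open (f -` cut_plane)" by (rule open_vimage[OF opU contf])
    \<comment> \<open>The possible values of \<open>w - L (f w)\<close> are the \<open>c n\<close>,
      and radius 1 isolates one of them.\<close>
    have "open (f -` cut_plane \<inter> (\<lambda>w. w - L (f w)) -` ball (c n) 1)"
      by (rule continuous_open_preimage[OF _ o])
         (auto intro!: continuous_intros continuous_on_compose2[OF L(1) contf])
    moreover have "f -` cut_plane \<inter> (\<lambda>w. w - L (f w)) -` ball (c n) 1 = W n"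
    proof -
      have "w - L (f w) = c n" if w: "f w \<in> cut_plane" "dist (c n) (w - L (f w)) < 1" for w
      proof -
        obtain m where m: "w - L (f w) = c m" using feq[of w "L (f w)"] fL[OF w(1)] by metis
        then have "norm (c n - c m) < 1" using w(2) by (simp add: dist_norm)
        then have "n = m" unfolding c_def by (rule int_multiple_near)
        then show ?thesis using m by simp
      qed
      moreover have "dist (c n) (w - L (f w)) < 1" if "w - L (f w) = c n" for w
        using that by simp
      ultimately show ?thesis unfolding W_def by auto
    qed
    ultimately show ?thesis by simp
  qed
  have opE: "open E" unfolding E_def by (rule open_log_cover)
  \<comment> \<open>Near a point of \<open>\<Gamma> a\<close> the index over the cut is continuous,
    hence constant; a small ball meets no other lift.\<close>
  have nbhd: "\<exists>r>0. ball w r \<subseteq> E \<and> (\<forall>n. ball w r \<inter> \<Gamma> n \<noteq> {} \<longrightarrow> n = a)" if w: "w \<in> \<Gamma> a" for w a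
  proof -
    have wE: "w \<in> E" using E w by blast
    then obtain r1 where r1: "r1 > 0" "ball w r1 \<subseteq> E" using opE open_contains_ball by blast
    have fw: "f w \<in> cut l" using w by (simp add: \<Gamma>_def)
    have "continuous_on {w. f w \<in> cut l} (\<lambda>w. w - \<Lambda> (\<delta> (f w)))"
      by (intro continuous_intros continuous_on_compose2[OF \<Lambda>(1)] continuous_on_compose2[OF \<delta>(1) contf])
         (use dpos in auto)
    then obtain r2 where r2: "r2 > 0" "\<And>v. f v \<in> cut l \<Longrightarrow> dist v w < r2 \<Longrightarrow>
        dist (v - \<Lambda> (\<delta> (f v))) (w - \<Lambda> (\<delta> (f w))) < 1"
      using fw unfolding continuous_on_iff by (metis mem_Collect_eq zero_less_one)
    have "n = a" if v: "v \<in> ball w r2" "v \<in> \<Gamma> n" for v n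
    proof -
      have "v - \<Lambda> (\<delta> (f v)) = c n" "w - \<Lambda> (\<delta> (f w)) = c a"
        using v(2) w unfolding \<Gamma>_def by simp_all
      moreover have "f v \<in> cut l" "dist v w < r2" using v by (simp_all add: \<Gamma>_def dist_commute)
      ultimately have "norm (c n - c a) < 1" using r2(2)[of v] by (simp add: dist_norm)
      then show ?thesis unfolding c_def by (rule int_multiple_near)
    qed
    then show ?thesis using r1 r2 by (intro exI[of _ "min r1 r2"]) (auto simp: subset_iff)
  qed
  define adj where "adj a \<longleftrightarrow> \<Gamma> a \<inter> closure (W 0) \<noteq> {}" for a
  \<comment> \<open>A boundary point of \<open>W m\<close> inside the cover is on no sheet, because
    the sheets are open and disjoint; so it lies over the cut.\<close>
  have fr: "\<exists>n. x \<in> \<Gamma> n" if x: "x \<in> E" "x \<in> closure (W m)" "x \<notin> W m" for x m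
  proof -
    have "x \<notin> W n" for n
    proof
      assume xn: "x \<in> W n"
      then have "n \<noteq> m" using x(3) by auto
      have "W n \<inter> W m \<noteq> {}"
        using x(2) xn openW[of n] open_Int_closure_eq_empty[OF openW[of n], of "W m"] by blast
      then show False using WW \<open>n \<noteq> m\<close> by blast
    qed
    then show ?thesis using E x(1) by blast
  qed
  have "\<exists>a b. a \<noteq> b \<and> adj a \<and> adj b"
  proof (rule ccontr)
    assume "\<nexists>a b. a \<noteq> b \<and> adj a \<and> adj b"
    \<comment> \<open>Such an \<open>a\<close> exists also in the case that no lift is
      touched.\<close>
    then obtain a where a: "\<And>n. adj n \<Longrightarrow> n = a" by metis
    define Y where "Y n = W n \<union> \<Gamma> (a + n)" for n
    have Y: "\<exists>r>0. ball w r \<subseteq> Y n" if w: "w \<in> Y n" for w n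
    proof (cases "w \<in> W n")
      case True
      then obtain r where "r > 0" "ball w r \<subseteq> W n" using openW open_contains_ball by meson
      then show ?thesis unfolding Y_def by blast
    next
      case False
      then have w: "w \<in> \<Gamma> (a + n)" using that by (simp add: Y_def)
      obtain r where r: "r > 0" "ball w r \<subseteq> E" "\<And>m. ball w r \<inter> \<Gamma> m \<noteq> {} \<Longrightarrow> m = a + n"
        using nbhd[OF w] by blast
      \<comment> \<open>Being connected and not contained in \<open>W m\<close>, the ball contains a
        boundary point of \<open>W m\<close>, which must lie on \<open>\<Gamma> (a + n)\<close>.
        Translated by \<open>- c m\<close>, it shows that \<open>\<Gamma> (a + n - m)\<close>
        touches \<open>W 0\<close>; hence a + n - m = a.\<close>
      have m: "m = n" if ne: "ball w r \<inter> W m \<noteq> {}" for m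
      proof -
        have "w \<notin> W m" using WG[of w m "a + n"] w by blast
        moreover have "w \<in> ball w r" using r(1) by simp
        ultimately have "ball w r - W m \<noteq> {}" by blast
        then have "ball w r \<inter> frontier (W m) \<noteq> {}"
          using connected_Int_frontier[of "ball w r" "W m"] ne by (simp add: convex_connected)
        then obtain x where x: "x \<in> ball w r" "x \<in> closure (W m)" "x \<notin> W m"
          using openW[of m] by (auto simp: frontier_def interior_open)
        obtain k where k: "x \<in> \<Gamma> k" using fr[of x m] x r(2) by blast
        then have kk: "k = a + n" using r(3) x(1) by blast
        have "x - c m \<in> \<Gamma> (k - m)" using Gsh[of "x - c m" m "k - m"] k by simp
        moreover have "x - c m \<in> closure (W 0)"
        proof -
          have "(\<lambda>w. - c m + w) ` W m = W 0"
          proof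
            show "(\<lambda>w. - c m + w) ` W m \<subseteq> W 0"
            proof (rule image_subsetI)
              fix y assume "y \<in> W m"
              then show "- c m + y \<in> W 0" using Wsh[of "- c m + y" m 0] by simp
            qed
            show "W 0 \<subseteq> (\<lambda>w. - c m + w) ` W m"
            proof
              fix y assume "y \<in> W 0"
              then have "y + c m \<in> W m" using Wsh[of y m 0] by simp
              then show "y \<in> (\<lambda>w. - c m + w) ` W m" by (intro image_eqI[of _ _ "y + c m"]) auto
            qed
          qed
          then have "closure (W 0) = (\<lambda>w. - c m + w) ` closure (W m)"
            using closure_translation[of "- c m" "W m"] by simp
          moreover have "x - c m = - c m + x" by simp
          ultimately show ?thesis using x(2) by (simp only: imageI)
        qed
        ultimately have "adj (k - m)" unfolding adj_def by blast
        then have "k - m = a" by (rule a)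
        then show ?thesis using kk by simp
      qed
      have "ball w r \<subseteq> Y n"
      proof
        fix y assume y: "y \<in> ball w r"
        then consider k where "y \<in> W k" | k where "y \<in> \<Gamma> k" using r(2) E by blast
        then show "y \<in> Y n"
        proof cases
          case 1
          then have "k = n" using m y by blast
          then show ?thesis using 1 by (simp add: Y_def)
        next
          case 2
          then have "k = a + n" using r(3) y by blast
          then show ?thesis using 2 by (simp add: Y_def)
        qed
      qed
      then show ?thesis using r(1) by blast
    qed
    have opY: "open (Y n)" for n unfolding open_contains_ball using Y by blast
    have EY: "E \<subseteq> Y 0 \<union> (\<Union>n\<in>-{0}. Y n)"
    proof
      fix y assume "y \<in> E"
      have Yk: "y \<in> Y 0 \<union> (\<Union>n\<in>-{0}. Y n)" if "y \<in> Y k" for k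
      proof (cases "k = 0")
        case False
        then have "k \<in> -{0}" by simp
        then have "y \<in> (\<Union>n\<in>-{0}. Y n)" using that by (rule UN_I)
        then show ?thesis by (rule UnI2)
      qed (use that in simp)
      from \<open>y \<in> E\<close> consider k where "y \<in> W k" | k where "y \<in> \<Gamma> k" using E by blast
      then show "y \<in> Y 0 \<union> (\<Union>n\<in>-{0}. Y n)"
      proof cases
        case 1
        then have "y \<in> Y k" by (simp add: Y_def)
        then show ?thesis by (rule Yk)
      next
        case 2
        then have "y \<in> Y (k - a)" by (simp add: Y_def)
        then show ?thesis by (rule Yk)
      qed
    qed
    have Ydis: "Y 0 \<inter> (\<Union>n\<in>-{0}. Y n) = {}"
    proof -
      have "m = n" if "y \<in> Y m" "y \<in> Y n" for y m n
        using that WW[of y m n] WG[of y m "a + n"] WG[of y n "a + m"] GG[of y "a + m" "a + n"]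
        unfolding Y_def by auto
      then show ?thesis by blast
    qed
    have "(0::complex) \<in> cut_plane" unfolding cut_plane_slit by (rule real_in_slit) auto
    then have ne: "L 0 \<in> W 0" unfolding W0 by blast
    then have ne1: "L 0 + c 1 \<in> W 1" using Wsh[of "L 0" 1 0] by simp
    have "open (\<Union>n\<in>-{0}. Y n)" using opY by blast
    moreover have "Y 0 \<inter> (\<Union>n\<in>-{0}. Y n) \<inter> E = {}" unfolding Ydis by simp
    ultimately have "Y 0 \<inter> E = {} \<or> (\<Union>n\<in>-{0}. Y n) \<inter> E = {}"
      using connectedD[OF connected_log_cover[OF l, folded E_def] opY _ _ EY] by blast
    moreover have "L 0 \<in> Y 0 \<inter> E" using ne E[of "L 0"] by (auto simp: Y_def)
    moreover have "L 0 + c 1 \<in> (\<Union>n\<in>-{0}. Y n) \<inter> E"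
    proof
      have "L 0 + c 1 \<in> Y 1" using ne1 by (simp add: Y_def)
      then show "L 0 + c 1 \<in> (\<Union>n\<in>-{0}. Y n)" by (rule UN_I[rotated]) simp
      show "L 0 + c 1 \<in> E" using ne1 E[of "L 0 + c 1"] by blast
    qed
    ultimately show False by blast
  qed
  then obtain a b where ab: "a \<noteq> b" "adj a" "adj b" by blast
  have acc: "\<exists>g s. s > 0 \<and> path g \<and> pathstart g \<in> L ` cut_plane \<and> pathfinish g = \<Lambda> s + c a \<and>
      path_image g \<subseteq> insert (pathfinish g) (L ` cut_plane)" if a: "adj a" for a
  proof -
    obtain w where w: "w \<in> \<Gamma> a" "w \<in> closure (W 0)" using a unfolding adj_def by blast
    obtain r where r: "r > 0" "ball w r \<subseteq> E" "\<And>m. ball w r \<inter> \<Gamma> m \<noteq> {} \<Longrightarrow> m = a"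
      using nbhd[OF w(1)] by blast
    obtain y where y: "y \<in> W 0" "y \<in> ball w r"
      using w(2) r(1) unfolding closure_approachable mem_ball by (metis dist_commute)
    have st: "pathstart (linepath y w) \<in> closure (W 0)" using y(1) closure_subset by auto
    have fi: "pathfinish (linepath y w) \<notin> W 0" using WG[of w 0 a] w(1) by auto
    \<comment> \<open>The segment is stopped at a frontier point of \<open>W 0\<close>. As it stays
      in the ball, this point lies on the same lift \<open>\<Gamma> a\<close>, though perhaps at
      another parameter than \<open>w\<close>.\<close>
    obtain h where h: "path h" "pathstart h = pathstart (linepath y w)"
      "path_image h \<subseteq> path_image (linepath y w)" "path_image h - {pathfinish h} \<subseteq> interior (W 0)"
      "pathfinish h \<in> frontier (W 0)"
      using exists_path_subpath_to_frontier[OF path_linepath st fi] by blast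
    have "path_image (linepath y w) \<subseteq> ball w r"
      using y(2) r(1) closed_segment_subset[of y "ball w r" w] by simp
    then have pf: "pathfinish h \<in> ball w r" using h(3) pathfinish_in_path_image by blast
    have cl: "pathfinish h \<in> closure (W 0)" "pathfinish h \<notin> W 0"
      using h(5) openW[of 0] by (auto simp: frontier_def interior_open)
    obtain k where k: "pathfinish h \<in> \<Gamma> k" using fr[OF _ cl] pf r(2) by blast
    then have "k = a" using r(3) pf by blast
    with k have pe: "pathfinish h = \<Lambda> (\<delta> (f (pathfinish h))) + c a" "f (pathfinish h) \<in> cut l"
      unfolding \<Gamma>_def mem_Collect_eq by (simp_all add: algebra_simps)
    have "path_image h \<subseteq> insert (pathfinish h) (L ` cut_plane)"
      using h(4) interior_subset unfolding W0 by blast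
    then show ?thesis
      using h(1,2) y(1) pe(1) dpos[OF pe(2)] unfolding W0
      by (intro exI[of _ h] exI[of _ "\<delta> (f (pathfinish h))"]) simp
  qed
  obtain g s where g: "s > 0" "path g" "pathstart g \<in> L ` cut_plane" "pathfinish g = \<Lambda> s + c a"
    "path_image g \<subseteq> insert (pathfinish g) (L ` cut_plane)" using acc[OF ab(2)] by blast
  obtain h t where h: "t > 0" "path h" "pathstart h \<in> L ` cut_plane" "pathfinish h = \<Lambda> t + c b"
    "path_image h \<subseteq> insert (pathfinish h) (L ` cut_plane)" using acc[OF ab(3)] by blast
  show ?thesis
    by (rule that[OF ab(1) g(1) h(1) g(2,3) g(4)[unfolded c_def] g(5) h(2,3) h(4)[unfolded c_def] h(5)])
qed


text \<open>The projection is injective on the image of \<open>L\<close>, so apart from its ends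
  \<open>e\<close> projects to a simple curve off the cut. Closed up by the piece of the cut between
  the parameters \<open>s\<close> and \<open>t\<close>, it is a simple closed curve, with winding
  number -1, 0 or 1 about \<open>\<tau> l\<close>. Read off from the lift this number is b - a,
  which is not zero.\<close>

lemma cut_lifts_adjacent:
  assumes l: "l \<in> letters"
    and L: "\<And>z. z \<in> cut_plane \<Longrightarrow> z = \<tau> l + exp (L z)"
    and \<Lambda>: "continuous_on {0<..} \<Lambda>" "\<And>t. t > 0 \<Longrightarrow> \<gamma> l t = \<tau> l + exp (\<Lambda> t)"
    and st: "s > 0" "t > 0" and ab: "a \<noteq> b"
    and e: "arc e" "pathstart e = \<Lambda> s + 2 * of_real pi * \<i> * of_int a"
      "pathfinish e = \<Lambda> t + 2 * of_real pi * \<i> * of_int b"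
      "path_image e \<subseteq> {pathstart e, pathfinish e} \<union> L ` cut_plane"
  shows "\<bar>b - a\<bar> = 1"
proof -
  define f where "f = (\<lambda>w. \<tau> l + exp w)"
  have contf: "continuous_on S f" for S unfolding f_def by (intro continuous_intros)
  have fc: "f (w + 2 * of_real pi * \<i> * of_int n) = f w" for w and n :: int
    using exp_plus_2pin[of w n] by (simp add: f_def algebra_simps)
  have fL: "f (L z) = z" if "z \<in> cut_plane" for z using L[OF that] by (simp add: f_def)
  have fL': "w = L (f w)" if "w \<in> L ` cut_plane" for w using that fL by force
  have fU: "f w \<in> cut_plane" if "w \<in> L ` cut_plane" for w using that fL by force
  have disjU: "z \<in> cut_plane \<Longrightarrow> z \<notin> cut l" for z using l unfolding cut_plane_def by auto
  have fe: "f (pathstart e) = \<gamma> l s" "f (pathfinish e) = \<gamma> l t"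
    unfolding e(2,3) fc using \<Lambda>(2) st by (simp_all add: f_def)
  have cs: "\<gamma> l s \<in> cut l" "\<gamma> l t \<in> cut l" using st unfolding cut_def by auto
  have pe: "path e" "inj_on e {0..1}" using e(1) by (simp_all add: arc_def)
  have mid: "e x \<in> L ` cut_plane" if "0 < x" "x < 1" for x
  proof -
    have "e x \<in> path_image e" unfolding path_image_def using that by auto
    moreover have "e x \<noteq> e 0" "e x \<noteq> e 1" using inj_onD[OF pe(2), of x 0] inj_onD[OF pe(2), of x 1] that by auto
    ultimately show ?thesis using e(4) unfolding pathstart_def pathfinish_def by blast
  qed
  have finj: "f (e x) = f (e y) \<Longrightarrow> x = y" if "0 < x" "x < 1" "0 < y" "y < 1" for x y
  proof -
    assume "f (e x) = f (e y)"
    then have "e x = e y" using fL'[OF mid[OF that(1,2)]] fL'[OF mid[OF that(3,4)]] by metis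
    then show "x = y" using inj_onD[OF pe(2), of x y] that by simp
  qed
  have fmid: "f (e x) \<notin> cut l" if "0 < x" "x < 1" for x using fU[OF mid[OF that]] disjU by blast
  have pfe: "path (f \<circ> e)" by (rule path_continuous_image[OF pe(1) contf])
  have notau: "\<tau> l \<notin> path_image (f \<circ> q)" for q :: "real \<Rightarrow> complex"
    unfolding path_image_def f_def by auto
  have "winding_number g (\<tau> l) \<in> {-1, 0, 1} \<Longrightarrow> winding_number g (\<tau> l) = of_int (b - a) \<Longrightarrow> \<bar>b - a\<bar> = 1" for g
  proof -
    assume w: "winding_number g (\<tau> l) \<in> {-1, 0, 1}" "winding_number g (\<tau> l) = of_int (b - a)"
    then have "(of_int (b - a) :: complex) \<in> {of_int (-1), of_int 0, of_int 1}" by simp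
    then have "b - a \<in> {-1, 0, 1}" unfolding insert_iff of_int_eq_iff by blast
    then show ?thesis using ab by auto
  qed
  note concl = this
  have wn: "winding_number (f \<circ> q) (\<tau> l) = z"
    if "path q" "pathfinish q - pathstart q = z * (2 * of_real pi * \<i>)" for q z
  proof -
    have "f \<circ> q = (\<lambda>t. \<tau> l + exp (q t))" by (simp add: f_def fun_eq_iff)
    then show ?thesis using winding_number_exp_lift[OF that(1), of "\<tau> l"] unfolding that(2) by simp
  qed
  show ?thesis
  \<comment> \<open>For s = t both ends lie over the same point of the cut, and the projected curve
    is closed already.\<close>
  proof (cases "s = t")
    case True
    have "simple_path (f \<circ> e)"
      unfolding simple_path_def loop_free_def
    proof (intro conjI pfe ballI impI)
      fix x y :: real assume xy: "x \<in> {0..1}" "y \<in> {0..1}" "(f \<circ> e) x = (f \<circ> e) y"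
      have ends: "f (e 0) \<in> cut l" "f (e 1) \<in> cut l" using fe cs by (simp_all add: pathstart_def pathfinish_def)
      show "x = y \<or> x = 0 \<and> y = 1 \<or> x = 1 \<and> y = 0"
      proof (cases "0 < x \<and> x < 1 \<and> 0 < y \<and> y < 1")
        case True
        then show ?thesis using finj[of x y] xy(3) by simp
      next
        case False
        then consider "x = 0" | "x = 1" | "y = 0" | "y = 1" using xy(1,2) by force
        then have "(x = 0 \<or> x = 1) \<and> (y = 0 \<or> y = 1)"
          using fmid[of x] fmid[of y] ends xy by cases (auto simp: less_le)
        then show ?thesis by auto
      qed
    qed
    moreover have "pathfinish (f \<circ> e) = pathstart (f \<circ> e)"
      using fe True by (simp add: pathfinish_def pathstart_def)
    ultimately have "winding_number (f \<circ> e) (\<tau> l) \<in> {-1,0,1}"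
      using notau by (intro simple_closed_path_winding_number_cases) auto
    moreover have "winding_number (f \<circ> e) (\<tau> l) = of_int (b - a)"
      by (rule wn[OF pe(1)]) (unfold e(2,3) True, simp add: algebra_simps)
    ultimately show ?thesis by (rule concl)
  next
    case False
    \<comment> \<open>The piece of the cut from \<open>t\<close> to \<open>s\<close>, lifted with
      index \<open>b\<close>: appended to \<open>e\<close>, it ends exactly b - a turns above the
      start of \<open>e\<close>.\<close>
    define m where "m = (\<lambda>x. \<Lambda> (linepath t s x) + 2 * of_real pi * \<i> * of_int b)"
    have lp: "linepath t s x > 0" if "x \<in> {0..1}" for x
    proof -
      have "linepath t s x \<in> closed_segment t s" using that by (simp add: linepath_in_path)
      then show ?thesis using st by (auto simp: closed_segment_eq_real_ivl split: if_splits)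
    qed
    have pm: "path m"
      unfolding m_def path_def
      by (intro continuous_intros continuous_on_compose2[OF \<Lambda>(1)]) (use lp in auto)
    have fm: "f (m x) = \<gamma> l (linepath t s x)" if "x \<in> {0..1}" for x
      unfolding m_def fc using \<Lambda>(2)[OF lp[OF that]] by (simp add: f_def)
    have "arc (f \<circ> m)"
      unfolding arc_def
    proof
      show "path (f \<circ> m)" by (rule path_continuous_image[OF pm contf])
      show "inj_on (f \<circ> m) {0..1}"
      proof (rule inj_onI)
        fix x y :: real assume xy: "x \<in> {0..1}" "y \<in> {0..1}" "(f \<circ> m) x = (f \<circ> m) y"
        then have "\<gamma> l (linepath t s x) = \<gamma> l (linepath t s y)" using fm by simp
        then have "linepath t s x = linepath t s y"
          by (rule inj_onD[OF cut_facts(2)[OF l]]) (use lp[OF xy(1)] lp[OF xy(2)] in auto)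
        then have "(x - y) * (s - t) = 0" by (simp add: linepath_def algebra_simps)
        then show "x = y" using False by simp
      qed
    qed
    moreover have "arc (f \<circ> e)"
      unfolding arc_def
    proof (intro conjI pfe inj_onI)
      fix x y :: real assume xy: "x \<in> {0..1}" "y \<in> {0..1}" "(f \<circ> e) x = (f \<circ> e) y"
      have ends: "f (e 0) \<in> cut l" "f (e 1) \<in> cut l" using fe cs by (simp_all add: pathstart_def pathfinish_def)
      have ne: "f (e 0) \<noteq> f (e 1)"
      proof
        assume "f (e 0) = f (e 1)"
        then have "\<gamma> l s = \<gamma> l t" using fe by (simp add: pathstart_def pathfinish_def)
        then have "s = t" by (rule inj_onD[OF cut_facts(2)[OF l]]) (use st in auto)
        then show False using False by blast
      qed
      show "x = y"
      proof (cases "0 < x \<and> x < 1 \<and> 0 < y \<and> y < 1")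
        case True
        then show ?thesis using finj[of x y] xy(3) by simp
      next
        case False
        then consider "x = 0" | "x = 1" | "y = 0" | "y = 1" using xy(1,2) by force
        then have "(x = 0 \<or> x = 1) \<and> (y = 0 \<or> y = 1)"
          using fmid[of x] fmid[of y] ends xy by cases (auto simp: less_le)
        then show ?thesis using ne xy(3) by auto
      qed
    qed
    moreover have j1: "pathfinish (f \<circ> e) = pathstart (f \<circ> m)"
      using fe fm[of 0] by (simp add: pathfinish_def pathstart_def linepath_def)
    moreover have j2: "pathfinish (f \<circ> m) = pathstart (f \<circ> e)"
      using fe fm[of 1] by (simp add: pathfinish_def pathstart_def linepath_def)
    moreover have "path_image (f \<circ> e) \<inter> path_image (f \<circ> m) \<subseteq> {pathstart (f \<circ> e), pathstart (f \<circ> m)}"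
    proof
      fix z assume z: "z \<in> path_image (f \<circ> e) \<inter> path_image (f \<circ> m)"
      then obtain x where x: "x \<in> {0..1}" "z = f (e x)" unfolding path_image_def by auto
      obtain y where y: "y \<in> {0..1}" "z = f (m y)" using z unfolding path_image_def by auto
      have "z \<in> cut l" unfolding y(2) fm[OF y(1)] cut_def using lp[OF y(1)] by auto
      then have "\<not> (0 < x \<and> x < 1)" using fmid[of x] x(2) by blast
      then have "x = 0 \<or> x = 1" using x(1) by auto
      then show "z \<in> {pathstart (f \<circ> e), pathstart (f \<circ> m)}"
        using x(2) j1 by (auto simp: pathstart_def pathfinish_def)
    qed
    ultimately have sp: "simple_path ((f \<circ> e) +++ (f \<circ> m))" by (intro simple_path_join_loop)
    have em: "pathfinish e = pathstart m" unfolding e(3) m_def by (simp add: pathstart_def linepath_def)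
    have eq: "(f \<circ> e) +++ (f \<circ> m) = f \<circ> (e +++ m)" by (simp add: path_compose_join)
    have "winding_number (f \<circ> (e +++ m)) (\<tau> l) \<in> {-1,0,1}"
    proof (rule simple_closed_path_winding_number_cases[OF _ _ notau])
      show "simple_path (f \<circ> (e +++ m))" using sp unfolding eq .
      show "pathfinish (f \<circ> (e +++ m)) = pathstart (f \<circ> (e +++ m))"
        unfolding eq[symmetric] using j2 by simp
    qed
    moreover have "winding_number (f \<circ> (e +++ m)) (\<tau> l) = of_int (b - a)"
    proof (rule wn)
      show "path (e +++ m)" using pe pm em by simp
      show "pathfinish (e +++ m) - pathstart (e +++ m) = of_int (b - a) * (2 * of_real pi * \<i>)"
      proof -
        have "pathfinish m = \<Lambda> s + 2 * of_real pi * \<i> * of_int b"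
          by (simp add: m_def pathfinish_def linepath_def)
        then show ?thesis by (simp add: e(2) algebra_simps)
      qed
    qed
    ultimately show ?thesis by (rule concl)
  qed
qed


text \<open>The loop is described by its lift: along \<open>e1\<close> to the lift of the cut with
  index n + 1, along this lift from \<open>s\<close> to \<open>t\<close>, and back along
  \<open>e2\<close> raised by one turn. It ends one turn above its start and is over the cut only in
  the middle part.\<close>

lemma bypass_from_lifts:
  assumes l: "l \<in> letters" and k: "k \<in> cut_plane"
    and L: "\<And>z. z \<in> cut_plane \<Longrightarrow> z = \<tau> l + exp (L z)"
    and \<Lambda>: "continuous_on {0<..} \<Lambda>" "\<And>t. t > 0 \<Longrightarrow> \<gamma> l t = \<tau> l + exp (\<Lambda> t)"
    and st: "s > 0" "t > 0"
    and e1: "path e1" "pathstart e1 = L k" "pathfinish e1 = \<Lambda> s + 2 * of_real pi * \<i> * of_int (n + 1)"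
      "\<And>x. 0 \<le> x \<Longrightarrow> x < 1 \<Longrightarrow> e1 x \<in> L ` cut_plane"
    and e2: "path e2" "pathstart e2 = L k" "pathfinish e2 = \<Lambda> t + 2 * of_real pi * \<i> * of_int n"
      "\<And>x. 0 \<le> x \<Longrightarrow> x < 1 \<Longrightarrow> e2 x \<in> L ` cut_plane"
  shows "\<exists>g. bypass l k g"
proof -
  define f where "f = (\<lambda>w. \<tau> l + exp w)"
  have contf: "continuous_on S f" for S unfolding f_def by (intro continuous_intros)
  have fc: "f (w + 2 * of_real pi * \<i> * of_int n) = f w" for w and n :: int
    using exp_plus_2pin[of w n] by (simp add: f_def algebra_simps)
  have fc1: "f (w + 2 * of_real pi * \<i>) = f w" for w using fc[of w 1] by simp
  have fL: "f (L z) = z" if "z \<in> cut_plane" for z using L[OF that] by (simp add: f_def)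
  have fU: "f w \<in> cut_plane" if "w \<in> L ` cut_plane" for w using that fL by force
  have disjU: "z \<in> cut_plane \<Longrightarrow> z \<notin> cut l" for z using l unfolding cut_plane_def by auto
  define m where "m = (\<lambda>x. \<Lambda> (linepath s t x) + 2 * of_real pi * \<i> * of_int (n + 1))"
  \<comment> \<open>Raising \<open>e2\<close> by 2 pi i moves its end from index n to index n + 1,
    where \<open>m\<close> ends.\<close>
  define e3 where "e3 = (\<lambda>x. reversepath e2 x + 2 * of_real pi * \<i>)"
  define q where "q = e1 +++ (m +++ e3)"
  have lp: "linepath s t x > 0" if "x \<in> {0..1}" for x
  proof -
    have "linepath s t x \<in> closed_segment s t" using that by (simp add: linepath_in_path)
    then show ?thesis using st by (auto simp: closed_segment_eq_real_ivl split: if_splits)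
  qed
  have pm: "path m"
    unfolding m_def path_def
    by (intro continuous_intros continuous_on_compose2[OF \<Lambda>(1)]) (use lp in auto)
  have p3: "path e3"
    using e2(1) path_reversepath[of e2] unfolding e3_def path_def by (intro continuous_intros) auto
  have j: "pathfinish e1 = pathstart m" "pathfinish m = pathstart e3"
    using e1(3) e2(3) by (simp_all add: m_def e3_def pathfinish_def pathstart_def reversepath_def linepath_def algebra_simps)
  have pq: "path q" unfolding q_def using e1(1) pm p3 j by simp
  have fm: "f (m x) \<in> cut l" if "x \<in> {0..1}" for x
  proof -
    have "f (m x) = \<gamma> l (linepath s t x)"
      unfolding m_def fc using \<Lambda>(2)[OF lp[OF that]] by (simp add: f_def)
    then show ?thesis using lp[OF that] unfolding cut_def by simp
  qed
  have fe1: "f (e1 x) \<in> cut_plane" if "0 \<le> x" "x < 1" for x using fU[OF e1(4)[OF that]] .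
  have fe3: "f (e3 x) \<in> cut_plane" if "0 < x" "x \<le> 1" for x
    using fU[OF e2(4)[of "1 - x"]] that unfolding e3_def fc1 reversepath_def by simp
  have q1: "f (q x) \<in> cut_plane" if "0 \<le> x" "x < 1/2" for x
    using fe1[of "2 * x"] that by (simp add: q_def joinpaths_def)
  have q2: "f (q x) \<in> cut l" if "1/2 \<le> x" "x \<le> 3/4" for x
  proof (cases "x = 1/2")
    case True
    have "q x = pathfinish e1" unfolding True q_def joinpaths_def pathfinish_def by simp
    then show ?thesis using j(1) fm[of 0] by (simp add: pathstart_def)
  next
    case False
    then have "q x = m (2 * (2 * x - 1))" using that by (simp add: q_def joinpaths_def)
    then show ?thesis using fm[of "2 * (2 * x - 1)"] that by simp
  qed
  have q3: "f (q x) \<in> cut_plane" if "3/4 < x" "x \<le> 1" for x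
  proof -
    have "q x = e3 (2 * (2 * x - 1) - 1)" using that by (simp add: q_def joinpaths_def)
    then show ?thesis using fe3[of "2 * (2 * x - 1) - 1"] that by simp
  qed
  have "bypass l k (f \<circ> q)"
    unfolding bypass_def
  proof (intro conjI ballI)
    show "path (f \<circ> q)" by (rule path_continuous_image[OF pq contf])
    show "pathstart (f \<circ> q) = k" using e1(2) fL[OF k] by (simp add: q_def pathstart_compose)
    have fin: "pathfinish q = L k + 2 * of_real pi * \<i>"
      using e2(2) by (simp add: q_def e3_def pathfinish_def pathstart_def reversepath_def joinpaths_def)
    then show "pathfinish (f \<circ> q) = k" using fL[OF k] fc1 by (simp add: pathfinish_compose)
    \<comment> \<open>The nested joins give the parameters from 1/2 to 3/4 to the middle piece; the
      other two meet the cut only at the ends shared with it.\<close>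
    have "{x \<in> {0..1}. (f \<circ> q) x \<in> cut l} = {1/2..3/4}"
    proof (intro equalityI subsetI)
      fix x assume "x \<in> {x \<in> {0..1}. (f \<circ> q) x \<in> cut l}"
      then show "x \<in> {1/2..3/4}"
        using q1[of x] q3[of x] disjU[of "f (q x)"] by (auto simp: not_less[symmetric])
    qed (use q2 in auto)
    then show "connected {x \<in> {0..1}. (f \<circ> q) x \<in> cut l}" by (simp only: connected_Icc)
    show "path_image (f \<circ> q) \<inter> cut i = {}" if i: "i \<in> letters - {l}" for i
    proof -
      have "f (q x) \<notin> cut i" if x: "x \<in> {0..1}" for x
      proof -
        have "f (q x) \<in> cut_plane \<or> f (q x) \<in> cut l"
          using q1[of x] q2[of x] q3[of x] x by force
        then show ?thesis using i cut_disj[OF l, of i] unfolding cut_plane_def by blast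
      qed
      then show ?thesis unfolding path_image_def by auto
    qed
    show "\<tau> l \<notin> path_image (f \<circ> q)" unfolding path_image_def f_def by auto
    have "f \<circ> q = (\<lambda>t. \<tau> l + exp (q t))" by (simp add: f_def fun_eq_iff)
    moreover have "pathfinish q - pathstart q = 2 * of_real pi * \<i>"
      unfolding fin using e1(2) by (simp add: q_def)
    ultimately show "winding_number (f \<circ> q) (\<tau> l) = 1"
      using winding_number_exp_lift[OF pq, of "\<tau> l"] by simp
  qed
  then show ?thesis by (rule exI[of _ "f \<circ> q"])
qed

text \<open>The two touching paths are prolonged within the image of \<open>L\<close> so as to start
  at \<open>L k\<close>. An arc between their ends shows that the lifts they reach have consecutive
  indices, as the assembly of a bypass requires.\<close>

lemma bypass_exists:
  assumes l: "l \<in> letters" and k: "k \<in> cut_plane"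
  shows "\<exists>g. bypass l k g"
proof -
  obtain L \<Lambda> \<delta> where pc:
    "continuous_on cut_plane L" "\<And>z. z \<in> cut_plane \<Longrightarrow> z = \<tau> l + exp (L z)"
    "continuous_on {0<..} \<Lambda>" "\<And>t. t > 0 \<Longrightarrow> \<gamma> l t = \<tau> l + exp (\<Lambda> t)"
    "continuous_on (cut l) \<delta>" "\<And>t. t \<ge> 0 \<Longrightarrow> \<delta> (\<gamma> l t) = t"
    "\<And>z. z \<in> cut l \<Longrightarrow> \<delta> z \<ge> 0" "\<And>z. z \<in> cut l \<Longrightarrow> \<gamma> l (\<delta> z) = z"
    by (rule log_cover_pieces[OF l]) blast
  note L = pc(1,2) and \<Lambda> = pc(3,4)
  obtain a b :: int and s t g h where t: "a \<noteq> b" "s > 0" "t > 0"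
    "path g" "pathstart g \<in> L ` cut_plane" "pathfinish g = \<Lambda> s + 2 * of_real pi * \<i> * of_int a"
    "path_image g \<subseteq> insert (pathfinish g) (L ` cut_plane)"
    "path h" "pathstart h \<in> L ` cut_plane" "pathfinish h = \<Lambda> t + 2 * of_real pi * \<i> * of_int b"
    "path_image h \<subseteq> insert (pathfinish h) (L ` cut_plane)"
    by (rule cut_lifts_touching[OF l pc]) blast
  have "path_connected cut_plane"
    using open_slit connected_slit connected_open_path_connected unfolding cut_plane_slit by blast
  then have pL: "path_connected (L ` cut_plane)" by (rule path_connected_continuous_image[OF L(1)])
  have fc: "\<tau> l + exp (w + 2 * of_real pi * \<i> * of_int n) = \<tau> l + exp w" for w and n :: int
    using exp_plus_2pin[of w n] by (simp add: algebra_simps)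
  have notin: "\<Lambda> u + 2 * of_real pi * \<i> * of_int n \<notin> L ` cut_plane" if "u > 0" for u n
  proof
    assume "\<Lambda> u + 2 * of_real pi * \<i> * of_int n \<in> L ` cut_plane"
    then obtain z where z: "z \<in> cut_plane" "\<Lambda> u + 2 * of_real pi * \<i> * of_int n = L z" by blast
    then have "z = \<gamma> l u" using L(2)[OF z(1)] fc[of "\<Lambda> u" n] \<Lambda>(2)[OF that] by simp
    moreover have "\<gamma> l u \<in> cut l" using that unfolding cut_def by auto
    ultimately show False using z(1) l unfolding cut_plane_def by blast
  qed
  \<comment> \<open>Thinning the path to an arc makes it reach its end at time 1 only; before that
    it is over the cut plane.\<close>
  have ex: "\<exists>e. path e \<and> pathstart e = L k \<and> pathfinish e = pathfinish g \<and>
      path_image e \<subseteq> insert (pathfinish g) (L ` cut_plane) \<and> (\<forall>x. 0 \<le> x \<longrightarrow> x < 1 \<longrightarrow> e x \<in> L ` cut_plane)"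
    if g: "path g" "pathstart g \<in> L ` cut_plane" "pathfinish g \<notin> L ` cut_plane"
      "path_image g \<subseteq> insert (pathfinish g) (L ` cut_plane)" for g
  proof -
    have "L k \<in> L ` cut_plane" using k by blast
    then obtain d where d: "path d" "path_image d \<subseteq> L ` cut_plane" "pathstart d = L k" "pathfinish d = pathstart g"
      using pL g(2) unfolding path_connected_def by blast
    have "path (d +++ g)" using d g(1) by simp
    moreover have "pathstart (d +++ g) = L k" using d by simp
    moreover have "pathfinish (d +++ g) = pathfinish g" by simp
    moreover have "L k \<noteq> pathfinish g"
    proof
      assume "L k = pathfinish g"
      then show False using g(3) imageI[OF k, of L] by simp
    qed
    ultimately obtain e where e: "arc e" "path_image e \<subseteq> path_image (d +++ g)"
      "pathstart e = L k" "pathfinish e = pathfinish g" by (rule path_contains_arc)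
    have im: "path_image e \<subseteq> insert (pathfinish g) (L ` cut_plane)"
      using e(2) path_image_join_subset[of d g] d(2) g(4) by blast
    have "e x \<in> L ` cut_plane" if "0 \<le> x" "x < 1" for x
    proof -
      have "e x \<noteq> pathfinish e"
        using e(1) that inj_onD[of e "{0..1}" x 1] unfolding arc_def pathfinish_def by auto
      moreover have "e x \<in> path_image e" using that unfolding path_image_def by auto
      ultimately show ?thesis using im e(4) by auto
    qed
    then show ?thesis using e im arc_imp_path by blast
  qed
  obtain e1 where e1: "path e1" "pathstart e1 = L k" "pathfinish e1 = pathfinish g"
      "path_image e1 \<subseteq> insert (pathfinish g) (L ` cut_plane)" "\<And>x. 0 \<le> x \<Longrightarrow> x < 1 \<Longrightarrow> e1 x \<in> L ` cut_plane"
    using ex[OF t(4,5) _ t(7)] notin[OF t(2)] unfolding t(6) by metis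
  obtain e2 where e2: "path e2" "pathstart e2 = L k" "pathfinish e2 = pathfinish h"
      "path_image e2 \<subseteq> insert (pathfinish h) (L ` cut_plane)" "\<And>x. 0 \<le> x \<Longrightarrow> x < 1 \<Longrightarrow> e2 x \<in> L ` cut_plane"
    using ex[OF t(8,9) _ t(11)] notin[OF t(3)] unfolding t(10) by metis
  \<comment> \<open>Equal ends would give s = t by injectivity of the cut, and then a = b. An arc
    can be extracted only between different points.\<close>
  have "pathfinish e1 \<noteq> pathfinish e2"
  proof
    assume eq: "pathfinish e1 = pathfinish e2"
    then have "\<gamma> l s = \<gamma> l t"
      using fc[of "\<Lambda> s" a] fc[of "\<Lambda> t" b] \<Lambda>(2)[OF t(2)] \<Lambda>(2)[OF t(3)] unfolding e1(3) e2(3) t(6,10) by simp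
    then have "s = t" by (rule inj_onD[OF cut_facts(2)[OF l]]) (use t(2,3) in auto)
    then show False using eq t(1) unfolding e1(3) e2(3) t(6,10) by simp
  qed
  moreover have "path (reversepath e1 +++ e2)" using e1 e2 by simp
  moreover have "pathstart (reversepath e1 +++ e2) = pathfinish e1" "pathfinish (reversepath e1 +++ e2) = pathfinish e2"
    by simp_all
  ultimately obtain e where e: "arc e" "path_image e \<subseteq> path_image (reversepath e1 +++ e2)"
    "pathstart e = pathfinish e1" "pathfinish e = pathfinish e2"
    by (metis path_contains_arc)
  have "\<bar>b - a\<bar> = 1"
  proof (rule cut_lifts_adjacent[OF l L(2) \<Lambda> t(2,3,1) e(1)])
    show "path_image e \<subseteq> {pathstart e, pathfinish e} \<union> L ` cut_plane"
      using e(2) path_image_join_subset[of "reversepath e1" e2] e1(4) e2(4) unfolding e(3,4) e1(3) e2(3) by auto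
  qed (use e e1 e2 t in auto)
  \<comment> \<open>The path to the lift of larger index is run first, which makes the turn
    positive.\<close>
  then consider "a = b + 1" | "b = a + 1" by linarith
  then show ?thesis
  proof cases
    case 1
    show ?thesis
      by (rule bypass_from_lifts[OF l k L(2) \<Lambda> t(2,3) e1(1,2) _ e1(5) e2(1,2) _ e2(5), where n = b])
         (use t(6,10) e1(3) e2(3) 1 in simp_all)
  next
    case 2
    show ?thesis
      by (rule bypass_from_lifts[OF l k L(2) \<Lambda> t(3,2) e2(1,2) _ e2(5) e1(1,2) _ e1(5), where n = a])
         (use t(6,10) e1(3) e2(3) 2 in simp_all)
  qed
qed

end

lemma continuation_split:
  assumes c: "continuation F (g1 +++ g2) H" and j: "pathfinish g1 = pathstart g2"
  obtains K where "continuation F g1 K" "continuation K g2 H"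
proof -
  let ?g = "g1 +++ g2"
  obtain f where f: "germ_family f ?g {0..1}" "\<forall>\<^sub>F k in at (?g 0). f 0 k = F k"
    "\<forall>\<^sub>F k in at (?g 1). f 1 k = H k"
    using c unfolding continuation_iff by blast
  have 1: "?g (1/2 * s + 0) = g1 s" if "s \<in> {0..1}" for s
    using that by (simp add: joinpaths_def)
  have 2: "?g (1/2 * s + 1/2) = g2 s" if "s \<in> {0..1}" for s
  proof (cases "s = 0")
    case True
    then show ?thesis using j by (simp add: joinpaths_def pathfinish_def pathstart_def)
  qed (use that in \<open>simp add: joinpaths_def\<close>)
  have "germ_family (\<lambda>s. f (1/2 * s + 0)) g1 {0..1}"
    by (rule germ_family_cong[OF germ_family_affine[OF f(1), of "{0..1}" "1/2" 0]]) (use 1 in auto)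
  then have a: "continuation F g1 (f (1/2))"
    unfolding continuation_iff using f(2) 1[of 0]
    by (intro exI[of _ "\<lambda>s. f (1/2 * s + 0)"]) simp
  have "germ_family (\<lambda>s. f (1/2 * s + 1/2)) g2 {0..1}"
    by (rule germ_family_cong[OF germ_family_affine[OF f(1), of "{0..1}" "1/2" "1/2"]]) (use 2 in auto)
  then have "continuation (f (1/2)) g2 H"
    unfolding continuation_iff using f(3) 2[of 1]
    by (intro exI[of _ "\<lambda>s. f (1/2 * s + 1/2)"]) simp
  with a show ?thesis by (rule that)
qed

subsection \<open>Branches along words\<close>

text \<open>The last germ is meromorphic on a disc in which the path remains for a while, so the
  family may be kept constant there.\<close>

lemma germ_family_extend:
  assumes f: "germ_family f g {0..t}" and t: "0 \<le> t" "t < 1" and g: "path g"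
  obtains f' t' where "t < t'" "t' \<le> 1" "germ_family f' g {0..t'}" "f' 0 = f 0"
proof -
  have "matrix_meromorphic_on (f t) {g t}" using f t unfolding germ_family_def by simp
  then obtain r where r: "r > 0" "matrix_meromorphic_on (f t) (ball (g t) r)"
    by (rule matrix_meromorphic_on_nhd)
  obtain d where d: "d > 0" "\<And>s. s \<in> {0..1} \<Longrightarrow> dist s t < d \<Longrightarrow> dist (g s) (g t) < r"
    using g t r(1) unfolding path_def continuous_on_iff by (metis atLeastAtMost_iff less_eq_real_def)
  define t' where "t' = min 1 (t + d / 2)"
  have t': "t < t'" "t' \<le> 1" using t d(1) by (auto simp: t'_def)
  define f' where "f' s = (if s \<le> t then f s else f t)" for s
  have "germ_family f' g {0..t}" by (rule germ_family_cong[OF f]) (auto simp: f'_def)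
  moreover have "germ_family f' g {t..t'}"
  proof (rule germ_family_cong[of "\<lambda>_. f t"])
    have "g s \<in> ball (g t) r" if "s \<in> {t..t'}" for s
    proof -
      have "dist s t < d" using that d(1) by (auto simp: t'_def dist_real_def)
      then show ?thesis using d(2)[of s] that t t' by (simp add: dist_commute)
    qed
    then show "germ_family (\<lambda>_. f t) g {t..t'}"
      by (intro germ_family_restrict matrix_meromorphic_on_subset[OF r(2)]) auto
  qed (auto simp: f'_def)
  ultimately have "germ_family f' g {0..t'}"
    by (rule germ_family_union) (use t t' in auto)
  moreover have "f' 0 = f 0" using t by (simp add: f'_def)
  ultimately show ?thesis using that t' by blast
qed

locale branched = cut_system +
  fixes G :: "complex \<Rightarrow> complex ^ 'n ^ 'n" and \<epsilon> :: real
  assumes eps: "\<epsilon> > 0" and mero: "matrix_meromorphic_on G (strip \<epsilon>)"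
    and bp: "branch_points G = \<tau> ` letters"
begin

definition base :: "complex set" where "base = - \<tau> ` letters"

lemma real_strip: "Im z = 0 \<Longrightarrow> z \<in> strip \<epsilon>"
  using eps by (simp add: strip_def)

lemma mero_real: "Im z = 0 \<Longrightarrow> matrix_meromorphic_on G {z}"
  using mero real_strip matrix_meromorphic_on_subset[of G "strip \<epsilon>" "{z}"] by blast

lemma open_base: "open base"
  unfolding base_def using finite_letters by (intro open_Compl finite_imp_closed) auto

lemma cut_plane_subset_base: "cut_plane \<subseteq> base"
  unfolding cut_plane_def base_def using tau_in_cut by blast

lemma punctured_slit_subset_base: "slit (letters - {l}) - {\<tau> l} \<subseteq> base"
  unfolding slit_def base_def using tau_in_cut by blast

lemma cut_plane_subset_punctured_slit: "l \<in> letters \<Longrightarrow> cut_plane \<subseteq> slit (letters - {l}) - {\<tau> l}"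
  unfolding slit_def cut_plane_def using tau_in_cut by blast

lemma open_cut_plane: "open cut_plane"
  by (simp add: cut_plane_slit open_slit)

lemma connected_cut_plane: "connected cut_plane"
  by (simp add: cut_plane_slit connected_slit)

lemma real_in_cut_plane: "Im z = 0 \<Longrightarrow> z \<in> cut_plane"
  by (simp add: cut_plane_slit real_in_slit)

lemma cut_plane_path:
  assumes "x \<in> cut_plane" "y \<in> cut_plane"
  obtains c where "path c" "path_image c \<subseteq> cut_plane" "pathstart c = x" "pathfinish c = y"
  using connected_open_path_connected[OF open_cut_plane connected_cut_plane] assms
  unfolding path_connected_def by blast

lemma cut_plane_ball:
  assumes "z \<in> cut_plane" "matrix_meromorphic_on F {z}"
  obtains r where "r > 0" "ball z r \<subseteq> cut_plane" "matrix_meromorphic_on F (ball z r)"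
proof -
  obtain r1 where r1: "r1 > 0" "ball z r1 \<subseteq> cut_plane"
    using open_cut_plane assms(1) open_contains_ball by blast
  obtain r2 where r2: "r2 > 0" "matrix_meromorphic_on F (ball z r2)"
    using matrix_meromorphic_on_nhd[OF assms(2)] by blast
  show ?thesis
  proof (rule that[of "min r1 r2"])
    show "ball z (min r1 r2) \<subseteq> cut_plane" using r1 by auto
    show "matrix_meromorphic_on F (ball z (min r1 r2))"
      by (rule matrix_meromorphic_on_subset[OF r2(2)]) auto
  qed (use r1 r2 in auto)
qed

text \<open>Let \<open>T\<close> be the supremum of the times up to which \<open>G\<close> can be
  continued. Continuation up to \<open>T\<close> itself is possible, for otherwise
  \<open>g T\<close> would be a branch point by definition; and if T < 1 the last germ carries it
  further.\<close>

lemma continuation_exists: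
  assumes g: "path g" "path_image g \<subseteq> base" "Im (pathstart g) = 0"
  shows "\<exists>H. continuation G g H"
proof -
  define P where "P t \<longleftrightarrow> (\<exists>f. germ_family f g {0..t} \<and> (\<forall>\<^sub>F k in at (g 0). f 0 k = G k))" for t
  have PI: "P t" if "continuation G (subpath 0 t g) H" "t > 0" for t H
    using continuation_subpathD[OF that] unfolding P_def by metis
  have PD: "\<exists>H. continuation G (subpath 0 t g) H" if "P t" "t \<ge> 0" for t
    using that continuation_subpathI unfolding P_def by blast
  have down: "P s" if "P t" "s \<le> t" for s t
    using that germ_family_subset[of _ g "{0..t}" "{0..s}"] unfolding P_def by fastforce
  have P0: "P 0"
    unfolding P_def using mero_real[of "g 0"] g(3) unfolding pathstart_def
    by (intro exI[of _ "\<lambda>_. G"]) (auto intro: germ_family_restrict)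
  have lim: "P t" if t: "t \<in> {0..1}" "\<And>s. 0 \<le> s \<Longrightarrow> s < t \<Longrightarrow> P s" for t
  proof (rule ccontr)
    assume nP: "\<not> P t"
    have t0: "t > 0" using nP P0 t(1) by (cases "t = 0") auto
    have "g t \<in> base" using g(2) t(1) unfolding path_image_def by blast
    then have nb: "g t \<notin> branch_points G" unfolding bp base_def by simp
    have "path (subpath 0 t g)" using g(1) t(1) by simp
    moreover have "Im (pathstart (subpath 0 t g)) = 0" using g(3) by (simp add: pathstart_def subpath_def)
    moreover have "pathfinish (subpath 0 t g) = g t" by simp
    moreover have "\<exists>H. continuation G (subpath 0 u (subpath 0 t g)) H" if "u \<in> {0..<1}" for u
    proof -
      have e: "subpath 0 u (subpath 0 t g) = subpath 0 (t * u) g"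
        by (simp add: subpath_def mult.assoc)
      have "t * u < t" "0 \<le> t * u" using t0 that by (simp_all add: mult_less_cancel_left2)
      then show ?thesis using PD[OF t(2)[of "t * u"]] unfolding e by blast
    qed
    moreover have "\<not> (\<exists>H. continuation G (subpath 0 t g) H)" using nP PI t0 by blast
    ultimately have "g t \<in> branch_points G" unfolding branch_points_def by blast
    then show False using nb by blast
  qed
  define T where "T = Sup {t \<in> {0..1}. P t}"
  have bdd: "bdd_above {t \<in> {0..1}. P t}" by (rule bdd_aboveI[of _ 1]) auto
  have T01: "0 \<le> T" "T \<le> 1"
  proof -
    show "0 \<le> T" unfolding T_def by (rule cSup_upper[OF _ bdd]) (simp add: P0)
    show "T \<le> 1" unfolding T_def using P0 by (intro cSup_least) (auto intro!: exI[of _ 0])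
  qed
  have PT: "P T"
  proof (rule lim)
    fix s assume s: "0 \<le> s" "s < T"
    then obtain t where "t \<in> {t \<in> {0..1}. P t}" "s < t"
    proof -
      have ne: "{t \<in> {0..1}. P t} \<noteq> {}" using P0 by (auto intro!: exI[of _ 0])
      show thesis using less_cSup_iff[OF ne bdd, of s] s(2) that unfolding T_def by blast
    qed
    then show "P s" using down[of t s] by auto
  qed (use T01 in auto)
  have "T = 1"
  proof (rule ccontr)
    assume "T \<noteq> 1"
    then have "T < 1" using T01 by simp
    obtain f where f: "germ_family f g {0..T}" "\<forall>\<^sub>F k in at (g 0). f 0 k = G k"
      using PT unfolding P_def by blast
    obtain f' t' where f': "T < t'" "t' \<le> 1" "germ_family f' g {0..t'}" "f' 0 = f 0"
      using germ_family_extend[OF f(1) T01(1) \<open>T < 1\<close> g(1)] by blast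
    have "P t'" unfolding P_def using f'(3,4) f(2) by auto
    then have "t' \<le> T" unfolding T_def using f' T01 by (intro cSup_upper bdd) auto
    then show False using f'(1) by simp
  qed
  with PT PD[of 1] show ?thesis by simp
qed

text \<open>The invariant preserved from letter to letter: a branch on the cut plane whose germs can
  be continued along every path that avoids the affixes of the branch points, also across the
  cuts.\<close>

definition contble :: "(complex \<Rightarrow> complex ^ 'n ^ 'n) \<Rightarrow> bool" where
  "contble K \<longleftrightarrow> matrix_meromorphic_on K cut_plane \<and>
     (\<forall>g. path g \<longrightarrow> path_image g \<subseteq> base \<longrightarrow> pathstart g \<in> cut_plane \<longrightarrow> (\<exists>H. continuation K g H))"

lemma cut_plane_homotopic:
  assumes "path c1" "path_image c1 \<subseteq> cut_plane" "path c2" "path_image c2 \<subseteq> cut_plane"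
    "pathstart c2 = pathstart c1" "pathfinish c2 = pathfinish c1"
  shows "homotopic_paths cut_plane c1 c2"
  using simply_connected_slit[of letters] assms
  unfolding cut_plane_slit simply_connected_eq_homotopic_paths by blast

text \<open>As the cut plane is simply connected, the germ reached at a point does not depend on the
  path. Different starting points are joined by a segment of the real axis, along which
  \<open>G\<close> continues to itself.\<close>

lemma physical_branch_exists:
  "\<exists>K. contble K \<and> (\<forall>c. path c \<longrightarrow> path_image c \<subseteq> cut_plane \<longrightarrow> Im (pathstart c) = 0 \<longrightarrow> continuation G c K)"
proof -
  have "\<exists>c \<phi>. path c \<and> path_image c \<subseteq> cut_plane \<and> pathstart c = 0 \<and> pathfinish c = z \<and> continuation G c \<phi>"
    if z: "z \<in> cut_plane" for z
  proof -
    obtain c where c: "path c" "path_image c \<subseteq> cut_plane" "pathstart c = 0" "pathfinish c = z"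
      by (rule cut_plane_path[OF real_in_cut_plane[of 0] z]) auto
    moreover have "\<exists>H. continuation G c H"
      by (rule continuation_exists) (use c cut_plane_subset_base in auto)
    ultimately show ?thesis by blast
  qed
  then obtain c \<phi> where c: "\<And>z. z \<in> cut_plane \<Longrightarrow> path (c z)" "\<And>z. z \<in> cut_plane \<Longrightarrow> path_image (c z) \<subseteq> cut_plane"
    "\<And>z. z \<in> cut_plane \<Longrightarrow> pathstart (c z) = 0" "\<And>z. z \<in> cut_plane \<Longrightarrow> pathfinish (c z) = z"
    "\<And>z. z \<in> cut_plane \<Longrightarrow> continuation G (c z) (\<phi> z)" by metis
  have ex: "\<exists>K. continuation G g K" if "path g" "path_image g \<subseteq> cut_plane" "Im (pathstart g) = 0" for g
    using continuation_exists that cut_plane_subset_base by blast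
  have all: "continuation G d (\<phi> (pathfinish d))"
    if d: "path d" "path_image d \<subseteq> cut_plane" "Im (pathstart d) = 0" for d
  proof -
    let ?z = "pathfinish d"
    have z: "?z \<in> cut_plane" using d(2) pathfinish_in_path_image by blast
    define e where "e = linepath 0 (pathstart d)"
    have ime: "Im w = 0" if "w \<in> path_image e" for w
    proof -
      have "closed_segment 0 (pathstart d) \<subseteq> {w. Im w = 0}"
      proof (rule closed_segment_subset)
        show "convex {w. Im w = 0}" unfolding convex_def by simp
      qed (use d(3) in auto)
      then show ?thesis using that unfolding e_def by auto
    qed
    have e: "path e" "path_image e \<subseteq> cut_plane" "pathstart e = 0" "pathfinish e = pathstart d"
      using ime real_in_cut_plane by (auto simp: e_def)
    have "continuation G e G"
      by (rule continuation_const, subst matrix_meromorphic_on_iff) (use ime mero_real in blast)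
    moreover obtain K where K: "continuation G d K" using ex[OF d] by blast
    ultimately have eK: "continuation G (e +++ d) K"
      using continuation_join e d by blast
    have "homotopic_paths cut_plane (c ?z) (e +++ d)"
      by (rule cut_plane_homotopic)
         (use e d c[OF z] path_image_join_subset[of e d] in auto)
    then have "continuation G (e +++ d) (\<phi> ?z)"
      by (rule continuation_homotopic[OF _ c(5)[OF z]]) (use ex c(3)[OF z] in auto)
    from continuation_unique[OF eK this] have "\<forall>\<^sub>F k in at ?z. K k = \<phi> ?z k"
      using e d by simp
    then show ?thesis using continuation_cong[OF K, of G "\<phi> ?z"] by simp
  qed
  have m\<phi>: "matrix_meromorphic_on (\<phi> z) {z}" if "z \<in> cut_plane" for z
    using continuation_meromorphic(2)[OF c(5)[OF that]] c(4)[OF that] by simp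
  have "\<forall>\<^sub>F w in at z. \<forall>\<^sub>F k in at w. \<phi> w k = \<phi> z k" if z: "z \<in> cut_plane" for z
  proof -
    obtain r where r: "r > 0" "ball z r \<subseteq> cut_plane" "matrix_meromorphic_on (\<phi> z) (ball z r)"
      using cut_plane_ball[OF z m\<phi>[OF z]] by blast
    have "\<forall>\<^sub>F w in at z. w \<in> ball z r" using r(1) by (intro eventually_at_in_open') auto
    then show ?thesis
    proof eventually_elim
      case (elim w)
      have seg: "path_image (linepath z w) \<subseteq> ball z r"
        using elim r(1) by (simp add: closed_segment_subset)
      have "continuation (\<phi> z) (linepath z w) (\<phi> z)"
        by (rule continuation_const[OF matrix_meromorphic_on_subset[OF r(3) seg]])
      then have a: "continuation G (c z +++ linepath z w) (\<phi> z)"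
        by (rule continuation_join[OF c(5)[OF z]]) (use c[OF z] in simp_all)
      have "continuation G (c z +++ linepath z w) (\<phi> w)"
        using all[of "c z +++ linepath z w"] c[OF z] path_image_join_subset[of "c z" "linepath z w"] seg r(2)
        by auto
      from continuation_unique[OF this a] show ?case using c[OF z] by simp
    qed
  qed
  then obtain K where K: "matrix_meromorphic_on K cut_plane" "\<And>z. z \<in> cut_plane \<Longrightarrow> \<forall>\<^sub>F k in at z. K k = \<phi> z k"
    using glue_germs[OF m\<phi>] by blast
  have allK: "continuation G d K"
    if d: "path d" "path_image d \<subseteq> cut_plane" "Im (pathstart d) = 0" for d
  proof (rule continuation_cong[OF all[OF d]])
    have "pathfinish d \<in> cut_plane" using d(2) pathfinish_in_path_image by blast
    from K(2)[OF this] show "\<forall>\<^sub>F k in at (pathfinish d). \<phi> (pathfinish d) k = K k"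
      by (rule eventually_mono) simp
  qed simp
  have "\<exists>H. continuation K g H" if g: "path g" "path_image g \<subseteq> base" "pathstart g \<in> cut_plane" for g
  proof -
    \<comment> \<open>Preceded by a path from the real axis, \<open>g\<close> becomes a path for
      which continuability of \<open>G\<close> is known.\<close>
    let ?c = "c (pathstart g)"
    have "path_image (?c +++ g) \<subseteq> base"
      using path_image_join_subset[of ?c g] c(2)[OF g(3)] cut_plane_subset_base g(2) by blast
    then obtain H where "continuation G (?c +++ g) H"
      using continuation_exists[of "?c +++ g"] c[OF g(3)] g by auto
    then obtain K1 where K1: "continuation G ?c K1" "continuation K1 g H"
      using continuation_split c(4)[OF g(3)] by metis
    have "continuation G ?c K" using allK[of ?c] c[OF g(3)] by simp
    from continuation_unique[OF K1(1) this] have "\<forall>\<^sub>F k in at (pathstart g). K1 k = K k"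
      using c[OF g(3)] by simp
    then have "continuation K g H" using continuation_cong[OF K1(2)] by simp
    then show ?thesis by blast
  qed
  then have "contble K" unfolding contble_def using K(1) by blast
  then show ?thesis using allK by blast
qed

text \<open>Of a bypass only what a homotopy in the punctured slit plane preserves; how the loop
  meets \<open>cut l\<close> is left open.\<close>

definition slit_loop :: "letter \<Rightarrow> complex \<Rightarrow> (real \<Rightarrow> complex) \<Rightarrow> bool" where
  "slit_loop l k g \<longleftrightarrow> path g \<and> pathstart g = k \<and> pathfinish g = k \<and>
     path_image g \<subseteq> slit (letters - {l}) - {\<tau> l} \<and> winding_number g (\<tau> l) = 1"

lemma bypass_imp_slit_loop: "bypass l k g \<Longrightarrow> slit_loop l k g"
  unfolding bypass_def slit_loop_def slit_def by auto

lemma continuation_slit_homotopic: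
  assumes K: "contble K" and l: "l \<in> letters" and c: "continuation K p1 H" and k: "pathstart p1 \<in> cut_plane"
    and p: "path p1" "path_image p1 \<subseteq> slit (letters - {l}) - {\<tau> l}"
      "path p2" "path_image p2 \<subseteq> slit (letters - {l}) - {\<tau> l}"
      "pathstart p2 = pathstart p1" "pathfinish p2 = pathfinish p1"
      "winding_number p1 (\<tau> l) = winding_number p2 (\<tau> l)"
  shows "continuation K p2 H"
proof (rule continuation_homotopic[OF homotopic_paths_winding[OF l p] c])
  fix g assume "path g" "path_image g \<subseteq> slit (letters - {l}) - {\<tau> l}" "pathstart g = pathstart p1"
  then show "\<exists>H. continuation K g H"
    using K k punctured_slit_subset_base[of l] unfolding contble_def by (metis order_trans)
qed

text \<open>The germ reached depends on the loop only through its winding number, so one bypass per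
  point determines it. Germs at neighbouring points fit together because the base point can be moved
  along a segment.\<close>

lemma step_exists:
  assumes K: "contble K" and l: "l \<in> letters"
  shows "\<exists>K'. contble K' \<and> (\<forall>k\<in>cut_plane. \<forall>g. slit_loop l k g \<longrightarrow> continuation K g K')"
proof -
  let ?D = "slit (letters - {l}) - {\<tau> l}"
  have mK: "matrix_meromorphic_on K cut_plane" using K by (simp add: contble_def)
  have "\<exists>g \<phi>. slit_loop l z g \<and> continuation K g \<phi>" if z: "z \<in> cut_plane" for z
  proof -
    obtain g where g: "slit_loop l z g" using bypass_exists[OF l z] bypass_imp_slit_loop by blast
    then have "\<exists>H. continuation K g H"
      using K z punctured_slit_subset_base[of l] unfolding contble_def slit_loop_def by auto
    then show ?thesis using g by blast
  qed
  then obtain g \<phi> where g: "\<And>z. z \<in> cut_plane \<Longrightarrow> slit_loop l z (g z)"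
    "\<And>z. z \<in> cut_plane \<Longrightarrow> continuation K (g z) (\<phi> z)" by metis
  have all: "continuation K d (\<phi> z)" if z: "z \<in> cut_plane" and d: "slit_loop l z d" for d z
    by (rule continuation_slit_homotopic[OF K l g(2)[OF z]])
       (use g(1)[OF z] d z in \<open>simp_all add: slit_loop_def\<close>)
  have m\<phi>: "matrix_meromorphic_on (\<phi> z) {z}" if "z \<in> cut_plane" for z
    using continuation_meromorphic(2)[OF g(2)[OF that]] g(1)[OF that] by (simp add: slit_loop_def)
  have "\<forall>\<^sub>F w in at z. \<forall>\<^sub>F k in at w. \<phi> w k = \<phi> z k" if z: "z \<in> cut_plane" for z
  proof -
    obtain r where r: "r > 0" "ball z r \<subseteq> cut_plane" "matrix_meromorphic_on (\<phi> z) (ball z r)"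
      using cut_plane_ball[OF z m\<phi>[OF z]] by blast
    have gz: "path (g z)" "pathstart (g z) = z" "pathfinish (g z) = z" "path_image (g z) \<subseteq> ?D"
      "winding_number (g z) (\<tau> l) = 1" "\<tau> l \<notin> path_image (g z)"
      using g(1)[OF z] by (auto simp: slit_loop_def)
    have "\<forall>\<^sub>F w in at z. w \<in> ball z r" using r(1) by (intro eventually_at_in_open') auto
    then show ?thesis
    proof eventually_elim
      case (elim w)
      have w: "w \<in> cut_plane" using elim r(2) by blast
      have seg: "path_image (linepath z w) \<subseteq> ball z r" "path_image (linepath w z) \<subseteq> ball z r"
        using elim r(1) by (simp_all add: closed_segment_subset)
      have BD: "ball z r \<subseteq> ?D" using r(2) cut_plane_subset_punctured_slit[OF l] by blast
      \<comment> \<open>A loop at \<open>w\<close> made from the one at \<open>z\<close>: the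
        contributions of the two segments to the winding number cancel, and along them
        \<open>K\<close> and \<open>\<phi> z\<close> continue to themselves.\<close>
      let ?d = "linepath w z +++ (g z +++ linepath z w)"
      have "continuation K (linepath w z) K"
        using seg r(2) by (intro continuation_const matrix_meromorphic_on_subset[OF mK]) auto
      moreover have "continuation (\<phi> z) (linepath z w) (\<phi> z)"
        by (rule continuation_const[OF matrix_meromorphic_on_subset[OF r(3) seg(1)]])
      then have "continuation K (g z +++ linepath z w) (\<phi> z)"
        by (rule continuation_join[OF g(2)[OF z]]) (use gz in simp_all)
      ultimately have a: "continuation K ?d (\<phi> z)"
        by (rule continuation_join) (use gz in simp_all)
      have \<tau>n: "\<tau> l \<notin> path_image (linepath z w)" "\<tau> l \<notin> path_image (linepath w z)"
        using seg BD by blast+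
      have "winding_number (linepath z w) (\<tau> l) = - winding_number (linepath w z) (\<tau> l)"
        using winding_number_reversepath[of "linepath w z" "\<tau> l"] \<tau>n by simp
      then have "winding_number ?d (\<tau> l) = 1"
        using gz \<tau>n by (simp add: winding_number_join not_in_path_image_join)
      moreover have "path_image ?d \<subseteq> ?D"
        using path_image_join_subset[of "linepath w z" "g z +++ linepath z w"]
          path_image_join_subset[of "g z" "linepath z w"] seg BD gz(4) by blast
      ultimately have "slit_loop l w ?d" using gz by (simp add: slit_loop_def)
      then have b: "continuation K ?d (\<phi> w)" by (rule all[OF w])
      have "path ?d" using gz by simp
      from continuation_unique[OF b a this] show ?case by simp
    qed
  qed
  then obtain K' where K': "matrix_meromorphic_on K' cut_plane" "\<And>z. z \<in> cut_plane \<Longrightarrow> \<forall>\<^sub>F k in at z. K' k = \<phi> z k"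
    using glue_germs[OF m\<phi>] by blast
  have allK: "continuation K d K'" if z: "z \<in> cut_plane" and d: "slit_loop l z d" for d z
  proof (rule continuation_cong[OF all[OF z d]])
    show "\<forall>\<^sub>F k in at (pathfinish d). \<phi> z k = K' k"
      using K'(2)[OF z] d unfolding slit_loop_def by (auto elim: eventually_mono)
  qed simp
  have "\<exists>H. continuation K' h H" if h: "path h" "path_image h \<subseteq> base" "pathstart h \<in> cut_plane" for h
  proof -
    let ?c = "g (pathstart h)"
    have c: "path ?c" "pathstart ?c = pathstart h" "pathfinish ?c = pathstart h" "path_image ?c \<subseteq> base"
      using g(1)[OF h(3)] punctured_slit_subset_base[of l] unfolding slit_loop_def by auto
    have "path_image (?c +++ h) \<subseteq> base"
      using path_image_join_subset[of ?c h] c h(2) by blast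
    then obtain H where "continuation K (?c +++ h) H"
      using K c h unfolding contble_def by (metis path_join pathstart_join)
    then obtain K1 where K1: "continuation K ?c K1" "continuation K1 h H"
      using continuation_split c(3) by metis
    have "continuation K ?c K'" by (rule allK[OF h(3) g(1)[OF h(3)]])
    from continuation_unique[OF K1(1) this c(1)] have "\<forall>\<^sub>F k in at (pathstart h). K1 k = K' k"
      using c by simp
    then have "continuation K' h H" using continuation_cong[OF K1(2)] by simp
    then show ?thesis by blast
  qed
  then have "contble K'" unfolding contble_def using K'(1) by blast
  then show ?thesis using allK by blast
qed

section \<open>The physical branch and the sheet belonging to a word\<close>

definition physical :: "complex \<Rightarrow> complex ^ 'n ^ 'n" where
  "physical = (SOME K. contble K \<and>
     (\<forall>c. path c \<longrightarrow> path_image c \<subseteq> cut_plane \<longrightarrow> Im (pathstart c) = 0 \<longrightarrow> continuation G c K))"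

definition step :: "letter \<Rightarrow> (complex \<Rightarrow> complex ^ 'n ^ 'n) \<Rightarrow> (complex \<Rightarrow> complex ^ 'n ^ 'n)" where
  "step l K = (SOME K'. contble K' \<and> (\<forall>k\<in>cut_plane. \<forall>g. slit_loop l k g \<longrightarrow> continuation K g K'))"

text \<open>\<open>fold\<close> applies the step of the leftmost letter first, in the order in which
  the bypasses of a word are performed.\<close>

definition sheet :: "letter list \<Rightarrow> complex \<Rightarrow> complex ^ 'n ^ 'n" where
  "sheet w = fold step w physical"

lemma physical:
  shows "contble physical"
    and "path c \<Longrightarrow> path_image c \<subseteq> cut_plane \<Longrightarrow> Im (pathstart c) = 0 \<Longrightarrow> continuation G c physical"
  using someI_ex[OF physical_branch_exists, folded physical_def] by auto

lemma step:
  assumes "contble K" "l \<in> letters"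
  shows "contble (step l K)"
    and "k \<in> cut_plane \<Longrightarrow> slit_loop l k g \<Longrightarrow> continuation K g (step l K)"
  using someI_ex[OF step_exists[OF assms], folded step_def] by auto

lemma words_Nil: "[] \<in> words" and words_Cons: "l # w \<in> words \<longleftrightarrow> l \<in> letters \<and> w \<in> words"
  and words_append: "v @ w \<in> words \<longleftrightarrow> v \<in> words \<and> w \<in> words"
  unfolding words_def by auto

lemma word_loop_path:
  assumes "word_loop w k g"
  shows "path g" "pathstart g = k" "pathfinish g = k"
proof -
  have "path g \<and> pathstart g = k \<and> pathfinish g = k"
    using assms
  proof (induction w arbitrary: g)
    case Nil
    then have "g = (\<lambda>_. k)" by simp
    then show ?case by (simp add: path_def pathstart_def pathfinish_def)
  next
    case (Cons l w)
    then obtain g1 g2 where g: "bypass l k g1" "word_loop w k g2" "g = g1 +++ g2" by auto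
    then show ?case using Cons.IH[OF g(2)] unfolding bypass_def by auto
  qed
  then show "path g" "pathstart g = k" "pathfinish g = k" by auto
qed

lemma word_loop_exists:
  assumes "w \<in> words" "k \<in> cut_plane"
  shows "\<exists>g. word_loop w k g"
  using assms(1)
proof (induction w)
  case (Cons l w)
  then obtain g2 where "word_loop w k g2" by (auto simp: words_Cons)
  moreover obtain g1 where "bypass l k g1" using bypass_exists Cons assms(2) by (auto simp: words_Cons)
  ultimately show ?case by auto
next
  case Nil
  show ?case by (rule exI[of _ "\<lambda>_. k"]) simp
qed

lemma contble_fold_step:
  assumes "w \<in> words" "contble K"
  shows "contble (fold step w K)"
  using assms by (induction w arbitrary: K) (simp_all add: words_Cons step(1))

lemma continuation_fold_step:
  assumes "w \<in> words" "contble K" "k \<in> cut_plane" "word_loop w k g"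
  shows "continuation K g (fold step w K)"
  using assms
proof (induction w arbitrary: K g)
  case Nil
  then have "g = (\<lambda>_. k)" "matrix_meromorphic_on K {k}"
    unfolding contble_def by (auto intro: matrix_meromorphic_on_subset)
  then show ?case by (auto intro!: continuation_const simp: path_image_def)
next
  case (Cons l w)
  then obtain g1 g2 where g: "bypass l k g1" "word_loop w k g2" "g = g1 +++ g2" by auto
  have lw: "l \<in> letters" "w \<in> words" using Cons.prems(1) by (auto simp: words_Cons)
  have "continuation K g1 (step l K)"
    using step(2)[OF Cons.prems(2) lw(1) Cons.prems(3)] bypass_imp_slit_loop g(1) by blast
  moreover have "continuation (step l K) g2 (fold step w (step l K))"
    using Cons.IH[OF lw(2) step(1)[OF Cons.prems(2) lw(1)] Cons.prems(3) g(2)] .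
  ultimately show ?case
    unfolding g(3) using word_loop_path[OF g(2)] g(1) by (auto intro!: continuation_join simp: bypass_def)
qed

lemma contble_sheet: "w \<in> words \<Longrightarrow> contble (sheet w)"
  unfolding sheet_def by (intro contble_fold_step physical)

lemma meromorphic_sheet: "w \<in> words \<Longrightarrow> matrix_meromorphic_on (sheet w) cut_plane"
  using contble_sheet by (simp add: contble_def)

lemma sheet_snoc:
  assumes "w \<in> words" "l \<in> letters" "k \<in> cut_plane" "slit_loop l k g"
  shows "continuation (sheet w) g (sheet (w @ [l]))"
  using step(2)[OF contble_sheet[OF assms(1)] assms(2-4)] by (simp add: sheet_def)

lemma is_branch_sheet:
  assumes "w \<in> words"
  shows "is_branch G w (sheet w)"
  unfolding is_branch_def
proof (intro conjI ballI allI impI; (elim conjE)?)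
  show "matrix_meromorphic_on (sheet w) cut_plane" by (rule meromorphic_sheet[OF assms])
  fix k c g assume k: "k \<in> cut_plane" and c: "path c" "path_image c \<subseteq> cut_plane" "Im (pathstart c) = 0"
    "pathfinish c = k" and g: "word_loop w k g"
  have "continuation physical g (sheet w)"
    unfolding sheet_def by (rule continuation_fold_step[OF assms physical(1) k g])
  then show "continuation G (c +++ g) (sheet w)"
    using physical(2)[OF c(1-3)] word_loop_path[OF g] c by (intro continuation_join[of G c physical g]) auto
qed

text \<open>At a point without a loop for \<open>w\<close> the condition in \<open>is_branch\<close>
  would be empty; the existence of bypasses makes it determine the germ. \<open>F\<close> is
  arbitrary, so that the product of \<open>G\<close> with a rational matrix is covered.\<close>

lemma is_branch_unique:
  assumes "is_branch F w H" "is_branch F w H'" "w \<in> words" "k \<in> cut_plane"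
  shows "\<forall>\<^sub>F z in at k. H z = H' z"
proof -
  obtain c where c: "path c" "path_image c \<subseteq> cut_plane" "pathstart c = 0" "pathfinish c = k"
    by (rule cut_plane_path[OF real_in_cut_plane[of 0] assms(4)]) auto
  obtain g where g: "word_loop w k g" using word_loop_exists[OF assms(3,4)] by blast
  have "continuation F (c +++ g) H" "continuation F (c +++ g) H'"
    using assms(1,2,4) c g unfolding is_branch_def by auto
  from continuation_unique[OF this] show ?thesis
    using c word_loop_path[OF g] by simp
qed

lemma branch_eq:
  assumes "is_branch F w H" "w \<in> words" "k \<in> cut_plane"
  shows "\<forall>\<^sub>F z in at k. branch F w z = H z"
  using is_branch_unique[OF _ assms] someI[of "is_branch F w" H] assms(1)
  unfolding branch_def by blast

lemma branch_sheet: "w \<in> words \<Longrightarrow> k \<in> cut_plane \<Longrightarrow> \<forall>\<^sub>F z in at k. branch G w z = sheet w z"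
  using branch_eq is_branch_sheet by blast

subsection \<open>Functions with trivial monodromy\<close>

definition trivial_monodromy :: "(complex \<Rightarrow> complex ^ 'n ^ 'n) \<Rightarrow> bool" where
  "trivial_monodromy K \<longleftrightarrow> contble K \<and>
     (\<forall>l\<in>letters. \<forall>k\<in>cut_plane. \<forall>g. slit_loop l k g \<longrightarrow> continuation K g K)"

primrec loop_power :: "(real \<Rightarrow> complex) \<Rightarrow> nat \<Rightarrow> real \<Rightarrow> complex" where
  "loop_power g 0 = linepath (pathstart g) (pathstart g)"
| "loop_power g (Suc m) = g +++ loop_power g m"

lemma loop_power:
  assumes "path g" "pathfinish g = pathstart g" "path_image g \<subseteq> D" "\<zeta> \<notin> D"
  shows "path (loop_power g m)" "pathstart (loop_power g m) = pathstart g"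
    "pathfinish (loop_power g m) = pathstart g" "path_image (loop_power g m) \<subseteq> D"
    "winding_number (loop_power g m) \<zeta> = of_nat m * winding_number g \<zeta>"
proof -
  have g0: "pathstart g \<in> D" using assms(3) by auto
  have "path (loop_power g m) \<and> pathstart (loop_power g m) = pathstart g \<and>
    pathfinish (loop_power g m) = pathstart g \<and> path_image (loop_power g m) \<subseteq> D \<and>
    winding_number (loop_power g m) \<zeta> = of_nat m * winding_number g \<zeta>"
  proof (induction m)
    case 0
    have "\<zeta> \<noteq> pathstart g" using g0 assms(4) by blast
    then show ?case using g0 by (simp add: winding_number_trivial del: linepath_refl linepath_trivial)
  next
    case (Suc m)
    have "\<zeta> \<notin> path_image g" "\<zeta> \<notin> path_image (loop_power g m)" using assms Suc by blast+
    moreover have "path_image (g +++ loop_power g m) \<subseteq> D"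
      using path_image_join_subset[of g "loop_power g m"] assms(3) Suc by blast
    ultimately show ?case
      using Suc assms by (simp add: winding_number_join algebra_simps)
  qed
  then show "path (loop_power g m)" "pathstart (loop_power g m) = pathstart g"
    "pathfinish (loop_power g m) = pathstart g" "path_image (loop_power g m) \<subseteq> D"
    "winding_number (loop_power g m) \<zeta> = of_nat m * winding_number g \<zeta>" by auto
qed

text \<open>A loop of winding number \<open>m \<ge> 0\<close> is homotopic to the \<open>m\<close>-th power of a bypass; a loop of negative
  winding number is reversed first.\<close>

lemma trivial_monodromy_loop:
  assumes K: "trivial_monodromy K" and l: "l \<in> letters" and k: "pathstart c \<in> cut_plane"
    and c: "path c" "pathfinish c = pathstart c" "path_image c \<subseteq> slit (letters - {l}) - {\<tau> l}"
  shows "continuation K c K"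
proof -
  have K1: "contble K" using K by (simp add: trivial_monodromy_def)
  have nonneg: "continuation K d K" if d: "path d" "pathfinish d = pathstart d" "pathstart d \<in> cut_plane"
      "path_image d \<subseteq> slit (letters - {l}) - {\<tau> l}" "winding_number d (\<tau> l) = of_nat m" for d m
  proof -
    obtain g where "bypass l (pathstart d) g" using bypass_exists[OF l d(3)] by blast
    then have sg: "slit_loop l (pathstart d) g" by (rule bypass_imp_slit_loop)
    have g: "path g" "pathfinish g = pathstart g" "path_image g \<subseteq> slit (letters - {l}) - {\<tau> l}"
      "\<tau> l \<notin> slit (letters - {l}) - {\<tau> l}" "pathstart g = pathstart d" "winding_number g (\<tau> l) = 1"
      using sg unfolding slit_loop_def by auto
    note lp = loop_power[OF g(1-4)]
    have cg: "continuation K g K" using K l d(3) sg unfolding trivial_monodromy_def by blast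
    have "continuation K (loop_power g m) K" for m
    proof (induction m)
      case 0
      have "matrix_meromorphic_on K {pathstart g}"
        using K1 d(3) g(5) unfolding contble_def by (auto intro: matrix_meromorphic_on_subset)
      then have "matrix_meromorphic_on K (path_image (linepath (pathstart g) (pathstart g)))"
        by (simp del: linepath_refl linepath_trivial)
      from continuation_const[OF this] show ?case by (simp only: loop_power.simps)
    next
      case (Suc m)
      show ?case unfolding loop_power.simps
        by (rule continuation_join[OF cg Suc g(1) lp(1)]) (use lp(2) g in simp)
    qed
    then show ?thesis
    proof (rule continuation_slit_homotopic[OF K1 l _ _ lp(1,4) d(1,4)])
      show "pathstart (loop_power g m) \<in> cut_plane" using lp(2) g(5) d(3) by simp
      show "pathstart d = pathstart (loop_power g m)" using lp(2) g(5) by simp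
      show "pathfinish d = pathfinish (loop_power g m)" using lp(3) g(5) d(2) by simp
      show "winding_number (loop_power g m) (\<tau> l) = winding_number d (\<tau> l)"
        unfolding lp(5) g(6) d(5) by simp
    qed
  qed
  have tau: "\<tau> l \<notin> path_image c" using c(3) by blast
  then have "winding_number c (\<tau> l) \<in> \<int>" using c(1,2) by (simp add: integer_winding_number_eq)
  then obtain m where m: "winding_number c (\<tau> l) = of_int m" by (auto elim: Ints_cases)
  show ?thesis
  proof (cases "m \<ge> 0")
    case True
    then have "winding_number c (\<tau> l) = of_nat (nat m)" unfolding m by simp
    then show ?thesis using nonneg[of c "nat m"] c k by blast
  next
    case False
    then have "winding_number (reversepath c) (\<tau> l) = of_nat (nat (- m))"
      using winding_number_reversepath[OF c(1) tau] unfolding m by simp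
    then have "continuation K (reversepath c) K"
      using nonneg[of "reversepath c"] c k by simp
    from continuation_reverse[OF this] show ?thesis by simp
  qed
qed

lemma cut_plane_dense: "open V \<Longrightarrow> V \<noteq> {} \<Longrightarrow> V \<inter> cut_plane \<noteq> {}"
  unfolding cut_plane_slit by (rule slit_dense) auto

text \<open>At a point of \<open>cut l\<close>, the function is continued from a nearby point
  \<open>k0\<close> of the cut plane. The disc without the cut may fall into many pieces; at a point
  of any of them the result still agrees with \<open>K\<close>, since the path can be closed up
  inside the cut plane to a loop that avoids the other cuts, and around such a loop \<open>K\<close>
  returns to itself.\<close>

lemma trivial_monodromy_extends_at:
  assumes K: "trivial_monodromy K" and z: "z \<in> base"
  shows "\<exists>\<phi> r. r > 0 \<and> matrix_meromorphic_on \<phi> (ball z r) \<and>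
    (\<forall>k\<in>ball z r \<inter> cut_plane. \<forall>\<^sub>F w in at k. \<phi> w = K w)"
proof (cases "z \<in> cut_plane")
  case True
  have mK: "matrix_meromorphic_on K cut_plane" using K by (simp add: trivial_monodromy_def contble_def)
  have "matrix_meromorphic_on K {z}" by (rule matrix_meromorphic_on_subset[OF mK]) (use True in simp)
  then obtain r where "r > 0" "ball z r \<subseteq> cut_plane" "matrix_meromorphic_on K (ball z r)"
    using cut_plane_ball[OF True] by blast
  then show ?thesis by (intro exI[of _ K] exI[of _ r]) simp
next
  case False
  then obtain l where l: "l \<in> letters" "z \<in> cut l" unfolding cut_plane_def by blast
  let ?D = "slit (letters - {l}) - {\<tau> l}"
  have zD: "z \<in> ?D"
    using l cut_disj[OF l(1)] z unfolding slit_def base_def by blast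
  have "open ?D" by (intro open_Diff open_slit) auto
  then obtain r1 where r1: "r1 > 0" "ball z r1 \<subseteq> ?D" using zD open_contains_ball by blast
  obtain k0 where k0: "k0 \<in> ball z r1" "k0 \<in> cut_plane"
    using cut_plane_dense[of "ball z r1"] r1(1) by auto
  have K1: "contble K" and mK: "matrix_meromorphic_on K cut_plane"
    using K by (simp_all add: trivial_monodromy_def contble_def)
  have s0: "path_image (linepath k0 z) \<subseteq> ball z r1"
    using k0(1) r1(1) by (simp add: closed_segment_subset)
  have "path_image (linepath k0 z) \<subseteq> base"
    using s0 r1(2) punctured_slit_subset_base[of l] by blast
  then obtain \<phi> where \<phi>: "continuation K (linepath k0 z) \<phi>"
    using K1 k0(2) unfolding contble_def by (metis path_linepath pathstart_linepath)
  have "matrix_meromorphic_on \<phi> {z}" using continuation_meromorphic(2)[OF \<phi>] by simp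
  then obtain r2 where r2: "r2 > 0" "matrix_meromorphic_on \<phi> (ball z r2)"
    using matrix_meromorphic_on_nhd by blast
  define r where "r = min r1 r2"
  have r: "r > 0" "ball z r \<subseteq> ball z r1" "ball z r \<subseteq> ball z r2" using r1 r2 by (auto simp: r_def)
  have m\<phi>: "matrix_meromorphic_on \<phi> (ball z r)" by (rule matrix_meromorphic_on_subset[OF r2(2) r(3)])
  have "\<forall>\<^sub>F w in at k. \<phi> w = K w" if k: "k \<in> ball z r" "k \<in> cut_plane" for k
  proof -
    obtain d where d: "path d" "path_image d \<subseteq> cut_plane" "pathstart d = k" "pathfinish d = k0"
      by (rule cut_plane_path[OF k(2) k0(2)]) blast
    have s1: "path_image (linepath z k) \<subseteq> ball z r"
      using k(1) r(1) by (simp add: closed_segment_subset)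
    let ?c = "d +++ (linepath k0 z +++ linepath z k)"
    have "continuation \<phi> (linepath z k) \<phi>"
      by (rule continuation_const[OF matrix_meromorphic_on_subset[OF m\<phi> s1]])
    then have kz: "continuation K (linepath k0 z +++ linepath z k) \<phi>"
      by (rule continuation_join[OF \<phi>]) simp_all
    have "continuation K d K"
      by (rule continuation_const[OF matrix_meromorphic_on_subset[OF mK d(2)]])
    from continuation_join[OF this kz] have a: "continuation K ?c \<phi>"
      using d by simp
    have "path_image ?c \<subseteq> ?D"
      using path_image_join_subset[of d "linepath k0 z +++ linepath z k"]
        path_image_join_subset[of "linepath k0 z" "linepath z k"] d(2) s0 s1 r(2) r1(2)
        cut_plane_subset_punctured_slit[OF l(1)] by blast
    then have b: "continuation K ?c K"
      by (intro trivial_monodromy_loop[OF K l(1)]) (use d k in simp_all)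
    have "path ?c" using d by simp
    from continuation_unique[OF a b this] show ?thesis by simp
  qed
  then show ?thesis using r(1) m\<phi> by (intro exI[of _ \<phi>] exI[of _ r]) blast
qed

text \<open>The local extensions agree where their discs overlap: the overlap is convex and contains
  a point of the dense cut plane, where both are equal to \<open>K\<close>.\<close>

lemma trivial_monodromy_extends:
  assumes K: "trivial_monodromy K"
  obtains H where "matrix_meromorphic_on H base" "\<And>k. k \<in> cut_plane \<Longrightarrow> \<forall>\<^sub>F z in at k. H z = K z"
proof -
  define Q where "Q z \<phi> r \<longleftrightarrow> r > 0 \<and> matrix_meromorphic_on \<phi> (ball z r) \<and>
    (\<forall>k\<in>ball z r \<inter> cut_plane. \<forall>\<^sub>F w in at k. \<phi> w = K w)" for z \<phi> r
  have "\<exists>\<phi> r. Q z \<phi> r" if "z \<in> base" for z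
    unfolding Q_def by (rule trivial_monodromy_extends_at[OF K that])
  then obtain \<phi> r where "\<And>z. z \<in> base \<Longrightarrow> Q z (\<phi> z) (r z)" by metis
  then have \<phi>: "\<And>z. z \<in> base \<Longrightarrow> r z > 0" "\<And>z. z \<in> base \<Longrightarrow> matrix_meromorphic_on (\<phi> z) (ball z (r z))"
    "\<And>z k. z \<in> base \<Longrightarrow> k \<in> ball z (r z) \<Longrightarrow> k \<in> cut_plane \<Longrightarrow> \<forall>\<^sub>F w in at k. \<phi> z w = K w"
    unfolding Q_def by blast+
  have m: "matrix_meromorphic_on (\<phi> z) {z}" if "z \<in> base" for z
    by (rule matrix_meromorphic_on_subset[OF \<phi>(2)[OF that]]) (use \<phi>(1)[OF that] in simp)
  have "\<forall>\<^sub>F w in at z. \<forall>\<^sub>F k in at w. \<phi> w k = \<phi> z k" if z: "z \<in> base" for z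
  proof -
    have "\<forall>\<^sub>F w in at z. w \<in> ball z (r z)" "\<forall>\<^sub>F w in at z. w \<in> base"
      by (rule eventually_at_in_open'; use \<phi>(1)[OF z] z open_base in simp)+
    then show ?thesis
    proof eventually_elim
      case (elim w)
      have "open (ball z (r z) \<inter> ball w (r w))" by auto
      moreover have "w \<in> ball z (r z) \<inter> ball w (r w)" using elim \<phi>(1) by auto
      ultimately obtain k where k: "k \<in> ball z (r z)" "k \<in> ball w (r w)" "k \<in> cut_plane"
        using cut_plane_dense[of "ball z (r z) \<inter> ball w (r w)"] by blast
      have "\<forall>\<^sub>F u in at k. \<phi> w u = \<phi> z u"
        using \<phi>(3)[OF z k(1,3)] \<phi>(3)[OF elim(2) k(2,3)] by eventually_elim simp
      moreover have "connected (ball z (r z) \<inter> ball w (r w))"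
        by (intro convex_connected convex_Int) auto
      ultimately show ?case
        using \<open>w \<in> ball z (r z) \<inter> ball w (r w)\<close> k
        by (intro matrix_meromorphic_eqI'[of "\<phi> w" "ball z (r z) \<inter> ball w (r w)" "\<phi> z" k w]
            matrix_meromorphic_on_subset[OF \<phi>(2)[OF z]] matrix_meromorphic_on_subset[OF \<phi>(2)[OF elim(2)]]) auto
    qed
  qed
  then obtain H where H: "matrix_meromorphic_on H base" "\<And>z. z \<in> base \<Longrightarrow> \<forall>\<^sub>F k in at z. H k = \<phi> z k"
    using glue_germs[of base \<phi>] m by blast
  show ?thesis
  proof (rule that[OF H(1)])
    fix k assume k: "k \<in> cut_plane"
    then have kb: "k \<in> base" using cut_plane_subset_base by blast
    have "\<forall>\<^sub>F w in at k. \<phi> k w = K w" using \<phi>(3)[OF kb _ k] \<phi>(1)[OF kb] by simp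
    with H(2)[OF kb] show "\<forall>\<^sub>F z in at k. H z = K z" by eventually_elim simp
  qed
qed

end

subsection \<open>Polynomial growth and rationality\<close>

lemma poly_norm_bound:
  fixes c :: "complex poly"
  shows "\<exists>C m. C \<ge> 0 \<and> (\<forall>z. norm (poly c z) \<le> C * (1 + norm z) ^ m)"
proof (induction c)
  case 0
  show ?case by (intro exI[of _ 0] exI[of _ 0]) simp
next
  case (pCons a c)
  then obtain C m where C: "C \<ge> 0" "\<And>z. norm (poly c z) \<le> C * (1 + norm z) ^ m" by blast
  have "norm (poly (pCons a c) z) \<le> (norm a + C) * (1 + norm z) ^ Suc m" for z
  proof -
    have "norm (poly (pCons a c) z) \<le> norm a + norm z * norm (poly c z)"
      by (simp add: norm_mult norm_triangle_le)
    also have "\<dots> \<le> norm a * (1 + norm z) ^ Suc m + (1 + norm z) * (C * (1 + norm z) ^ m)"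
    proof (rule add_mono)
      show "norm a \<le> norm a * (1 + norm z) ^ Suc m"
        using one_le_power[of "1 + norm z" "Suc m"] by (intro mult_left_le[of "norm a" 1, simplified] | simp add: mult_le_cancel_left1)+
      show "norm z * norm (poly c z) \<le> (1 + norm z) * (C * (1 + norm z) ^ m)"
        using C(2)[of z] by (intro mult_mono) auto
    qed
    also have "\<dots> = (norm a + C) * (1 + norm z) ^ Suc m" by (simp add: algebra_simps)
    finally show ?thesis .
  qed
  then show ?case using C(1) by (intro exI[of _ "norm a + C"] exI[of _ "Suc m"]) auto
qed

text \<open>The polynomial multiplier absorbs poles, and the class is closed under sums and
  products. The bound concerns germs only, as values at isolated points carry no meaning.\<close>

definition poly_growth :: "complex set \<Rightarrow> (complex \<Rightarrow> complex) \<Rightarrow> bool" where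
  "poly_growth D f \<longleftrightarrow> (\<exists>(c :: complex poly) C m. c \<noteq> 0 \<and> C \<ge> 0 \<and>
     (\<forall>k\<in>D. \<forall>\<^sub>F z in at k. norm (poly c z * f z) \<le> C * (1 + norm z) ^ m))"

lemma poly_growthI:
  assumes "c \<noteq> 0" "C \<ge> 0" "\<And>k. k \<in> D \<Longrightarrow> \<forall>\<^sub>F z in at k. norm (poly c z * f z) \<le> C * (1 + norm z) ^ m"
  shows "poly_growth D f"
  using assms unfolding poly_growth_def by blast

lemma poly_growth_const: "poly_growth D (\<lambda>_. a)"
  by (rule poly_growthI[of 1 "norm a" _ _ 0]) auto

lemma poly_growth_mult:
  assumes "poly_growth D f" "poly_growth D g"
  shows "poly_growth D (\<lambda>z. f z * g z)"
proof -
  obtain c C m where f: "c \<noteq> 0" "C \<ge> 0" "\<And>k. k \<in> D \<Longrightarrow> \<forall>\<^sub>F z in at k. norm (poly c z * f z) \<le> C * (1 + norm z) ^ m"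
    using assms(1) unfolding poly_growth_def by blast
  obtain d E n where g: "d \<noteq> 0" "E \<ge> 0" "\<And>k. k \<in> D \<Longrightarrow> \<forall>\<^sub>F z in at k. norm (poly d z * g z) \<le> E * (1 + norm z) ^ n"
    using assms(2) unfolding poly_growth_def by blast
  show ?thesis
  proof (rule poly_growthI[of "c * d" "C * E" _ _ "m + n"])
    fix k assume k: "k \<in> D"
    show "\<forall>\<^sub>F z in at k. norm (poly (c * d) z * (f z * g z)) \<le> C * E * (1 + norm z) ^ (m + n)"
      using f(3)[OF k] g(3)[OF k]
    proof eventually_elim
      case (elim z)
      have "norm (poly (c * d) z * (f z * g z)) = norm (poly c z * f z) * norm (poly d z * g z)"
        by (simp add: norm_mult mult_ac)
      also have "\<dots> \<le> (C * (1 + norm z) ^ m) * (E * (1 + norm z) ^ n)"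
        using elim f(2) by (intro mult_mono) auto
      finally show ?case by (simp add: power_add mult_ac)
    qed
  qed (use f g in auto)
qed

lemma poly_growth_add:
  assumes "poly_growth D f" "poly_growth D g"
  shows "poly_growth D (\<lambda>z. f z + g z)"
proof -
  obtain c C m where f: "c \<noteq> 0" "C \<ge> 0" "\<And>k. k \<in> D \<Longrightarrow> \<forall>\<^sub>F z in at k. norm (poly c z * f z) \<le> C * (1 + norm z) ^ m"
    using assms(1) unfolding poly_growth_def by blast
  obtain d E n where g: "d \<noteq> 0" "E \<ge> 0" "\<And>k. k \<in> D \<Longrightarrow> \<forall>\<^sub>F z in at k. norm (poly d z * g z) \<le> E * (1 + norm z) ^ n"
    using assms(2) unfolding poly_growth_def by blast
  obtain C1 m1 where c: "C1 \<ge> 0" "\<And>z. norm (poly c z) \<le> C1 * (1 + norm z) ^ m1" using poly_norm_bound by blast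
  obtain C2 m2 where d: "C2 \<ge> 0" "\<And>z. norm (poly d z) \<le> C2 * (1 + norm z) ^ m2" using poly_norm_bound by blast
  \<comment> \<open>A common exponent for the two terms, each of which picks up the other
    multiplier.\<close>
  define N where "N = (m + m2) + (n + m1)"
  show ?thesis
  proof (rule poly_growthI[of "c * d" "C * C2 + E * C1" _ _ N])
    fix k assume k: "k \<in> D"
    show "\<forall>\<^sub>F z in at k. norm (poly (c * d) z * (f z + g z)) \<le> (C * C2 + E * C1) * (1 + norm z) ^ N"
      using f(3)[OF k] g(3)[OF k]
    proof eventually_elim
      case (elim z)
      have le: "(1 + norm z) ^ (m + m2) \<le> (1 + norm z) ^ N" "(1 + norm z) ^ (n + m1) \<le> (1 + norm z) ^ N"
        by (auto simp: N_def intro!: power_increasing)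
      have "poly (c * d) z * (f z + g z) = (poly c z * f z) * poly d z + (poly d z * g z) * poly c z"
        by (simp add: algebra_simps)
      then have "norm (poly (c * d) z * (f z + g z)) \<le>
          norm (poly c z * f z) * norm (poly d z) + norm (poly d z * g z) * norm (poly c z)"
        by (metis norm_mult norm_triangle_ineq)
      also have "\<dots> \<le> (C * (1 + norm z) ^ m) * (C2 * (1 + norm z) ^ m2) + (E * (1 + norm z) ^ n) * (C1 * (1 + norm z) ^ m1)"
        using elim f(2) g(2) c d by (intro add_mono mult_mono) auto
      also have "\<dots> = C * C2 * (1 + norm z) ^ (m + m2) + E * C1 * (1 + norm z) ^ (n + m1)"
        by (simp add: power_add mult_ac)
      also have "\<dots> \<le> C * C2 * (1 + norm z) ^ N + E * C1 * (1 + norm z) ^ N"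
        using le f(2) g(2) c(1) d(1) by (intro add_mono mult_left_mono) auto
      finally show ?case by (simp add: algebra_simps)
    qed
  qed (use f g c d in auto)
qed

lemma poly_growth_sum:
  "(\<And>i. i \<in> I \<Longrightarrow> poly_growth D (f i)) \<Longrightarrow> poly_growth D (\<lambda>z. \<Sum>i\<in>I. f i z)"
  by (induction I rule: infinite_finite_induct) (auto intro: poly_growth_const poly_growth_add)

lemma poly_growth_prod:
  "(\<And>i. i \<in> I \<Longrightarrow> poly_growth D (f i)) \<Longrightarrow> poly_growth D (\<lambda>z. \<Prod>i\<in>I. f i z)"
  by (induction I rule: infinite_finite_induct) (auto intro: poly_growth_const poly_growth_mult)

lemma poly_growth_diff:
  assumes "poly_growth D f" "poly_growth D g"
  shows "poly_growth D (\<lambda>z. f z - g z)"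
  using poly_growth_add[OF assms(1) poly_growth_mult[OF poly_growth_const[of D "-1"] assms(2)]] by simp

lemma poly_growth_det:
  fixes F :: "complex \<Rightarrow> complex ^ 'n ^ 'n"
  assumes "\<And>i j. poly_growth D (\<lambda>z. F z $ i $ j)"
  shows "poly_growth D (\<lambda>z. det (F z))"
  unfolding det_def
  by (intro poly_growth_sum poly_growth_mult poly_growth_prod poly_growth_const assms)

lemma poly_poly_const:
  fixes P :: "'a :: comm_semiring_1 poly poly"
  shows "poly (poly P [:y:]) k = (\<Sum>r\<le>degree P. poly (coeff P r) k * y ^ r)"
  by (simp add: poly_altdef[of P] poly_sum poly_power)

text \<open>Multiplied by the power d - 1 of the leading coefficient, the relation becomes a monic
  equation for \<open>a d * y\<close>, to which Cauchy's estimate of roots applies. No division by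
  \<open>a d\<close> occurs, so polynomial coefficients give a polynomial bound.\<close>

lemma poly_root_bound:
  fixes a :: "nat \<Rightarrow> complex"
  assumes "(\<Sum>r\<le>d. a r * y ^ r) = 0" "a d \<noteq> 0"
  shows "norm (a d * y) \<le> 1 + (\<Sum>r<d. norm (a r) * norm (a d) ^ (d - 1 - r))"
proof (cases "norm (a d * y) \<le> 1")
  case True
  have "0 \<le> (\<Sum>r<d. norm (a r) * norm (a d) ^ (d - 1 - r))" by (intro sum_nonneg) auto
  with True show ?thesis by linarith
next
  case False
  have d0: "d \<noteq> 0" using assms by (intro notI) simp
  let ?z = "a d * y"
  have z1: "norm ?z \<ge> 1" using False by simp
  have "?z ^ d = a d ^ (d - 1) * (a d * y ^ d)"
    using d0 by (cases d) (simp_all add: power_mult_distrib mult_ac)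
  also have "a d * y ^ d = - (\<Sum>r<d. a r * y ^ r)"
    using assms(1) unfolding lessThan_Suc_atMost[symmetric] sum.lessThan_Suc by (rule add.inverse_unique[symmetric])
  also have "a d ^ (d - 1) * - (\<Sum>r<d. a r * y ^ r) = - (\<Sum>r<d. a r * a d ^ (d - 1 - r) * ?z ^ r)"
  proof -
    have "a d ^ (d - 1) * (a r * y ^ r) = a r * a d ^ (d - 1 - r) * ?z ^ r" if "r < d" for r
    proof -
      have "d - 1 = (d - 1 - r) + r" using that by simp
      then have "a d ^ (d - 1) = a d ^ (d - 1 - r) * a d ^ r" by (metis power_add)
      then show ?thesis by (simp add: power_mult_distrib mult_ac)
    qed
    then have "a d ^ (d - 1) * (\<Sum>r<d. a r * y ^ r) = (\<Sum>r<d. a r * a d ^ (d - 1 - r) * ?z ^ r)"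
      unfolding sum_distrib_left by (intro sum.cong) auto
    then show ?thesis by simp
  qed
  finally have "norm ?z ^ d = norm (\<Sum>r<d. a r * a d ^ (d - 1 - r) * ?z ^ r)"
    by (metis norm_minus_cancel norm_power)
  also have "\<dots> \<le> (\<Sum>r<d. norm (a r) * norm (a d) ^ (d - 1 - r) * norm ?z ^ r)"
    by (rule order_trans[OF norm_sum]) (simp add: norm_mult norm_power)
  also have "\<dots> \<le> (\<Sum>r<d. norm (a r) * norm (a d) ^ (d - 1 - r) * norm ?z ^ (d - 1))"
    using z1 by (intro sum_mono mult_left_mono power_increasing) auto
  also have "\<dots> = (\<Sum>r<d. norm (a r) * norm (a d) ^ (d - 1 - r)) * norm ?z ^ (d - 1)"
    by (simp add: sum_distrib_right)
  finally have "norm ?z * norm ?z ^ (d - 1) \<le> (\<Sum>r<d. norm (a r) * norm (a d) ^ (d - 1 - r)) * norm ?z ^ (d - 1)"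
    using power_minus_mult[of d "norm ?z"] d0 by (simp add: mult.commute)
  moreover have "norm ?z ^ (d - 1) > 0" using z1 by (intro zero_less_power) linarith
  ultimately have "norm ?z \<le> (\<Sum>r<d. norm (a r) * norm (a d) ^ (d - 1 - r))"
    by (rule mult_right_le_imp_le)
  then show ?thesis by linarith
qed

lemma poly_nonzero_eventually:
  fixes c :: "complex poly"
  assumes "c \<noteq> 0"
  shows "\<forall>\<^sub>F z in at k. poly c z \<noteq> 0"
proof -
  have "finite ({z. poly c z = 0} - {k})" using poly_roots_finite[OF assms] by blast
  then have "open (- ({z. poly c z = 0} - {k}))" by (intro open_Compl finite_imp_closed)
  then have "\<forall>\<^sub>F z in at k. z \<in> - ({z. poly c z = 0} - {k}) - {k}"
    by (intro eventually_at_in_open) auto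
  then show ?thesis by eventually_elim auto
qed

text \<open>The leading coefficient serves as multiplier: an algebraic function becomes integral
  over the polynomials after multiplication by it.\<close>

lemma poly_growth_algebraic:
  fixes P :: "complex poly poly"
  assumes P: "P \<noteq> 0" and f: "\<And>k. k \<in> D \<Longrightarrow> \<forall>\<^sub>F z in at k. poly (poly P [:f z:]) z = 0"
  shows "poly_growth D f"
proof -
  define d where "d = degree P"
  define c where "c = coeff P d"
  have c0: "c \<noteq> 0" using P by (simp add: c_def d_def)
  have "\<exists>C m. C \<ge> 0 \<and> (\<forall>z. norm (poly (coeff P r) z) * norm (poly c z) ^ (d - 1 - r) \<le> C * (1 + norm z) ^ m)" for r
  proof -
    obtain C m where "C \<ge> 0" "\<And>z. norm (poly (coeff P r * c ^ (d - 1 - r)) z) \<le> C * (1 + norm z) ^ m"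
      using poly_norm_bound by blast
    then show ?thesis by (intro exI[of _ C] exI[of _ m]) (simp add: poly_power norm_mult norm_power)
  qed
  then obtain C m where C: "\<And>r. C r \<ge> 0"
    "\<And>r z. norm (poly (coeff P r) z) * norm (poly c z) ^ (d - 1 - r) \<le> C r * (1 + norm z) ^ m r" by metis
  define N where "N = (\<Sum>r<d. m r)"
  show ?thesis
  proof (rule poly_growthI[OF c0, of "1 + (\<Sum>r<d. C r)" _ _ N])
    show "0 \<le> 1 + (\<Sum>r<d. C r)" using C(1) by (simp add: sum_nonneg add_nonneg_nonneg)
    fix k assume "k \<in> D"
    from f[OF this] poly_nonzero_eventually[OF c0, of k]
    show "\<forall>\<^sub>F z in at k. norm (poly c z * f z) \<le> (1 + (\<Sum>r<d. C r)) * (1 + norm z) ^ N"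
    proof eventually_elim
      case (elim z)
      have "(\<Sum>r\<le>d. poly (coeff P r) z * f z ^ r) = 0"
        using elim(1) by (simp only: poly_poly_const d_def)
      from poly_root_bound[of "\<lambda>r. poly (coeff P r) z", OF this] elim(2)
      have "norm (poly c z * f z) \<le> 1 + (\<Sum>r<d. norm (poly (coeff P r) z) * norm (poly c z) ^ (d - 1 - r))"
        by (simp add: c_def)
      also have "\<dots> \<le> 1 + (\<Sum>r<d. C r * (1 + norm z) ^ N)"
      proof (intro add_left_mono sum_mono)
        fix r assume r: "r \<in> {..<d}"
        have "norm (poly (coeff P r) z) * norm (poly c z) ^ (d - 1 - r) \<le> C r * (1 + norm z) ^ m r" by (rule C(2))
        also have "m r \<le> N" unfolding N_def using r by (intro member_le_sum) auto
        then have "C r * (1 + norm z) ^ m r \<le> C r * (1 + norm z) ^ N"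
          using C(1) by (intro mult_left_mono power_increasing) auto
        finally show "norm (poly (coeff P r) z) * norm (poly c z) ^ (d - 1 - r) \<le> C r * (1 + norm z) ^ N" .
      qed
      also have "\<dots> \<le> (1 + norm z) ^ N + (\<Sum>r<d. C r) * (1 + norm z) ^ N"
        by (simp add: sum_distrib_right one_le_power)
      finally show ?case by (simp add: algebra_simps)
    qed
  qed
qed

text \<open>By continuity a violation at \<open>w\<close> would persist on an open set. This set
  meets \<open>D\<close>, and near a point of \<open>D\<close> the bound holds.\<close>

lemma analytic_bound_dense:
  fixes h :: "complex \<Rightarrow> complex"
  assumes h: "h analytic_on {w}"
    and dense: "\<And>V. open V \<Longrightarrow> V \<noteq> {} \<Longrightarrow> V \<inter> D \<noteq> {}"
    and bound: "\<And>k. k \<in> D \<Longrightarrow> \<forall>\<^sub>F z in at k. norm (h z) \<le> C * (1 + norm z) ^ m"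
  shows "norm (h w) \<le> C * (1 + norm w) ^ m"
proof (rule ccontr)
  assume neg: "\<not> norm (h w) \<le> C * (1 + norm w) ^ m"
  obtain T where T: "open T" "w \<in> T" "h holomorphic_on T"
    using h unfolding analytic_at by blast
  have "continuous_on T (\<lambda>z. C * (1 + norm z) ^ m - norm (h z))"
    using holomorphic_on_imp_continuous_on[OF T(3)] by (intro continuous_intros)
  then have "open (T \<inter> (\<lambda>z. C * (1 + norm z) ^ m - norm (h z)) -` {..<0})"
    by (rule continuous_open_preimage[OF _ T(1)]) simp
  moreover have "w \<in> T \<inter> (\<lambda>z. C * (1 + norm z) ^ m - norm (h z)) -` {..<0}" using T neg by simp
  ultimately obtain k where k: "k \<in> T \<inter> (\<lambda>z. C * (1 + norm z) ^ m - norm (h z)) -` {..<0}" "k \<in> D"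
    and o: "open (T \<inter> (\<lambda>z. C * (1 + norm z) ^ m - norm (h z)) -` {..<0})"
    using dense by blast
  have "\<forall>\<^sub>F z in at k. z \<in> T \<inter> (\<lambda>z. C * (1 + norm z) ^ m - norm (h z)) -` {..<0}"
    using o k(1) by (rule eventually_at_in_open')
  with bound[OF k(2)] have "\<forall>\<^sub>F z in at k. False" by eventually_elim auto
  then show False by simp
qed

lemma meromorphic_bounded_imp_analytic:
  fixes h :: "complex \<Rightarrow> complex"
  assumes "isolated_singularity_at h z" "\<forall>\<^sub>F w in at z. norm (h w) \<le> M"
  shows "remove_sings h analytic_on {z}"
proof -
  obtain r where r: "r > 0" "h analytic_on ball z r - {z}"
    using assms(1) unfolding isolated_singularity_at_def by blast
  then have "h holomorphic_on ball z r - {z}" using analytic_imp_holomorphic by blast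
  moreover have "z \<in> interior (ball z r)" using r(1) by simp
  ultimately obtain g where g: "g holomorphic_on ball z r" "\<And>w. w \<in> ball z r - {z} \<Longrightarrow> g w = h w"
    using holomorphic_on_extend_bounded[of h "ball z r" z] assms(2) by blast
  have "isCont g z"
  proof -
    have "continuous_on (ball z r) g" using g(1) by (rule holomorphic_on_imp_continuous_on)
    then show ?thesis using r(1) by (simp add: continuous_on_eq_continuous_at)
  qed
  then have "g \<midarrow>z\<rightarrow> g z" by (simp add: isCont_def)
  moreover have "\<forall>\<^sub>F w in at z. g w = h w"
  proof -
    have "\<forall>\<^sub>F w in at z. w \<in> ball z r - {z}" using r(1) by (intro eventually_at_in_open) auto
    then show ?thesis by eventually_elim (rule g(2))
  qed
  ultimately have "h \<midarrow>z\<rightarrow> g z" by (rule Lim_transform_eventually)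
  then show ?thesis by (rule remove_sings_analytic_at[OF assms(1)])
qed

text \<open>After multiplication by \<open>c\<close> the bound spreads from the dense set to all
  points of analyticity. Hence the singularities are removable, first those off \<open>T\<close> and
  then the points of \<open>T\<close>; an entire function of polynomial growth is a
  polynomial.\<close>

lemma poly_growth_imp_rational:
  fixes f :: "complex \<Rightarrow> complex"
  assumes fin: "finite T" and f: "f meromorphic_on - T" and gr: "poly_growth D f"
    and D: "D \<subseteq> - T" "\<And>V. open V \<Longrightarrow> V \<noteq> {} \<Longrightarrow> V \<inter> D \<noteq> {}"
  obtains p q :: "complex poly" where "q \<noteq> 0" "\<And>k. k \<in> D \<Longrightarrow> \<forall>\<^sub>F z in at k. f z = poly p z / poly q z"
proof -
  obtain c C m where c: "c \<noteq> 0" "C \<ge> 0" "\<And>k. k \<in> D \<Longrightarrow> \<forall>\<^sub>F z in at k. norm (poly c z * f z) \<le> C * (1 + norm z) ^ m"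
    using gr unfolding poly_growth_def by blast
  define h where "h z = poly c z * f z" for z
  have op: "open (- T)" using fin by (intro open_Compl finite_imp_closed)
  have mh: "h meromorphic_on - T"
  proof -
    have "(\<lambda>z. poly c z) holomorphic_on - T" by (intro holomorphic_intros)
    then have "(\<lambda>z. poly c z) meromorphic_on - T"
      using op by (intro analytic_on_imp_meromorphic_on) (simp add: analytic_on_open)
    then show ?thesis unfolding h_def using f by (intro meromorphic_on_mult)
  qed
  have bd: "\<exists>M. \<forall>\<^sub>F w in at z. norm (g w) \<le> M" if g: "\<forall>\<^sub>F w in at z. norm (g w) \<le> C * (1 + norm w) ^ m" for g :: "complex \<Rightarrow> complex" and z
  proof -
    have "\<forall>\<^sub>F w in at z. w \<in> ball z 1" by (intro eventually_at_in_open') auto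
    with g have "\<forall>\<^sub>F w in at z. norm (g w) \<le> C * (1 + (norm z + 1)) ^ m"
    proof eventually_elim
      case (elim w)
      have "norm w \<le> norm z + 1"
        using elim(2) norm_triangle_ineq2[of w z] by (simp add: dist_norm norm_minus_commute)
      then have "C * (1 + norm w) ^ m \<le> C * (1 + (norm z + 1)) ^ m"
        using c(2) by (intro mult_left_mono power_mono) auto
      with elim(1) show ?case by linarith
    qed
    then show ?thesis by blast
  qed
  define h1 where "h1 = remove_sings h"
  have iso: "isolated_singularity_at h z" if "z \<in> - T" for z
    
    using mh that unfolding meromorphic_on_altdef by blast
  have ev1: "\<forall>\<^sub>F w in at z. h1 w = h w" if "z \<in> - T" for z
    unfolding h1_def by (rule eventually_remove_sings_eq_at[OF iso[OF that]])
  have hb: "norm (h w) \<le> C * (1 + norm w) ^ m" if "h analytic_on {w}" for w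
    by (rule analytic_bound_dense[OF that D(2)]) (use c(3) in \<open>simp_all add: h_def\<close>)
  have an1: "h1 analytic_on {z}" if z: "z \<in> - T" for z
  proof -
    obtain r where r: "r > 0" "h analytic_on ball z r - {z}"
      using iso[OF z] unfolding isolated_singularity_at_def by blast
    have "\<forall>\<^sub>F w in at z. w \<in> ball z r - {z}" using r(1) by (intro eventually_at_in_open) auto
    then have "\<forall>\<^sub>F w in at z. norm (h w) \<le> C * (1 + norm w) ^ m"
      by eventually_elim (rule hb, use r(2) analytic_on_subset in blast)
    from bd[OF this] show ?thesis
      unfolding h1_def using meromorphic_bounded_imp_analytic[OF iso[OF z]] by blast
  qed
  have b1: "norm (h1 z) \<le> C * (1 + norm z) ^ m" if "z \<in> - T" for z
  proof (rule analytic_bound_dense[OF an1[OF that] D(2)])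
    fix k assume k: "k \<in> D"
    then have kT: "k \<in> - T" using D(1) by blast
    show "\<forall>\<^sub>F z in at k. norm (h1 z) \<le> C * (1 + norm z) ^ m"
      using ev1[OF kT] c(3)[OF k] by eventually_elim (simp add: h_def)
  qed
  define F where "F = remove_sings h1"
  have FT: "F z = h1 z" if "z \<in> - T" for z
    unfolding F_def by (rule remove_sings_at_analytic[OF an1[OF that]])
  have "F analytic_on {z}" for z
  proof -
    have op2: "open (- (T - {z}))" using fin by (intro open_Compl finite_imp_closed) auto
    then have evT: "\<forall>\<^sub>F w in at z. w \<in> - (T - {z}) - {z}" by (intro eventually_at_in_open) auto
    have "h1 analytic_on - T"
      using an1 by (subst analytic_on_analytic_at) blast
    then have "h1 analytic_on - (T - {z}) - {z}" by (rule analytic_on_subset) blast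
    then have "h1 holomorphic_on - (T - {z}) - {z}" by (rule analytic_imp_holomorphic)
    then have "isolated_singularity_at h1 z"
      by (rule isolated_singularity_at_holomorphic[OF _ op2]) simp
    moreover have "\<forall>\<^sub>F w in at z. norm (h1 w) \<le> C * (1 + norm w) ^ m"
      using evT by eventually_elim (rule b1, auto)
    ultimately show ?thesis
      unfolding F_def using bd meromorphic_bounded_imp_analytic by blast
  qed
  then have "F analytic_on UNIV" by (subst analytic_on_analytic_at) blast
  then have F: "F holomorphic_on UNIV" by (rule analytic_imp_holomorphic)
  obtain R where R: "\<And>t. t \<in> T \<Longrightarrow> norm t \<le> R"
    using finite_imp_bounded[OF fin] unfolding bounded_iff by blast
  \<comment> \<open>Beyond this radius there are no points of \<open>T\<close>, and 1 + |z| is at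
    most 2 |z|.\<close>
  define A where "A = max 1 (R + 1)"
  have "norm (F z) \<le> (C * 2 ^ m) * norm z ^ m" if z: "A \<le> norm z" for z
  proof -
    have "z \<in> - T" using R[of z] z by (auto simp: A_def)
    then have "norm (F z) \<le> C * (1 + norm z) ^ m" using FT b1 by simp
    also have "\<dots> \<le> C * (2 * norm z) ^ m"
      using c(2) z by (intro mult_left_mono power_mono) (auto simp: A_def)
    finally show ?thesis by (simp add: power_mult_distrib)
  qed
  then have L: "F \<xi> = (\<Sum>k\<le>m. (deriv ^^ k) F 0 / fact k * \<xi> ^ k)" for \<xi>
    by (rule Liouville_polynomial[OF F])
  define p where "p = (\<Sum>k\<le>m. monom ((deriv ^^ k) F 0 / fact k) k)"
  have p: "poly p z = F z" for z unfolding p_def L[of z] by (simp add: poly_sum poly_monom)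
  show ?thesis
  proof (rule that[of c p, OF c(1)])
    fix k assume "k \<in> D"
    then have kT: "k \<in> - T" using D(1) by blast
    have "\<forall>\<^sub>F z in at k. z \<in> - T" using op kT by (rule eventually_at_in_open')
    then show "\<forall>\<^sub>F z in at k. f z = poly p z / poly c z"
      using ev1[OF kT] poly_nonzero_eventually[OF c(1), of k]
      by eventually_elim (simp add: p FT h_def)
  qed
qed

subsection \<open>The trace over the sheets\<close>

lemma matrix_inv:
  fixes M :: "'a :: field ^ 'n ^ 'n"
  assumes "det M \<noteq> 0"
  shows "M ** matrix_inv M = mat 1" "matrix_inv M ** M = mat 1"
proof -
  have "invertible M" using assms by (simp add: invertible_det_nz)
  then have "\<exists>M'. M ** M' = mat 1 \<and> M' ** M = mat 1" unfolding invertible_def .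
  from someI_ex[OF this] show "M ** matrix_inv M = mat 1" "matrix_inv M ** M = mat 1"
    unfolding matrix_inv_def by auto
qed

lemma mat_component: "(mat c ** (M :: 'a :: comm_semiring_1 ^ 'n ^ 'n)) $ i $ j = c * M $ i $ j"
  by (simp add: matrix_matrix_mult_def mat_def if_distrib[of "\<lambda>x. x * _"] cong: if_cong)

lemma mat_commute: "mat c ** (M :: 'a :: comm_semiring_1 ^ 'n ^ 'n) = M ** mat c"
proof -
  have "(M ** mat c) $ i $ j = c * M $ i $ j" for i j
    by (simp add: matrix_matrix_mult_def mat_def if_distrib[of "\<lambda>x. _ * x"] mult.commute cong: if_cong)
  then show ?thesis by (simp add: vec_eq_iff mat_component)
qed

lemma mat_mult_mat: "mat a ** (mat b :: 'a :: comm_semiring_1 ^ 'n ^ 'n) = mat (a * b)"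
proof -
  have "(mat a ** mat b :: 'a ^ 'n ^ 'n) $ i $ j = mat (a * b) $ i $ j" for i j
    unfolding mat_component by (simp add: mat_def)
  then show ?thesis by (simp add: vec_eq_iff)
qed

lemma matrix_mult_sum_right:
  "(M :: 'a :: comm_semiring_1 ^ 'n ^ 'm) ** (\<Sum>v\<in>V. F v) = (\<Sum>v\<in>V. M ** F v)"
  by (induction V rule: infinite_finite_induct) (simp_all add: matrix_add_ldistrib)

lemma matrix_mult_sum_left:
  fixes F :: "'b \<Rightarrow> 'a :: comm_semiring_1 ^ 'm ^ 'k" and M :: "'a ^ 'n ^ 'm"
  shows "(\<Sum>v\<in>V. F v) ** M = (\<Sum>v\<in>V. F v ** M)"
proof -
  have "(X + Y) ** M = X ** M + Y ** M" for X Y :: "'a ^ 'm ^ 'k"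
    by (simp add: matrix_matrix_mult_def vec_eq_iff sum.distrib distrib_right)
  then show ?thesis by (induction V rule: infinite_finite_induct) simp_all
qed

text \<open>Cramer's rule for the columns of the inverse, without the division by the determinant;
  it is polynomial in the entries and makes sense for singular matrices.\<close>

definition adjugate :: "'a :: field ^ 'n ^ 'n \<Rightarrow> 'a ^ 'n ^ 'n" where
  "adjugate M = (\<chi> k j. det (\<chi> i j'. if j' = k then (if i = j then 1 else 0) else M $ i $ j'))"

lemma adjugate_eq:
  fixes M :: "'a :: field ^ 'n ^ 'n"
  assumes d: "det M \<noteq> 0"
  shows "adjugate M = mat (det M) ** matrix_inv M"
proof -
  have "adjugate M $ k $ j = det M * matrix_inv M $ k $ j" for k j
  proof -
    define b :: "'a ^ 'n" where "b = (\<chi> i. if i = j then 1 else 0)"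
    have "matrix_inv M *v b = (\<chi> k. matrix_inv M $ k $ j)"
      by (simp add: b_def matrix_vector_mult_def vec_eq_iff if_distrib[of "\<lambda>x. _ * x"] cong: if_cong)
    moreover have "M *v (matrix_inv M *v b) = b"
      by (simp add: matrix_vector_mul_assoc matrix_inv(1)[OF d])
    then have "matrix_inv M *v b = (\<chi> k. det (\<chi> i j'. if j' = k then b $ i else M $ i $ j') / det M)"
      by (rule iffD1[OF cramer[OF d]])
    ultimately have "(\<chi> k. matrix_inv M $ k $ j) $ k = (\<chi> k. det (\<chi> i j'. if j' = k then b $ i else M $ i $ j') / det M) $ k"
      by (simp only:)
    then have "matrix_inv M $ k $ j = det (\<chi> i j'. if j' = k then b $ i else M $ i $ j') / det M"
      by (simp only: vec_lambda_beta)
    then show ?thesis using d unfolding adjugate_def b_def by (simp cong: if_cong)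
  qed
  then show ?thesis by (simp add: vec_eq_iff mat_component)
qed

text \<open>With \<open>P v = G v ** matrix_inv G0\<close>, the matrix \<open>G0 ** S\<close> is a combination of the inverses of the \<open>P v\<close>.
  Hence it commutes with every \<open>P v\<close>, and \<open>G v ** S = P v ** (G0 ** S)\<close>.\<close>

lemma commuting_twist:
  fixes G :: "'b \<Rightarrow> 'a :: field ^ 'n ^ 'n" and G0 :: "'a ^ 'n ^ 'n"
  assumes d: "det G0 \<noteq> 0" "\<And>v. v \<in> V \<Longrightarrow> det (G v) \<noteq> 0"
    and comm: "\<And>v w. v \<in> V \<Longrightarrow> w \<in> V \<Longrightarrow>
        (G v ** matrix_inv G0) ** (G w ** matrix_inv G0) = (G w ** matrix_inv G0) ** (G v ** matrix_inv G0)"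
    and S: "S = (\<Sum>v\<in>V. mat (c v) ** matrix_inv (G v))"
    and uw: "u \<in> V" "w \<in> V"
  shows "(G u ** S) ** (G w ** S) = (G w ** S) ** (G u ** S)"
proof -
  define P where "P v = G v ** matrix_inv G0" for v
  define Q where "Q v = G0 ** matrix_inv (G v)" for v
  define T where "T = G0 ** S"
  have PQ: "P v ** Q v = mat 1" "Q v ** P v = mat 1" if "v \<in> V" for v
  proof -
    have "P v ** Q v = G v ** (matrix_inv G0 ** G0) ** matrix_inv (G v)"
      by (simp add: P_def Q_def matrix_mul_assoc)
    then show "P v ** Q v = mat 1" by (simp add: matrix_inv d that)
    have "Q v ** P v = G0 ** (matrix_inv (G v) ** G v) ** matrix_inv G0"
      by (simp add: P_def Q_def matrix_mul_assoc)
    then show "Q v ** P v = mat 1" by (simp add: matrix_inv d that)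
  qed
  have PP: "P v ** P w = P w ** P v" if "v \<in> V" "w \<in> V" for v w
    unfolding P_def by (rule comm[OF that])
  have QP: "Q v ** P w = P w ** Q v" if v: "v \<in> V" "w \<in> V" for v w
  proof -
    have "Q v ** P w = Q v ** P w ** (P v ** Q v)" by (simp add: PQ v)
    also have "\<dots> = Q v ** (P w ** P v) ** Q v" by (simp add: matrix_mul_assoc)
    also have "\<dots> = (Q v ** P v) ** P w ** Q v" by (simp add: PP[OF v(2,1)] matrix_mul_assoc)
    also have "\<dots> = P w ** Q v" by (simp add: PQ v)
    finally show ?thesis .
  qed
  have T: "T = (\<Sum>v\<in>V. mat (c v) ** Q v)"
  proof -
    have "G0 ** (mat (c v) ** matrix_inv (G v)) = mat (c v) ** Q v" for v
      unfolding Q_def by (metis mat_commute matrix_mul_assoc)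
    then show ?thesis unfolding T_def S matrix_mult_sum_right by simp
  qed
  have TP: "T ** P w = P w ** T" if w: "w \<in> V" for w
    unfolding T matrix_mult_sum_left matrix_mult_sum_right
  proof (rule sum.cong[OF refl])
    fix v assume v: "v \<in> V"
    have "mat (c v) ** Q v ** P w = mat (c v) ** P w ** Q v"
      by (simp add: matrix_mul_assoc[symmetric] QP[OF v w])
    also have "\<dots> = P w ** (mat (c v) ** Q v)" by (simp add: mat_commute[of _ "P w"] matrix_mul_assoc)
    finally show "mat (c v) ** Q v ** P w = P w ** (mat (c v) ** Q v)" .
  qed
  have GS: "G v ** S = P v ** T" for v
  proof -
    have "P v ** T = G v ** (matrix_inv G0 ** G0) ** S" by (simp add: P_def T_def matrix_mul_assoc)
    then show ?thesis by (simp add: matrix_inv d)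
  qed
  have "(P u ** T) ** (P w ** T) = P u ** (T ** P w) ** T" by (simp add: matrix_mul_assoc)
  also have "\<dots> = (P u ** P w) ** (T ** T)" by (simp add: TP uw matrix_mul_assoc)
  also have "\<dots> = P w ** (P u ** T) ** T" by (simp add: PP[OF uw] matrix_mul_assoc)
  also have "\<dots> = P w ** (T ** P u) ** T" by (simp only: TP[OF uw(1)])
  also have "\<dots> = (P w ** T) ** (P u ** T)" by (simp only: matrix_mul_assoc)
  finally show ?thesis unfolding GS .
qed

section \<open>Meromorphy, analyticity and growth of the terms of the trace\<close>

lemma meromorphic_on_det:
  fixes F :: "complex \<Rightarrow> complex ^ 'n ^ 'n"
  assumes "matrix_meromorphic_on F D"
  shows "(\<lambda>z. det (F z)) meromorphic_on D"
  unfolding det_def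
  by (intro meromorphic_intros) (use assms in \<open>auto simp: matrix_meromorphic_on_def\<close>)

lemma analytic_on_det:
  fixes F :: "complex \<Rightarrow> complex ^ 'n ^ 'n"
  assumes "\<And>i j. (\<lambda>z. F z $ i $ j) analytic_on D"
  shows "(\<lambda>z. det (F z)) analytic_on D"
  unfolding det_def by (intro analytic_intros assms)

lemma matrix_meromorphic_on_mult:
  fixes F H :: "complex \<Rightarrow> complex ^ 'n ^ 'n"
  assumes "matrix_meromorphic_on F D" "matrix_meromorphic_on H D"
  shows "matrix_meromorphic_on (\<lambda>z. F z ** H z) D"
  unfolding matrix_meromorphic_on_def matrix_matrix_mult_def vec_lambda_beta
  by (intro allI meromorphic_intros) (use assms in \<open>auto simp: matrix_meromorphic_on_def\<close>)

lemma continuation_map: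
  fixes F H :: "complex \<Rightarrow> complex ^ 'n ^ 'n" and \<Psi> :: "complex \<Rightarrow> complex ^ 'n ^ 'n \<Rightarrow> complex ^ 'm ^ 'm"
  assumes "continuation F g H"
    and "\<And>K z. matrix_meromorphic_on K {z} \<Longrightarrow> matrix_meromorphic_on (\<lambda>k. \<Psi> k (K k)) {z}"
  shows "continuation (\<lambda>k. \<Psi> k (F k)) g (\<lambda>k. \<Psi> k (H k))"
  using continuation_combine[of "{()}" "\<lambda>_. F" g "\<lambda>_. H" "\<lambda>k M. \<Psi> k (M ())"] assms by simp

lemma poly_growth_cong:
  assumes "poly_growth D f" "\<And>k. k \<in> D \<Longrightarrow> \<forall>\<^sub>F z in at k. f z = g z"
  shows "poly_growth D g"
proof -
  obtain c C m where f: "c \<noteq> 0" "C \<ge> 0" "\<And>k. k \<in> D \<Longrightarrow> \<forall>\<^sub>F z in at k. norm (poly c z * f z) \<le> C * (1 + norm z) ^ m"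
    using assms(1) unfolding poly_growth_def by blast
  show ?thesis
  proof (rule poly_growthI[OF f(1,2)])
    fix k assume k: "k \<in> D"
    show "\<forall>\<^sub>F z in at k. norm (poly c z * g z) \<le> C * (1 + norm z) ^ m"
      using f(3)[OF k] assms(2)[OF k] by eventually_elim simp
  qed
qed

text \<open>\<open>separator\<close> is the weight \<open>h\<close>: a product of entry differences, so that it stays polynomial in the
  entries. With \<open>adjugate\<close> in place of the inverse the same holds for \<open>trace_term\<close>.\<close>

definition distinguishing_entry :: "'a ^ 'n ^ 'n \<Rightarrow> 'a ^ 'n ^ 'n \<Rightarrow> 'n \<times> 'n" where
  "distinguishing_entry M N = (SOME e. M $ fst e $ snd e \<noteq> N $ fst e $ snd e)"

definition separator :: "('b list \<Rightarrow> 'a :: field ^ 'n ^ 'n) \<Rightarrow> 'b list set \<Rightarrow> 'a ^ 'n ^ 'n \<Rightarrow> 'a" where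
  "separator s V M = (\<Prod>v\<in>V - {[]}.
     let e = distinguishing_entry (s []) (s v) in M $ fst e $ snd e - s v $ fst e $ snd e)"

lemma separator_nonzero:
  assumes "\<And>v. v \<in> V - {[]} \<Longrightarrow> s [] \<noteq> s v" "finite V"
  shows "separator s V (s []) \<noteq> 0"
proof -
  have "s [] $ fst e $ snd e - s v $ fst e $ snd e \<noteq> 0"
    if v: "v \<in> V - {[]}" and e: "e = distinguishing_entry (s []) (s v)" for v e
  proof -
    obtain i j where "s [] $ i $ j \<noteq> s v $ i $ j" using assms(1)[OF v] by (auto simp: vec_eq_iff)
    then have "s [] $ fst (i, j) $ snd (i, j) \<noteq> s v $ fst (i, j) $ snd (i, j)" by simp
    then show ?thesis unfolding e distinguishing_entry_def right_minus_eq by (rule someI)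
  qed
  then show ?thesis unfolding separator_def using assms(2) by (simp add: Let_def)
qed

lemma separator_zero:
  assumes "v \<in> V - {[]}" "finite V"
  shows "separator s V (s v) = 0"
  unfolding separator_def using assms by (intro prod_zero) (auto simp: Let_def)

definition trace_term :: "('b list \<Rightarrow> 'a :: field ^ 'n ^ 'n) \<Rightarrow> 'b list set \<Rightarrow> 'a ^ 'n ^ 'n \<Rightarrow> 'a ^ 'n ^ 'n" where
  "trace_term s V M = mat (separator s V M) ** adjugate M"

lemma meromorphic_trace_term:
  fixes K :: "complex \<Rightarrow> complex ^ 'n ^ 'n"
  assumes "matrix_meromorphic_on K D"
  shows "matrix_meromorphic_on (\<lambda>z. trace_term s V (K z)) D"
proof -
  have e: "(\<lambda>z. K z $ i $ j) meromorphic_on D" for i j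
    using assms by (simp add: matrix_meromorphic_on_def)
  have "(\<lambda>z. separator s V (K z)) meromorphic_on D"
    unfolding separator_def Let_def by (intro meromorphic_intros e)
  moreover have "(\<lambda>z. adjugate (K z) $ k $ j) meromorphic_on D" for k j
    unfolding adjugate_def vec_lambda_beta
  proof (intro meromorphic_on_det, unfold matrix_meromorphic_on_def vec_lambda_beta, intro allI)
    show "(\<lambda>z. if j' = k then if i = j then 1 else 0 else K z $ i $ j') meromorphic_on D" for i j'
      using e by (cases "j' = k") auto
  qed
  ultimately show ?thesis
    unfolding matrix_meromorphic_on_def trace_term_def mat_component by (intro allI meromorphic_on_mult)
qed

lemma analytic_trace_term:
  fixes K :: "complex \<Rightarrow> complex ^ 'n ^ 'n"
  assumes e: "\<And>i j. (\<lambda>z. K z $ i $ j) analytic_on D"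
  shows "(\<lambda>z. trace_term s V (K z) $ i $ j) analytic_on D"
proof -
  have "(\<lambda>z. separator s V (K z)) analytic_on D"
    unfolding separator_def Let_def by (intro analytic_intros e)
  moreover have "(\<lambda>z. adjugate (K z) $ k $ j) analytic_on D" for k j
    unfolding adjugate_def vec_lambda_beta
  proof (intro analytic_on_det, unfold vec_lambda_beta)
    show "(\<lambda>z. if j' = k then if i = j then 1 else 0 else K z $ i $ j') analytic_on D" for i j'
      using e by (cases "j' = k") auto
  qed
  ultimately show ?thesis
    unfolding trace_term_def mat_component by (intro analytic_on_mult)
qed

lemma poly_growth_trace_term:
  fixes K :: "complex \<Rightarrow> complex ^ 'n ^ 'n"
  assumes e: "\<And>i j. poly_growth D (\<lambda>z. K z $ i $ j)"
  shows "poly_growth D (\<lambda>z. trace_term s V (K z) $ i $ j)"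
proof -
  have "poly_growth D (\<lambda>z. separator s V (K z))"
    unfolding separator_def Let_def by (intro poly_growth_prod poly_growth_diff poly_growth_const e)
  moreover have "poly_growth D (\<lambda>z. adjugate (K z) $ k $ j)" for k j
    unfolding adjugate_def vec_lambda_beta
  proof (intro poly_growth_det, unfold vec_lambda_beta)
    show "poly_growth D (\<lambda>z. if j' = k then if i = j then 1 else 0 else K z $ i $ j')" for i j'
      using e poly_growth_const by (cases "j' = k") auto
  qed
  ultimately show ?thesis
    unfolding trace_term_def mat_component by (intro poly_growth_mult)
qed

section \<open>The sheets of a bypass-commutative matrix and the twisting factor\<close>

locale bypass_commuting = branched p q \<gamma> G \<epsilon>
  for p q :: nat and \<gamma> :: "letter \<Rightarrow> real \<Rightarrow> complex" and G :: "complex \<Rightarrow> complex ^ 'n ^ 'n" and \<epsilon> :: real +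
  assumes alg: "algebraic_matrix_on G (strip \<epsilon>)"
    and nondeg: "\<not> (\<forall>\<^sub>\<approx>k\<in>strip \<epsilon>. det (G k) = 0)"
    and comm: "bypass_commutative G"
begin

lemma open_strip: "open (strip \<epsilon>)" and connected_strip: "connected (strip \<epsilon>)"
proof -
  have s: "strip \<epsilon> = {z. Im z < \<epsilon>} \<inter> {z. Im z > - \<epsilon>}" unfolding strip_def by (auto simp: abs_less_iff)
  show "open (strip \<epsilon>)" unfolding s by (intro open_Int open_halfspace_Im_lt open_halfspace_Im_gt)
  have "convex (strip \<epsilon>)" unfolding s by (intro convex_Int convex_halfspace_Im_lt convex_halfspace_Im_gt)
  then show "connected (strip \<epsilon>)" by (rule convex_connected)
qed

lemma sheet_continuation:
  assumes "w \<in> words" "k \<in> cut_plane"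
  obtains c where "path c" "Im (pathstart c) = 0" "pathfinish c = k" "continuation G c (sheet w)"
proof -
  obtain c where c: "path c" "path_image c \<subseteq> cut_plane" "pathstart c = 0" "pathfinish c = k"
    by (rule cut_plane_path[OF real_in_cut_plane[of 0] assms(2)]) auto
  obtain g where g: "word_loop w k g" using word_loop_exists[OF assms] by blast
  have "continuation G (c +++ g) (sheet w)"
    using is_branch_sheet[OF assms(1)] assms(2) c g unfolding is_branch_def by auto
  then show ?thesis using that[of "c +++ g"] c word_loop_path[OF g] by simp
qed

text \<open>The determinant of a sheet vanishes identically or at isolated points only. In the first
  case, running the continuation back to the real axis would give a real point near which det G
  vanishes, against \<open>nondeg\<close>.\<close>

lemma det_sheet:
  assumes w: "w \<in> words" and k: "k \<in> cut_plane"
  shows "\<forall>\<^sub>F z in at k. det (sheet w z) \<noteq> 0"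
proof (rule ccontr)
  assume neg: "\<not> (\<forall>\<^sub>F z in at k. det (sheet w z) \<noteq> 0)"
  have "(\<lambda>z. det (sheet w z)) meromorphic_on cut_plane"
    by (rule meromorphic_on_det[OF meromorphic_sheet[OF w]])
  from meromorphic_imp_constant_or_avoid[OF this open_cut_plane connected_cut_plane, of 0]
  have z: "\<forall>\<^sub>F z in at k. det (sheet w z) = 0"
    using neg k unfolding eventually_cosparse_open_eq[OF open_cut_plane] by blast
  obtain c where c: "path c" "Im (pathstart c) = 0" "pathfinish c = k" "continuation G c (sheet w)"
    by (rule sheet_continuation[OF w k]) blast
  \<comment> \<open>Continuation is defined for matrices, so the scalar is carried along as a matrix
    with all entries equal.\<close>
  define \<Psi> :: "complex ^ 'n ^ 'n \<Rightarrow> complex ^ 'n ^ 'n" where "\<Psi> M = (\<chi> i j. det M)" for M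
  have m: "matrix_meromorphic_on (\<lambda>k. \<Psi> (K k)) {z}" if "matrix_meromorphic_on K {z}" for K z
    using meromorphic_on_det[OF that] by (simp add: \<Psi>_def matrix_meromorphic_on_def)
  have 1: "continuation (\<lambda>k. \<Psi> (G k)) c (\<lambda>k. \<Psi> (sheet w k))"
    by (rule continuation_map[OF c(4) m])
  have 2: "continuation (\<lambda>_. 0) c (\<lambda>_. 0 :: complex ^ 'n ^ 'n)"
    by (rule continuation_const) (simp add: matrix_meromorphic_on_def meromorphic_on_const)
  have "\<forall>\<^sub>F z in at (pathfinish c). \<Psi> (sheet w z) = 0"
    using z unfolding c(3) by eventually_elim (simp add: \<Psi>_def vec_eq_iff)
  from continuation_unique_start[OF 1 2 c(1) this]
  have "\<forall>\<^sub>F z in at (pathstart c). det (G z) = 0"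
    by eventually_elim (simp add: \<Psi>_def vec_eq_iff)
  moreover have "\<forall>\<^sub>\<approx>z\<in>strip \<epsilon>. det (G z) \<noteq> 0"
    using meromorphic_imp_constant_or_avoid[OF meromorphic_on_det[OF mero] open_strip connected_strip, of 0] nondeg
    by blast
  then have "\<forall>\<^sub>F z in at (pathstart c). det (G z) \<noteq> 0"
    using real_strip[OF c(2)] by (simp add: eventually_cosparse_open_eq open_strip)
  ultimately have "\<forall>\<^sub>F z in at (pathstart c). False" by eventually_elim simp
  then show False by simp
qed

lemma meromorphic_poly_poly:
  fixes P :: "complex poly poly"
  assumes f: "f meromorphic_on D" and D: "open D"
  shows "(\<lambda>z. poly (poly P [:f z:]) z) meromorphic_on D"
proof -
  have "(\<lambda>z. poly c z) meromorphic_on D" for c :: "complex poly"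
  proof -
    have "(\<lambda>z. poly c z) holomorphic_on D" by (intro holomorphic_intros)
    then show ?thesis using D by (intro analytic_on_imp_meromorphic_on) (simp add: analytic_on_open)
  qed
  then show ?thesis unfolding poly_poly_const using f by (intro meromorphic_intros)
qed

text \<open>Polynomial relations on the strip are identities between meromorphic germs and survive
  continuation, so the same polynomials serve for all sheets. This bounds both the number of sheets
  and their growth.\<close>

lemma sheet_algebraic:
  obtains P :: "'n \<Rightarrow> 'n \<Rightarrow> complex poly poly" where "\<And>i j. P i j \<noteq> 0"
    "\<And>i j w k. w \<in> words \<Longrightarrow> k \<in> cut_plane \<Longrightarrow> \<forall>\<^sub>F z in at k. poly (poly (P i j) [:sheet w z $ i $ j:]) z = 0"
proof -
  define R :: "'n \<Rightarrow> 'n \<Rightarrow> complex poly poly \<Rightarrow> bool" where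
    "R i j P \<longleftrightarrow> P \<noteq> 0 \<and> (\<forall>\<^sub>\<approx>k\<in>strip \<epsilon>. poly (poly P [:G k $ i $ j:]) k = 0)" for i j P
  have "\<exists>P. R i j P" for i j
    using alg unfolding algebraic_matrix_on_def R_def by blast
  then obtain P where "\<And>i j. R i j (P i j)" by metis
  then have P: "\<And>i j. P i j \<noteq> 0"
    "\<And>i j. \<forall>\<^sub>\<approx>k\<in>strip \<epsilon>. poly (poly (P i j) [:G k $ i $ j:]) k = 0"
    unfolding R_def by blast+
  show ?thesis
  proof (rule that[of P, OF P(1)])
    fix i j w k assume w: "w \<in> words" "k \<in> cut_plane"
    obtain c where c: "path c" "Im (pathstart c) = 0" "pathfinish c = k" "continuation G c (sheet w)"
      by (rule sheet_continuation[OF w]) blast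
    define \<Psi> :: "complex \<Rightarrow> complex ^ 'n ^ 'n \<Rightarrow> complex ^ 'n ^ 'n"
      where "\<Psi> z M = (\<chi> i' j'. poly (poly (P i j) [:M $ i $ j:]) z)" for z M
    have m: "matrix_meromorphic_on (\<lambda>k. \<Psi> k (K k)) {z}" if K: "matrix_meromorphic_on K {z}" for K z
    proof -
      obtain r where r: "r > 0" "matrix_meromorphic_on K (ball z r)" by (rule matrix_meromorphic_on_nhd[OF K]) blast
      have "(\<lambda>z. poly (poly (P i j) [:K z $ i $ j:]) z) meromorphic_on ball z r"
        using r(2) by (intro meromorphic_poly_poly) (auto simp: matrix_meromorphic_on_def)
      then have "(\<lambda>z. poly (poly (P i j) [:K z $ i $ j:]) z) meromorphic_on {z}"
        by (rule meromorphic_on_subset) (use r(1) in simp)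
      then show ?thesis by (simp add: \<Psi>_def matrix_meromorphic_on_def)
    qed
    have 1: "continuation (\<lambda>k. \<Psi> k (G k)) c (\<lambda>k. \<Psi> k (sheet w k))"
      by (rule continuation_map[OF c(4) m])
    have 2: "continuation (\<lambda>_. 0) c (\<lambda>_. 0 :: complex ^ 'n ^ 'n)"
      by (rule continuation_const) (simp add: matrix_meromorphic_on_def meromorphic_on_const)
    have "\<forall>\<^sub>F z in at (pathstart c). poly (poly (P i j) [:G z $ i $ j:]) z = 0"
      using P(2)[of i j] real_strip[OF c(2)] by (simp add: eventually_cosparse_open_eq open_strip)
    then have "\<forall>\<^sub>F z in at (pathstart c). \<Psi> z (G z) = 0"
      by eventually_elim (simp add: \<Psi>_def vec_eq_iff)
    from continuation_unique[OF 1 2 c(1) this]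
    show "\<forall>\<^sub>F z in at k. poly (poly (P i j) [:sheet w z $ i $ j:]) z = 0"
      unfolding c(3) by eventually_elim (simp add: \<Psi>_def vec_eq_iff)
  qed
qed

lemma same_sheet_iff:
  assumes "v \<in> words" "w \<in> words"
  shows "same_sheet G v w \<longleftrightarrow> (\<forall>k\<in>cut_plane. \<forall>\<^sub>F z in at k. sheet v z = sheet w z)"
proof -
  have "(\<forall>\<^sub>F z in at k. branch G v z = branch G w z) \<longleftrightarrow> (\<forall>\<^sub>F z in at k. sheet v z = sheet w z)"
    if "k \<in> cut_plane" for k
  proof -
    have "\<forall>\<^sub>F z in at k. (branch G v z = branch G w z) \<longleftrightarrow> (sheet v z = sheet w z)"
      using branch_sheet[OF assms(1) that] branch_sheet[OF assms(2) that] by eventually_elim simp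
    then show ?thesis by (rule eventually_subst)
  qed
  then show ?thesis unfolding same_sheet_def eventually_cosparse_open_eq[OF open_cut_plane] by blast
qed

lemma same_sheetI:
  assumes "v \<in> words" "w \<in> words" "k \<in> cut_plane" "\<exists>\<^sub>F z in at k. sheet v z = sheet w z"
  shows "same_sheet G v w"
  unfolding same_sheet_iff[OF assms(1,2)]
  using matrix_meromorphic_eqI[OF meromorphic_sheet[OF assms(1)] meromorphic_sheet[OF assms(2)]
      open_cut_plane connected_cut_plane assms(3,4)] by blast

lemma same_sheet_refl: "same_sheet G v v"
  unfolding same_sheet_def by simp

lemma same_sheet_sym: "same_sheet G v w \<Longrightarrow> same_sheet G w v"
  unfolding same_sheet_def by (auto elim: eventually_mono)

lemma same_sheet_trans: "same_sheet G u v \<Longrightarrow> same_sheet G v w \<Longrightarrow> same_sheet G u w"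
  unfolding same_sheet_def by (drule (1) eventually_conj, erule eventually_mono) simp

lemma different_sheets:
  assumes "v \<in> words" "w \<in> words" "k \<in> cut_plane" "\<not> same_sheet G v w"
  shows "\<forall>\<^sub>F z in at k. sheet v z \<noteq> sheet w z"
  using same_sheetI[OF assms(1-3)] assms(4) by (auto simp: frequently_def)

text \<open>At a generic point the sheets are distinct matrices whose entries are roots of fixed polynomials.\<close>

lemma sheets_bounded:
  obtains m where "\<And>V. finite V \<Longrightarrow> V \<subseteq> words \<Longrightarrow> (\<And>v w. v \<in> V \<Longrightarrow> w \<in> V \<Longrightarrow> v \<noteq> w \<Longrightarrow> \<not> same_sheet G v w) \<Longrightarrow> card V \<le> m"
proof -
  obtain P :: "'n \<Rightarrow> 'n \<Rightarrow> complex poly poly" where P: "\<And>i j. P i j \<noteq> 0"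
    "\<And>i j w k. w \<in> words \<Longrightarrow> k \<in> cut_plane \<Longrightarrow> \<forall>\<^sub>F z in at k. poly (poly (P i j) [:sheet w z $ i $ j:]) z = 0"
    by (rule sheet_algebraic) blast
  define m where "m = (\<Prod>(i, j)\<in>UNIV. degree (P i j))"
  have "card V \<le> m" if V: "finite V" "V \<subseteq> words" "\<And>v w. v \<in> V \<Longrightarrow> w \<in> V \<Longrightarrow> v \<noteq> w \<Longrightarrow> \<not> same_sheet G v w" for V
  proof -
    have k: "0 \<in> cut_plane" by (rule real_in_cut_plane) simp
    have "\<forall>\<^sub>F z in at 0. \<forall>v\<in>V. \<forall>w\<in>V. v \<noteq> w \<longrightarrow> sheet v z \<noteq> sheet w z"
    proof (intro eventually_ball_finite V ballI)
      fix v w assume vw: "v \<in> V" "w \<in> V"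
      show "\<forall>\<^sub>F z in at 0. v \<noteq> w \<longrightarrow> sheet v z \<noteq> sheet w z"
      proof (cases "v = w")
        case False
        then show ?thesis using different_sheets[OF _ _ k, of v w] V(2,3) vw by auto
      qed simp
    qed
    moreover have "\<forall>\<^sub>F z in at 0. \<forall>v\<in>V. \<forall>i j. poly (poly (P i j) [:sheet v z $ i $ j:]) z = 0"
      using V(1,2) P(2)[OF _ k] by (intro eventually_ball_finite ballI eventually_all_finite) auto
    \<comment> \<open>Keeps the polynomials \<open>Q i j\<close>, specialised at \<open>z\<close>
      below, nonzero, so that each has at most as many roots as the degree of
      \<open>P i j\<close>.\<close>
    moreover have "\<forall>\<^sub>F z in at 0. \<forall>i j. poly (lead_coeff (P i j)) z \<noteq> 0"
      using P(1) by (intro eventually_all_finite poly_nonzero_eventually) simp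
    ultimately have "\<forall>\<^sub>F z in at 0. (\<forall>v\<in>V. \<forall>w\<in>V. v \<noteq> w \<longrightarrow> sheet v z \<noteq> sheet w z) \<and>
        (\<forall>v\<in>V. \<forall>i j. poly (poly (P i j) [:sheet v z $ i $ j:]) z = 0) \<and> (\<forall>i j. poly (lead_coeff (P i j)) z \<noteq> 0)"
      by eventually_elim blast
    from eventually_happens'[OF at_neq_bot this] obtain z where zz: "(\<forall>v\<in>V. \<forall>w\<in>V. v \<noteq> w \<longrightarrow> sheet v z \<noteq> sheet w z) \<and>
        (\<forall>v\<in>V. \<forall>i j. poly (poly (P i j) [:sheet v z $ i $ j:]) z = 0) \<and> (\<forall>i j. poly (lead_coeff (P i j)) z \<noteq> 0)"
      by (rule exE)
    have z: "sheet v z \<noteq> sheet w z" if "v \<in> V" "w \<in> V" "v \<noteq> w" for v w using zz that by blast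
    have z2: "poly (poly (P i j) [:sheet v z $ i $ j:]) z = 0" if "v \<in> V" for v i j using zz that by blast
    have z3: "poly (lead_coeff (P i j)) z \<noteq> 0" for i j using zz by blast
    define Q where "Q i j = map_poly (\<lambda>c. poly c z) (P i j)" for i j
    have cQ: "coeff (Q i j) r = poly (coeff (P i j) r) z" for i j r
      unfolding Q_def by (simp add: coeff_map_poly)
    have Q0: "Q i j \<noteq> 0" for i j
      using z3[of i j] cQ[of i j "degree (P i j)"] by auto
    have dQ: "degree (Q i j) \<le> degree (P i j)" for i j by (rule degree_le) (simp add: cQ coeff_eq_0)
    have root: "poly (Q i j) (sheet v z $ i $ j) = 0" if "v \<in> V" for v i j
    proof -
      have "poly (Q i j) y = (\<Sum>r\<le>degree (P i j). coeff (Q i j) r * y ^ r)" for y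
        unfolding poly_altdef using dQ[of i j]
        by (intro sum.mono_neutral_left) (auto simp: coeff_eq_0)
      then show ?thesis using z2[OF that, of i j] unfolding poly_poly_const cQ by simp
    qed
    define R where "R = (\<lambda>(i, j). {y. poly (Q i j) y = 0})"
    have fR: "finite (R ij)" for ij unfolding R_def using poly_roots_finite[OF Q0] by (auto split: prod.split)
    have cR: "card (R ij) \<le> (case ij of (i, j) \<Rightarrow> degree (P i j))" for ij
      unfolding R_def using order_trans[OF card_poly_roots_bound[OF Q0] dQ] by (auto split: prod.split)
    have "card V \<le> card (Pi\<^sub>E UNIV R)"
    proof (rule card_inj_on_le)
      show "inj_on (\<lambda>v. \<lambda>(i, j). sheet v z $ i $ j) V"
      proof (rule inj_onI)
        fix v w assume vw: "v \<in> V" "w \<in> V" "(\<lambda>(i, j). sheet v z $ i $ j) = (\<lambda>(i, j). sheet w z $ i $ j)"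
        then have "sheet v z = sheet w z" by (auto simp: vec_eq_iff fun_eq_iff)
        then show "v = w" using z[OF vw(1,2)] by blast
      qed
      show "(\<lambda>v. \<lambda>(i, j). sheet v z $ i $ j) ` V \<subseteq> Pi\<^sub>E UNIV R" using root by (auto simp: R_def)
      show "finite (Pi\<^sub>E UNIV R)" using fR by (intro finite_PiE) auto
    qed
    also have "\<dots> = (\<Prod>ij\<in>UNIV. card (R ij))" by (rule card_PiE) simp
    also have "\<dots> \<le> m" unfolding m_def using cR by (intro prod_mono) auto
    finally show ?thesis .
  qed
  then show ?thesis by (rule that)
qed

text \<open>A set of words on pairwise different sheets is taken with the largest possible
  cardinality; a word on none of its sheets could be added. The empty word is kept as representative
  of the physical sheet.\<close>

lemma sheet_representatives:
  obtains V where "finite V" "V \<subseteq> words" "[] \<in> V"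
    "\<And>v w. v \<in> V \<Longrightarrow> w \<in> V \<Longrightarrow> v \<noteq> w \<Longrightarrow> \<not> same_sheet G v w"
    "\<And>w. w \<in> words \<Longrightarrow> \<exists>v\<in>V. same_sheet G w v"
proof -
  define good where "good V \<longleftrightarrow> finite V \<and> V \<subseteq> words \<and> [] \<in> V \<and>
    (\<forall>v\<in>V. \<forall>w\<in>V. v \<noteq> w \<longrightarrow> \<not> same_sheet G v w)" for V
  obtain m where m: "\<And>V. finite V \<Longrightarrow> V \<subseteq> words \<Longrightarrow>
      (\<And>v w. v \<in> V \<Longrightarrow> w \<in> V \<Longrightarrow> v \<noteq> w \<Longrightarrow> \<not> same_sheet G v w) \<Longrightarrow> card V \<le> m"
    by (rule sheets_bounded) blast
  have "card V \<le> m" if "good V" for V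
    by (rule m) (use that in \<open>auto simp: good_def\<close>)
  then have b: "\<forall>V. good V \<longrightarrow> card V < Suc m" by (simp add: less_Suc_eq_le)
  have "good {[]}" unfolding good_def using words_Nil by simp
  from ex_has_greatest_nat[of good, OF this b]
  obtain V where V: "good V" "\<And>W. good W \<Longrightarrow> card W \<le> card V" by blast
  show ?thesis
  proof (rule that[of V])
    fix w assume w: "w \<in> words"
    show "\<exists>v\<in>V. same_sheet G w v"
    proof (rule ccontr)
      assume neg: "\<not> (\<exists>v\<in>V. same_sheet G w v)"
      then have wV: "w \<notin> V" using same_sheet_refl[of w] by auto
      have ns: "\<not> same_sheet G w v" "\<not> same_sheet G v w" if "v \<in> V" for v
        using neg that same_sheet_sym[of v w] by auto
      have gV: "finite V" "V \<subseteq> words" "[] \<in> V" "\<And>v u. v \<in> V \<Longrightarrow> u \<in> V \<Longrightarrow> v \<noteq> u \<Longrightarrow> \<not> same_sheet G v u"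
        using V(1) unfolding good_def by auto
      have "good (insert w V)"
        unfolding good_def using gV(1-3) w
      proof (intro conjI ballI impI)
        fix v u assume "v \<in> insert w V" "u \<in> insert w V" "v \<noteq> u"
        then show "\<not> same_sheet G v u" using gV(4)[of v u] ns(1)[of u] ns(2)[of v] by auto
      qed auto
      then show False using gV(1) wV V(2)[of "insert w V"] by simp
    qed
  qed (use V(1) in \<open>auto simp: good_def\<close>)
qed

text \<open>Used to verify that the representatives other than the physical one form a list of the
  length demanded in \<open>basic_bypass_words\<close>.\<close>

lemma sheet_count_eq:
  assumes V: "V \<subseteq> words" "\<And>v w. v \<in> V \<Longrightarrow> w \<in> V \<Longrightarrow> v \<noteq> w \<Longrightarrow> \<not> same_sheet G v w"
    "\<And>w. w \<in> words \<Longrightarrow> \<exists>v\<in>V. same_sheet G w v"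
  shows "sheet_count G = card V"
proof -
  define R where "R = {(v, w). v \<in> words \<and> w \<in> words \<and> same_sheet G v w}"
  have "inj_on (\<lambda>v. R `` {v}) V"
  proof (rule inj_onI)
    fix v w assume vw: "v \<in> V" "w \<in> V" "R `` {v} = R `` {w}"
    have "w \<in> R `` {w}" using vw(2) V(1) same_sheet_refl by (auto simp: R_def)
    then have "same_sheet G v w" unfolding vw(3)[symmetric] by (simp add: R_def)
    then show "v = w" using V(2) vw(1,2) by blast
  qed
  moreover have "(\<lambda>v. R `` {v}) ` V = words // R"
  proof
    show "(\<lambda>v. R `` {v}) ` V \<subseteq> words // R" using V(1) unfolding quotient_def by blast
    show "words // R \<subseteq> (\<lambda>v. R `` {v}) ` V"
    proof
      fix X assume "X \<in> words // R"
      then obtain w where w: "w \<in> words" "X = R `` {w}" unfolding quotient_def by blast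
      obtain v where v: "v \<in> V" "same_sheet G w v" using V(3)[OF w(1)] by blast
      have "R `` {w} = R `` {v}"
        using v w(1) V(1) same_sheet_trans same_sheet_sym unfolding R_def by blast
      then show "X \<in> (\<lambda>v. R `` {v}) ` V" using v(1) w(2) by blast
    qed
  qed
  ultimately have "card V = card (words // R)" by (metis card_image)
  then show ?thesis unfolding sheet_count_def R_def by simp
qed

text \<open>Balance replaces each representative by a word in lower letters on the same sheet.
  Without the physical one these words are a system of basic bypass words, whose matrices commute by
  hypothesis; the physical sheet contributes the identity matrix.\<close>

lemma representatives_commute:
  assumes V: "finite V" "V \<subseteq> words" "[] \<in> V" "\<And>v w. v \<in> V \<Longrightarrow> w \<in> V \<Longrightarrow> v \<noteq> w \<Longrightarrow> \<not> same_sheet G v w"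
    "\<And>w. w \<in> words \<Longrightarrow> \<exists>v\<in>V. same_sheet G w v"
    and vw: "v \<in> V" "w \<in> V" and k: "k \<in> cut_plane"
  shows "\<forall>\<^sub>F z in at k. (sheet v z ** matrix_inv (sheet [] z)) ** (sheet w z ** matrix_inv (sheet [] z)) =
    (sheet w z ** matrix_inv (sheet [] z)) ** (sheet v z ** matrix_inv (sheet [] z))"
proof -
  have wb: "words_b \<subseteq> words" unfolding words_b_def words_def letters_def by (intro lists_mono) auto
  have "\<exists>u\<in>words_b. same_sheet G u v" if "v \<in> V" for v
    using comm that V(2) unfolding bypass_commutative_def balanced_def by blast
  then obtain \<beta> where \<beta>: "\<And>v. v \<in> V \<Longrightarrow> \<beta> v \<in> words_b" "\<And>v. v \<in> V \<Longrightarrow> same_sheet G (\<beta> v) v"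
    by metis
  obtain vs where vs: "set vs = V - {[]}" "distinct vs"
    using finite_distinct_list[of "V - {[]}"] V(1) by blast
  define ws where "ws = map \<beta> vs"
  have inV: "vs ! i \<in> V" "vs ! i \<noteq> []" if "i < length vs" for i
    using nth_mem[OF that] vs(1) by auto
  have len: "length ws = length vs" by (simp add: ws_def)
  have nth: "ws ! i = \<beta> (vs ! i)" if "i < length ws" for i using that by (simp add: ws_def)
  have "basic_bypass_words G ws"
    unfolding basic_bypass_words_def
  proof (intro conjI allI impI)
    have "length vs = card (V - {[]})" using distinct_card[OF vs(2)] vs(1) by simp
    then show "length ws = sheet_count G - 1"
      using sheet_count_eq[OF V(2,4,5)] V(1,3) len by simp
    show "set ws \<subseteq> words_b" using \<beta>(1) vs(1) by (auto simp: ws_def)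
    fix i assume i: "i < length ws"
    note iV = inV[of i, folded len, OF i]
    show "\<not> same_sheet G (ws ! i) []"
      using V(4)[OF iV(1) V(3) iV(2)] same_sheet_trans[OF same_sheet_sym[OF \<beta>(2)[OF iV(1)]]]
      unfolding nth[OF i] by blast
    fix j assume j: "j < length ws" "i \<noteq> j"
    note jV = inV[of j, folded len, OF j(1)]
    have "vs ! i \<noteq> vs ! j" using vs(2) i j len by (simp add: nth_eq_iff_index_eq)
    then have ns: "\<not> same_sheet G (vs ! i) (vs ! j)" using V(4) iV(1) jV(1) by blast
    show "\<not> same_sheet G (ws ! i) (ws ! j)"
    proof
      assume "same_sheet G (ws ! i) (ws ! j)"
      then have "same_sheet G (\<beta> (vs ! i)) (\<beta> (vs ! j))" unfolding nth[OF i] nth[OF j(1)] .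
      then show False
        using ns same_sheet_trans same_sheet_sym \<beta>(2)[OF iV(1)] \<beta>(2)[OF jV(1)] by blast
    qed
  qed
  then have C: "\<forall>\<^sub>\<approx>z\<in>cut_plane. bypass_matrix G (ws ! i) z ** bypass_matrix G (ws ! j) z =
      bypass_matrix G (ws ! j) z ** bypass_matrix G (ws ! i) z" if "i < length ws" "j < length ws" for i j
    using comm that unfolding bypass_commutative_def by blast
  have inv1: "\<forall>\<^sub>F z in at k. sheet [] z ** matrix_inv (sheet [] z) = mat 1"
    using det_sheet[OF words_Nil k] by eventually_elim (rule matrix_inv)
  have bm: "\<forall>\<^sub>F z in at k. bypass_matrix G (\<beta> u) z = sheet u z ** matrix_inv (sheet [] z)" if u: "u \<in> V" for u
  proof -
    have w: "u \<in> words" "\<beta> u \<in> words" using u V(2) \<beta>(1) wb by auto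
    have "\<forall>\<^sub>F z in at k. sheet (\<beta> u) z = sheet u z"
      using \<beta>(2)[OF u] k unfolding same_sheet_iff[OF w(2,1)] by blast
    with branch_sheet[OF w(2) k] branch_sheet[OF words_Nil k] show ?thesis
      by eventually_elim (simp add: bypass_matrix_def)
  qed
  show ?thesis
  proof (cases "v = [] \<or> w = []")
    case True
    then show ?thesis using inv1 by (auto elim: eventually_mono)
  next
    case False
    then have "v \<in> set vs" "w \<in> set vs" using vs(1) vw by auto
    then obtain i j where ij: "i < length vs" "vs ! i = v" "j < length vs" "vs ! j = w"
      unfolding in_set_conv_nth by blast
    then have n: "ws ! i = \<beta> v" "ws ! j = \<beta> w" using nth len by auto
    have "\<forall>\<^sub>F z in at k. bypass_matrix G (\<beta> v) z ** bypass_matrix G (\<beta> w) z =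
      bypass_matrix G (\<beta> w) z ** bypass_matrix G (\<beta> v) z"
      using C[of i j] ij len n k unfolding eventually_cosparse_open_eq[OF open_cut_plane] by simp
    with bm[OF vw(1)] bm[OF vw(2)] show ?thesis by eventually_elim simp
  qed
qed

text \<open>A bypass sends each sheet to a sheet, and different sheets to different ones because
  continuation is reversible; on the finite set \<open>V\<close> this is a permutation.
  \<open>s\<close> and \<open>U\<close> are constants, so one and the same function of the matrix is
  summed over all sheets, and the sum does not change.\<close>

lemma trace_trivial_monodromy:
  assumes V: "finite V" "V \<subseteq> words" "\<And>v w. v \<in> V \<Longrightarrow> w \<in> V \<Longrightarrow> v \<noteq> w \<Longrightarrow> \<not> same_sheet G v w"
    "\<And>w. w \<in> words \<Longrightarrow> \<exists>v\<in>V. same_sheet G w v"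
  shows "trivial_monodromy (\<lambda>z. \<Sum>v\<in>V. trace_term s U (sheet v z))"
proof -
  define \<Psi> where "\<Psi> = (\<lambda>(k :: complex) M. \<Sum>v\<in>V. trace_term s U (M v))"
  have m\<Psi>: "matrix_meromorphic_on (\<lambda>k. \<Psi> k (\<lambda>v. K v k)) D"
    if K: "\<And>v. v \<in> V \<Longrightarrow> matrix_meromorphic_on (K v) D" for K D
    unfolding \<Psi>_def matrix_meromorphic_on_def sum_component
  proof (intro allI meromorphic_on_sum)
    fix i j v assume "v \<in> V"
    from meromorphic_trace_term[OF K[OF this], of s U]
    show "(\<lambda>z. trace_term s U (K v z) $ i $ j) meromorphic_on D"
      unfolding matrix_meromorphic_on_def by blast
  qed
  have cont: "continuation (\<lambda>k. \<Psi> k (\<lambda>v. sheet v k)) g (\<lambda>k. \<Psi> k (\<lambda>v. H v k))"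
    if "\<And>v. v \<in> V \<Longrightarrow> continuation (sheet v) g (H v)" for g H
    by (rule continuation_combine[OF V(1) that m\<Psi>]) (auto simp: \<Psi>_def intro!: sum.cong)
  have "\<exists>H. continuation (\<lambda>k. \<Psi> k (\<lambda>v. sheet v k)) g H"
    if g: "path g" "path_image g \<subseteq> base" "pathstart g \<in> cut_plane" for g
  proof -
    have "\<exists>H. continuation (sheet v) g H" if "v \<in> V" for v
      using contble_sheet[of v] V(2) that g unfolding contble_def by blast
    then obtain H where "\<And>v. v \<in> V \<Longrightarrow> continuation (sheet v) g (H v)" by metis
    from cont[OF this] show ?thesis by blast
  qed
  moreover have "matrix_meromorphic_on (\<lambda>k. \<Psi> k (\<lambda>v. sheet v k)) cut_plane"
    using V(2) by (intro m\<Psi> meromorphic_sheet) auto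
  ultimately have "contble (\<lambda>k. \<Psi> k (\<lambda>v. sheet v k))" unfolding contble_def by blast
  moreover have "continuation (\<lambda>k. \<Psi> k (\<lambda>v. sheet v k)) g (\<lambda>k. \<Psi> k (\<lambda>v. sheet v k))"
    if l: "l \<in> letters" and k: "k \<in> cut_plane" and g: "slit_loop l k g" for l k g
  proof -
    have words: "v \<in> words" "v @ [l] \<in> words" if "v \<in> V" for v
      using V(2) that l by (auto simp: words_append words_Cons words_Nil)
    have c: "continuation (sheet v) g (sheet (v @ [l]))" if "v \<in> V" for v
      by (rule sheet_snoc[OF words(1)[OF that] l k g])
    have pg: "path g" "pathstart g = k" "pathfinish g = k" using g by (auto simp: slit_loop_def)
    have "\<exists>u\<in>V. same_sheet G (v @ [l]) u" if "v \<in> V" for v using V(4) words(2)[OF that] by blast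
    then obtain \<pi> where \<pi>: "\<And>v. v \<in> V \<Longrightarrow> \<pi> v \<in> V" "\<And>v. v \<in> V \<Longrightarrow> same_sheet G (v @ [l]) (\<pi> v)" by metis
    have ev: "\<forall>\<^sub>F z in at k. sheet (v @ [l]) z = sheet (\<pi> v) z" if "v \<in> V" for v
      using \<pi>(2)[OF that] k unfolding same_sheet_iff[OF words(2)[OF that] words(1)[OF \<pi>(1)[OF that]]] by blast
    have "inj_on \<pi> V"
    proof (rule inj_onI)
      fix v w assume vw: "v \<in> V" "w \<in> V" "\<pi> v = \<pi> w"
      have "\<forall>\<^sub>F z in at (pathfinish g). sheet (v @ [l]) z = sheet (w @ [l]) z"
        unfolding pg(3) using ev[OF vw(1)] ev[OF vw(2)] by eventually_elim (simp add: vw(3))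
      from continuation_unique_start[OF c[OF vw(1)] c[OF vw(2)] pg(1) this]
      have "\<exists>\<^sub>F z in at k. sheet v z = sheet w z" unfolding pg(2) by (simp add: eventually_frequently)
      then have "same_sheet G v w" by (rule same_sheetI[OF words(1)[OF vw(1)] words(1)[OF vw(2)] k])
      then show "v = w" using V(3) vw(1,2) by blast
    qed
    then have "bij_betw \<pi> V V"
      using endo_inj_surj[OF V(1), of \<pi>] \<pi>(1) unfolding bij_betw_def by blast
    then have reindex: "(\<Sum>v\<in>V. trace_term s U (sheet (\<pi> v) z)) = (\<Sum>v\<in>V. trace_term s U (sheet v z))" for z
      by (rule sum.reindex_bij_betw)
    have "\<forall>\<^sub>F z in at k. \<forall>v\<in>V. sheet (v @ [l]) z = sheet (\<pi> v) z"
      using ev V(1) by (simp add: eventually_ball_finite)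
    then have "\<forall>\<^sub>F z in at k. \<Psi> z (\<lambda>v. sheet (v @ [l]) z) = \<Psi> z (\<lambda>v. sheet v z)"
      by eventually_elim (simp add: \<Psi>_def reindex)
    then show ?thesis
      using continuation_cong[OF cont[OF c]] pg(3) by simp
  qed
  ultimately show ?thesis unfolding trivial_monodromy_def \<Psi>_def by blast
qed

lemma poly_growth_sheet:
  assumes w: "w \<in> words"
  shows "poly_growth cut_plane (\<lambda>z. sheet w z $ i $ j)"
proof -
  obtain P :: "'n \<Rightarrow> 'n \<Rightarrow> complex poly poly" where P: "\<And>i j. P i j \<noteq> 0"
    "\<And>i j w k. w \<in> words \<Longrightarrow> k \<in> cut_plane \<Longrightarrow> \<forall>\<^sub>F z in at k. poly (poly (P i j) [:sheet w z $ i $ j:]) z = 0"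
    by (rule sheet_algebraic) blast
  show ?thesis by (rule poly_growth_algebraic[OF P]) (use w in auto)
qed

text \<open>Trivial monodromy gives a meromorphic extension to the plane without the finitely many
  affixes; with polynomial growth near the points of the dense cut plane each entry is
  rational.\<close>

lemma trivial_monodromy_rational:
  fixes K :: "complex \<Rightarrow> complex ^ 'n ^ 'n"
  assumes K: "trivial_monodromy K" and gr: "\<And>i j. poly_growth cut_plane (\<lambda>z. K z $ i $ j)"
  obtains S where "rational_matrix S" "\<And>k. k \<in> cut_plane \<Longrightarrow> \<forall>\<^sub>F z in at k. S z = K z"
proof -
  obtain H where H: "matrix_meromorphic_on H base" "\<And>k. k \<in> cut_plane \<Longrightarrow> \<forall>\<^sub>F z in at k. H z = K z"
    by (rule trivial_monodromy_extends[OF K]) blast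
  define Q where "Q i j r s \<longleftrightarrow> s \<noteq> 0 \<and> (\<forall>k\<in>cut_plane. \<forall>\<^sub>F z in at k. H z $ i $ j = poly r z / poly s z)"
    for i j and r s :: "complex poly"
  have "\<exists>r s. Q i j r s" for i j
  proof -
    have gH: "poly_growth cut_plane (\<lambda>z. H z $ i $ j)"
    proof (rule poly_growth_cong[OF gr])
      fix k assume "k \<in> cut_plane"
      from H(2)[OF this] show "\<forall>\<^sub>F z in at k. K z $ i $ j = H z $ i $ j" by eventually_elim simp
    qed
    have mH: "(\<lambda>z. H z $ i $ j) meromorphic_on - \<tau> ` letters"
      using H(1) unfolding matrix_meromorphic_on_def base_def by blast
    have fin: "finite (\<tau> ` letters)" using finite_letters by simp
    have sub: "cut_plane \<subseteq> - \<tau> ` letters" using cut_plane_subset_base unfolding base_def .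
    show ?thesis
      by (rule poly_growth_imp_rational[OF fin mH gH sub cut_plane_dense]) (unfold Q_def, blast+)
  qed
  then obtain r s where rs: "\<And>i j. Q i j (r i j) (s i j)" by metis
  define S where "S z = (\<chi> i j. poly (r i j) z / poly (s i j) z)" for z
  show ?thesis
  proof (rule that[of S])
    show "rational_matrix S"
      unfolding rational_matrix_def S_def using rs unfolding Q_def by (auto intro!: exI)
    fix k assume k: "k \<in> cut_plane"
    have "\<forall>\<^sub>F z in at k. \<forall>i j. H z $ i $ j = poly (r i j) z / poly (s i j) z"
      using rs k unfolding Q_def by (intro eventually_all_finite) auto
    with H(2)[OF k] show "\<forall>\<^sub>F z in at k. S z = K z"
      by eventually_elim (simp add: S_def vec_eq_iff)
  qed
qed

lemma rational_matrix_meromorphic: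
  assumes "rational_matrix S"
  shows "matrix_meromorphic_on S D"
proof -
  have pm: "(\<lambda>z. poly c z) meromorphic_on UNIV" for c :: "complex poly"
  proof -
    have "(\<lambda>z. poly c z) holomorphic_on UNIV" by (intro holomorphic_intros)
    then show ?thesis by (intro analytic_on_imp_meromorphic_on) (simp add: analytic_on_open)
  qed
  have "(\<lambda>z. S z $ i $ j) meromorphic_on UNIV" for i j
  proof -
    obtain r s where "\<And>k. S k $ i $ j = poly r k / poly s k"
      using assms unfolding rational_matrix_def by blast
    then show ?thesis using meromorphic_on_divide[OF pm[of r] pm[of s]] by simp
  qed
  then show ?thesis unfolding matrix_meromorphic_on_def using meromorphic_on_subset by blast
qed

text \<open>A rational matrix continues to itself along every path, so multiplying a sheet of
  \<open>G\<close> by \<open>S\<close> gives a branch of the product; uniqueness identifies it with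
  the chosen \<open>branch\<close>.\<close>

lemma branch_mult:
  assumes S: "rational_matrix S" and w: "w \<in> words" and k: "k \<in> cut_plane"
  shows "\<forall>\<^sub>F z in at k. branch (\<lambda>k. G k ** S k) w z = sheet w z ** S z"
proof (rule branch_eq[OF _ w k])
  have m: "matrix_meromorphic_on (\<lambda>k. K k ** S k) D" if "matrix_meromorphic_on K D" for K D
    by (rule matrix_meromorphic_on_mult[OF that rational_matrix_meromorphic[OF S]])
  show "is_branch (\<lambda>k. G k ** S k) w (\<lambda>z. sheet w z ** S z)"
    unfolding is_branch_def
  proof (intro conjI ballI allI impI)
    show "matrix_meromorphic_on (\<lambda>z. sheet w z ** S z) cut_plane" by (rule m[OF meromorphic_sheet[OF w]])
    fix k c g
    assume "k \<in> cut_plane" "path c \<and> path_image c \<subseteq> cut_plane \<and> Im (pathstart c) = 0 \<and> pathfinish c = k \<and> word_loop w k g"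
    then have "continuation G (c +++ g) (sheet w)"
      using is_branch_sheet[OF w] unfolding is_branch_def by blast
    then show "continuation (\<lambda>k. G k ** S k) (c +++ g) (\<lambda>z. sheet w z ** S z)"
      using m by (rule continuation_map)
  qed
qed

text \<open>The weight is made from the values of the sheets at one generic point \<open>z0\<close>,
  where all are analytic and the physical one is invertible and different from the others. At
  \<open>z0\<close> the terms of the other sheets vanish, and what remains is a nonzero multiple of
  the inverse of the physical value.\<close>

lemma twisted_branch_commutative:
  "\<exists>S. rational_matrix S \<and> \<not> (\<forall>\<^sub>\<approx>k. det (S k) = 0) \<and> branch_commutative (\<lambda>k. G k ** S k)"
proof -
  obtain V where V: "finite V" "V \<subseteq> words" "[] \<in> V"
    "\<And>v w. v \<in> V \<Longrightarrow> w \<in> V \<Longrightarrow> v \<noteq> w \<Longrightarrow> \<not> same_sheet G v w"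
    "\<And>w. w \<in> words \<Longrightarrow> \<exists>v\<in>V. same_sheet G w v"
    by (rule sheet_representatives) blast
  have Vw: "v \<in> words" if "v \<in> V" for v using V(2) that by blast
  have k0: "0 \<in> cut_plane" by (rule real_in_cut_plane) simp
  have "\<forall>\<^sub>F z in at 0. \<forall>v\<in>V - {[]}. sheet [] z \<noteq> sheet v z"
  proof (intro eventually_ball_finite ballI)
    fix v assume "v \<in> V - {[]}"
    then have "v \<in> V" "\<not> same_sheet G [] v" using V(4)[OF V(3), of v] by auto
    then show "\<forall>\<^sub>F z in at 0. sheet [] z \<noteq> sheet v z"
      using different_sheets[OF words_Nil Vw k0] by blast
  qed (use V(1) in simp)
  moreover have "\<forall>\<^sub>F z in at 0. \<forall>v\<in>V. \<forall>i j. (\<lambda>z. sheet v z $ i $ j) analytic_on {z}"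
  proof (intro eventually_ball_finite ballI eventually_all_finite V(1))
    fix v i j assume "v \<in> V"
    then have "(\<lambda>z. sheet v z $ i $ j) meromorphic_on cut_plane"
      using meromorphic_sheet[OF Vw] by (simp add: matrix_meromorphic_on_def)
    from meromorphic_on_imp_analytic_cosparse[OF this]
    show "\<forall>\<^sub>F z in at 0. (\<lambda>z. sheet v z $ i $ j) analytic_on {z}"
      using k0 unfolding eventually_cosparse_open_eq[OF open_cut_plane] by blast
  qed
  moreover have "\<forall>\<^sub>F z in at 0. det (sheet [] z) \<noteq> 0" by (rule det_sheet[OF words_Nil k0])
  moreover have "\<forall>\<^sub>F z in at 0. z \<in> cut_plane" using open_cut_plane k0 by (rule eventually_at_in_open')
  ultimately have "\<forall>\<^sub>F z in at 0. (\<forall>v\<in>V - {[]}. sheet [] z \<noteq> sheet v z) \<and>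
      (\<forall>v\<in>V. \<forall>i j. (\<lambda>z. sheet v z $ i $ j) analytic_on {z}) \<and> det (sheet [] z) \<noteq> 0 \<and> z \<in> cut_plane"
    by eventually_elim blast
  from eventually_happens'[OF at_neq_bot this] obtain z0 where
    "(\<forall>v\<in>V - {[]}. sheet [] z0 \<noteq> sheet v z0) \<and>
      (\<forall>v\<in>V. \<forall>i j. (\<lambda>z. sheet v z $ i $ j) analytic_on {z0}) \<and> det (sheet [] z0) \<noteq> 0 \<and> z0 \<in> cut_plane"
    by (rule exE)
  then have z0: "\<And>v. v \<in> V - {[]} \<Longrightarrow> sheet [] z0 \<noteq> sheet v z0"
    "\<And>v i j. v \<in> V \<Longrightarrow> (\<lambda>z. sheet v z $ i $ j) analytic_on {z0}" "det (sheet [] z0) \<noteq> 0" "z0 \<in> cut_plane"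
    by blast+
  define s where "s v = sheet v z0" for v
  define S0 where "S0 z = (\<Sum>v\<in>V. trace_term s V (sheet v z))" for z
  have "trivial_monodromy S0" unfolding S0_def by (rule trace_trivial_monodromy[OF V(1,2,4,5)])
  moreover have "poly_growth cut_plane (\<lambda>z. S0 z $ i $ j)" for i j
    unfolding S0_def sum_component
    by (intro poly_growth_sum poly_growth_trace_term poly_growth_sheet Vw)
  ultimately obtain S where S: "rational_matrix S" "\<And>k. k \<in> cut_plane \<Longrightarrow> \<forall>\<^sub>F z in at k. S z = S0 z"
    by (rule trivial_monodromy_rational) blast
  have "S0 z0 = trace_term s V (s [])"
  proof -
    have "trace_term s V (s v) = 0" if "v \<in> V - {[]}" for v
      by (simp add: trace_term_def separator_zero[OF that V(1)] vec_eq_iff mat_component)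
    then show ?thesis
      unfolding S0_def s_def[symmetric] using sum.remove[OF V(1,3), of "\<lambda>v. trace_term s V (s v)"] by simp
  qed
  moreover have "det (trace_term s V (s [])) \<noteq> 0"
  proof -
    have d: "det (s []) \<noteq> 0" using z0(3) by (simp add: s_def)
    have "separator s V (s []) \<noteq> 0" by (rule separator_nonzero[OF _ V(1)]) (use z0(1) in \<open>auto simp: s_def\<close>)
    then have c: "separator s V (s []) * det (s []) \<noteq> 0" (is "?c \<noteq> 0") using d by simp
    have "trace_term s V (s []) = mat ?c ** matrix_inv (s [])"
      unfolding trace_term_def adjugate_eq[OF d] matrix_mul_assoc mat_mult_mat ..
    then have "trace_term s V (s []) ** (s [] ** mat (1 / ?c)) = mat ?c ** (matrix_inv (s []) ** s []) ** mat (1 / ?c)"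
      by (simp add: matrix_mul_assoc)
    also have "\<dots> = mat 1" using c by (simp add: matrix_inv(2)[OF d] mat_mult_mat)
    finally show ?thesis unfolding invertible_det_nz[symmetric] invertible_right_inverse by blast
  qed
  ultimately have nz: "det (S0 z0) \<noteq> 0" by simp
  \<comment> \<open>\<open>S\<close> agrees with \<open>S0\<close> near \<open>z0\<close> but
    perhaps not at \<open>z0\<close>, so the nonvanishing of the determinant is first spread to a
    neighbourhood by continuity.\<close>
  have "(\<lambda>z. S0 z $ i $ j) analytic_on {z0}" for i j
    unfolding S0_def sum_component
    by (intro analytic_on_sum analytic_trace_term z0(2))
  then have "(\<lambda>z. det (S0 z)) analytic_on {z0}" by (rule analytic_on_det)
  then have "isCont (\<lambda>z. det (S0 z)) z0" by (rule analytic_at_imp_isCont)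
  then have "\<forall>\<^sub>F z in at z0. det (S0 z) \<noteq> 0"
    using nz unfolding isCont_def by (rule tendsto_imp_eventually_ne)
  with S(2)[OF z0(4)] have detS: "\<forall>\<^sub>F z in at z0. det (S z) \<noteq> 0" by eventually_elim simp
  have "\<not> (\<forall>\<^sub>\<approx>k. det (S k) = 0)"
  proof
    assume "\<forall>\<^sub>\<approx>k. det (S k) = 0"
    then have "\<forall>\<^sub>F z in at z0. det (S z) = 0" by (simp add: eventually_cosparse_open_eq)
    with detS have "\<forall>\<^sub>F z in at z0. False" by eventually_elim simp
    then show False by simp
  qed
  moreover have "branch_commutative (\<lambda>k. G k ** S k)"
    unfolding branch_commutative_def eventually_cosparse_open_eq[OF open_cut_plane]
  proof (intro ballI impI)
    fix w1 w2 k assume w: "w1 \<in> words" "w2 \<in> words" and k: "k \<in> cut_plane"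
    obtain v1 where v1: "v1 \<in> V" "same_sheet G w1 v1" using V(5)[OF w(1)] by blast
    obtain v2 where v2: "v2 \<in> V" "same_sheet G w2 v2" using V(5)[OF w(2)] by blast
    have e1: "\<forall>\<^sub>F z in at k. sheet w1 z = sheet v1 z"
      using v1 k unfolding same_sheet_iff[OF w(1) Vw[OF v1(1)]] by blast
    have e2: "\<forall>\<^sub>F z in at k. sheet w2 z = sheet v2 z"
      using v2 k unfolding same_sheet_iff[OF w(2) Vw[OF v2(1)]] by blast
    have d: "\<forall>\<^sub>F z in at k. \<forall>v\<in>V. det (sheet v z) \<noteq> 0"
      using V(1) det_sheet[OF Vw k] by (simp add: eventually_ball_finite)
    have c: "\<forall>\<^sub>F z in at k. \<forall>v\<in>V. \<forall>w\<in>V. (sheet v z ** matrix_inv (sheet [] z)) ** (sheet w z ** matrix_inv (sheet [] z)) =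
        (sheet w z ** matrix_inv (sheet [] z)) ** (sheet v z ** matrix_inv (sheet [] z))"
      by (intro eventually_ball_finite V(1) ballI representatives_commute[OF V _ _ k])
    show "\<forall>\<^sub>F z in at k. branch (\<lambda>k. G k ** S k) w1 z ** branch (\<lambda>k. G k ** S k) w2 z -
        branch (\<lambda>k. G k ** S k) w2 z ** branch (\<lambda>k. G k ** S k) w1 z = 0"
      using branch_mult[OF S(1) w(1) k] branch_mult[OF S(1) w(2) k] e1 e2 d c S(2)[OF k]
    proof eventually_elim
      case (elim z)
      have dz: "\<And>v. v \<in> V \<Longrightarrow> det (sheet v z) \<noteq> 0" using elim(5) by blast
      \<comment> \<open>At a point where all sheets are invertible the adjugates turn into inverses,
        the form required by \<open>commuting_twist\<close>.\<close>
      have "S z = (\<Sum>v\<in>V. mat (separator s V (sheet v z) * det (sheet v z)) ** matrix_inv (sheet v z))"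
      proof -
        have "trace_term s V (sheet v z) = mat (separator s V (sheet v z) * det (sheet v z)) ** matrix_inv (sheet v z)"
          if "v \<in> V" for v
          unfolding trace_term_def adjugate_eq[OF dz[OF that]] matrix_mul_assoc mat_mult_mat ..
        then show ?thesis unfolding elim(7) S0_def by (intro sum.cong refl)
      qed
      from commuting_twist[of "sheet [] z" V "\<lambda>v. sheet v z", OF dz[OF V(3)] dz _ this v1(1) v2(1)] elim(6)
      have "(sheet v1 z ** S z) ** (sheet v2 z ** S z) = (sheet v2 z ** S z) ** (sheet v1 z ** S z)"
        by blast
      then show ?case unfolding elim(1-4) by simp
    qed
  qed
  ultimately show ?thesis using S(1) by blast
qed

end

theorem theorem4:
  fixes G :: "complex \<Rightarrow> complex ^ 'n ^ 'n"
    and \<epsilon> :: real and p q :: nat and \<gamma> :: "letter \<Rightarrow> real \<Rightarrow> complex"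
  assumes "\<epsilon> > 0"
    and "algebraic_matrix_on G (strip \<epsilon>)"
    and "cut_system p q \<gamma>"
    and "branch_points G = cut_system.\<tau> \<gamma> ` cut_system.letters p q"
    and "branch_points G \<inter> strip \<epsilon> = {}"
    and "\<not> (\<forall>\<^sub>\<approx>k\<in>strip \<epsilon>. det (G k) = 0)"
    and "cut_system.bypass_commutative p q \<gamma> G"
  shows "\<exists>S. rational_matrix S \<and> \<not> (\<forall>\<^sub>\<approx>k. det (S k) = 0) \<and>
             cut_system.branch_commutative p q \<gamma> (\<lambda>k. G k ** S k)"
proof -
  interpret cut_system p q \<gamma> by fact
  interpret bypass_commuting p q \<gamma> G \<epsilon>
    by unfold_locales (use assms in \<open>simp_all add: algebraic_matrix_on_def\<close>)
  show ?thesis by (rule twisted_branch_commutative)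
qed

end
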